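(* Let $p$ be an odd prime and let $k$ be an integer whose class in $\mathbb{F}_p$ is a non-square, so that $\mathbb{F}_p[t]/(t^2-k)\cong\mathbb{F}_{p^2}$. A representation group of $G = \mathbb{H}_{3}\big(\mathbb{F}_p[t]/(t^2-k)\big)$ is the following group of nilpotency class three: $$\begin{aligned}G^\star=\langle\, x_i, y_i,\ i=1,2 \mid\ & [y_1,x_1]=z_1,\ [y_1,x_2]=z_2,\ [y_2,x_1]z_2^{-1}=w_2,\ [y_2,x_2]z_1^{-k}=w_3,\\ & [z_1, y_i]=u_i,\ [z_1, x_i]=v_i,\ [z_2,x_1]=[z_1, x_2],\ [z_2,y_1]=[z_1, y_2],\ [z_2,y_2]=[z_1,y_1]^k,\\ & [z_2,x_2]=[z_1,x_1]^k,\ [x_2,x_1]=w_1,\ [y_2,y_1]=w_4,\ x_i^p=y_i^p=w_j^p=1,\ 1\le i\le 2,\ 1\le j\le 4\,\rangle.\end{aligned}$$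
   Context: $\mathbb{H}_3(R)$ is the group of upper unitriangular $3\times 3$ matrices over the commutative ring $R$. $[x,y]=x^{-1}y^{-1}xy$. Convention for presentations: all commutators between pairs of the named elements ($x_i,y_i,z_i,w_j,u_i,v_i$) which are not explicitly stated in the presentation are trivial (so in particular all $w_j,u_i,v_i$ are central and $[z_1,z_2]=1$). A representation group of a finite group $G$ is a finite group $G^\star$ having a subgroup $A\subseteq Z(G^\star)\cap [G^\star,G^\star]$ with $A\cong \mathrm{H}^2(G,\mathbb{C}^\times)$ (trivial action) and $G^\star/A\cong G$. *)

theory Defs
  imports "HOL-Algebra.Algebra" "HOL-Number_Theory.Number_Theory" Complex_Main
begin

section \<open>Group-theoretic notions\<close>

definition commutator :: "('a, 'b) monoid_scheme \<Rightarrow> 'a \<Rightarrow> 'a \<Rightarrow> 'a" where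
  "commutator G x y = inv\<^bsub>G\<^esub> x \<otimes>\<^bsub>G\<^esub> inv\<^bsub>G\<^esub> y \<otimes>\<^bsub>G\<^esub> x \<otimes>\<^bsub>G\<^esub> y"

definition center :: "('a, 'b) monoid_scheme \<Rightarrow> 'a set" where
  "center G = {z \<in> carrier G. \<forall>g \<in> carrier G. z \<otimes>\<^bsub>G\<^esub> g = g \<otimes>\<^bsub>G\<^esub> z}"

text \<open>The index is shifted: \<open>lower_central G n\<close> is the term usually written \<open>\<gamma>\<close> with index \<open>n + 1\<close>.\<close>

primrec lower_central :: "('a, 'b) monoid_scheme \<Rightarrow> nat \<Rightarrow> 'a set" where
  "lower_central G 0 = carrier G"
| "lower_central G (Suc n) =
     generate G {commutator G x y | x y. x \<in> lower_central G n \<and> y \<in> carrier G}"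

definition has_nilpotency_class :: "('a, 'b) monoid_scheme \<Rightarrow> nat \<Rightarrow> bool" where
  "has_nilpotency_class G c \<longleftrightarrow>
     lower_central G c = {\<one>\<^bsub>G\<^esub>} \<and> (\<forall>n<c. lower_central G n \<noteq> {\<one>\<^bsub>G\<^esub>})"


section \<open>Free groups and presentations\<close>

text \<open>A letter \<open>(True, s)\<close> stands for the generator \<open>s\<close> and \<open>(False, s)\<close> for its formal inverse.
  All elements of the type \<open>'s\<close> are free generators.\<close>

inductive free_eq :: "(bool \<times> 's) list \<Rightarrow> (bool \<times> 's) list \<Rightarrow> bool" where
  refl: "free_eq w w"
| sym: "free_eq v w \<Longrightarrow> free_eq w v"
| trans: "free_eq u v \<Longrightarrow> free_eq v w \<Longrightarrow> free_eq u w"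
| cancel: "free_eq (u @ [(b, s), (\<not> b, s)] @ v) (u @ v)"

definition free_class :: "(bool \<times> 's) list \<Rightarrow> (bool \<times> 's) list set" where
  "free_class w = {v. free_eq w v}"

definition free_group :: "(bool \<times> 's) list set monoid" where
  "free_group = \<lparr>carrier = range free_class,
     monoid.mult = (\<lambda>A B. {w. \<exists>u\<in>A. \<exists>v\<in>B. free_eq (u @ v) w}),
     one = free_class []\<rparr>"

definition free_gen :: "'s \<Rightarrow> (bool \<times> 's) list set" where
  "free_gen s = free_class [(True, s)]"

definition normal_closure :: "('a, 'b) monoid_scheme \<Rightarrow> 'a set \<Rightarrow> 'a set" where
  "normal_closure G S =
     generate G {g \<otimes>\<^bsub>G\<^esub> s \<otimes>\<^bsub>G\<^esub> inv\<^bsub>G\<^esub> g | g s. g \<in> carrier G \<and> s \<in> S}"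

text \<open>A pair \<open>(l, r)\<close> in \<open>E\<close> stands for the defining relation \<open>l = r\<close>.\<close>

definition presented_group ::
  "((bool \<times> 's) list set \<times> (bool \<times> 's) list set) set \<Rightarrow> (bool \<times> 's) list set set monoid" where
  "presented_group E =
     free_group Mod normal_closure free_group
       {l \<otimes>\<^bsub>free_group\<^esub> inv\<^bsub>free_group\<^esub> r | l r. (l, r) \<in> E}"


section \<open>Second cohomology with trivial action\<close>

definition complex_units :: "complex monoid" where
  "complex_units = \<lparr>carrier = - {0}, monoid.mult = (*), one = 1\<rparr>"

definition cochains2 ::
  "('a, 'c) monoid_scheme \<Rightarrow> ('b, 'd) monoid_scheme \<Rightarrow> ('a \<times> 'a \<Rightarrow> 'b) monoid" where
  "cochains2 G M = product_group (carrier G \<times> carrier G) (\<lambda>_. M)"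

definition cocycles2 ::
  "('a, 'c) monoid_scheme \<Rightarrow> ('b, 'd) monoid_scheme \<Rightarrow> ('a \<times> 'a \<Rightarrow> 'b) set" where
  "cocycles2 G M = {f \<in> carrier (cochains2 G M).
     \<forall>g\<in>carrier G. \<forall>h\<in>carrier G. \<forall>k\<in>carrier G.
       f (g, h) \<otimes>\<^bsub>M\<^esub> f (g \<otimes>\<^bsub>G\<^esub> h, k) = f (h, k) \<otimes>\<^bsub>M\<^esub> f (g, h \<otimes>\<^bsub>G\<^esub> k)}"

definition coboundaries2 ::
  "('a, 'c) monoid_scheme \<Rightarrow> ('b, 'd) monoid_scheme \<Rightarrow> ('a \<times> 'a \<Rightarrow> 'b) set" where
  "coboundaries2 G M =
     {(\<lambda>(g, h)\<in>carrier G \<times> carrier G. c h \<otimes>\<^bsub>M\<^esub> inv\<^bsub>M\<^esub> c (g \<otimes>\<^bsub>G\<^esub> h) \<otimes>\<^bsub>M\<^esub> c g)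
       | c. c \<in> carrier G \<rightarrow> carrier M}"

definition H2 ::
  "('a, 'c) monoid_scheme \<Rightarrow> ('b, 'd) monoid_scheme \<Rightarrow> ('a \<times> 'a \<Rightarrow> 'b) set monoid" where
  "H2 G M = (cochains2 G M)\<lparr>carrier := cocycles2 G M\<rparr> Mod coboundaries2 G M"

definition representation_group ::
  "('a, 'c) monoid_scheme \<Rightarrow> ('b, 'd) monoid_scheme \<Rightarrow> bool" where
  "representation_group Gs G \<longleftrightarrow>
     group G \<and> finite (carrier G) \<and> group Gs \<and> finite (carrier Gs) \<and>
     (\<exists>A. subgroup A Gs \<and> A \<subseteq> center Gs \<inter> derived Gs (carrier Gs) \<and>
          Gs\<lparr>carrier := A\<rparr> \<cong> H2 G complex_units \<and>
          Gs Mod A \<cong> G)"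


section \<open>Unitriangular matrices\<close>

definition unitriangular :: "nat \<Rightarrow> ('a, 'b) ring_scheme \<Rightarrow> (nat \<times> nat \<Rightarrow> 'a) monoid" where
  "unitriangular n R =
     \<lparr>carrier = {A \<in> {..<n} \<times> {..<n} \<rightarrow>\<^sub>E carrier R.
         (\<forall>i<n. A (i, i) = \<one>\<^bsub>R\<^esub>) \<and> (\<forall>i<n. \<forall>j<i. A (i, j) = \<zero>\<^bsub>R\<^esub>)},
      monoid.mult = (\<lambda>A B. \<lambda>(i, j)\<in>{..<n} \<times> {..<n}.
         finsum R (\<lambda>l. A (i, l) \<otimes>\<^bsub>R\<^esub> B (l, j)) {..<n}),
      one = (\<lambda>(i, j)\<in>{..<n} \<times> {..<n}. if i = j then \<one>\<^bsub>R\<^esub> else \<zero>\<^bsub>R\<^esub>)\<rparr>"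

text \<open>\<open>Rupt\<^bsub>R\<^esub> K f\<close> is the quotient of \<open>K[X]\<close> by the ideal generated by \<open>f\<close>.  Polynomials are lists of
  coefficients with the leading one first, so the list below is \<open>t^2 - k\<close>.\<close>

definition quadratic_ext :: "nat \<Rightarrow> int \<Rightarrow> int list set ring" where
  "quadratic_ext p k =
     Rupt\<^bsub>residue_ring (int p)\<^esub> (carrier (residue_ring (int p))) [1, 0, (- k) mod int p]"


section \<open>The presentation\<close>

datatype generator = X1 | X2 | Y1 | Y2

text \<open>The symbols \<open>z\<^sub>i\<close>, \<open>w\<^sub>j\<close>, \<open>u\<^sub>i\<close>, \<open>v\<^sub>i\<close> are not generators but abbreviations: the relations which
  introduce them are used as their definitions.  The second and third sets are the relations
  supplied by the convention that every commutator of two named elements not occurring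
  in the presentation is trivial.\<close>

definition Gstar_relations ::
  "nat \<Rightarrow> int \<Rightarrow> ((bool \<times> generator) list set \<times> (bool \<times> generator) list set) set" where
  "Gstar_relations p k =
    (let F = free_group; C = commutator F;
         x1 = free_gen X1; x2 = free_gen X2; y1 = free_gen Y1; y2 = free_gen Y2;
         z1 = C y1 x1; z2 = C y1 x2;
         w1 = C x2 x1;
         w2 = C y2 x1 \<otimes>\<^bsub>F\<^esub> inv\<^bsub>F\<^esub> z2;
         w3 = C y2 x2 \<otimes>\<^bsub>F\<^esub> z1 [^]\<^bsub>F\<^esub> (- k);
         w4 = C y2 y1;
         u1 = C z1 y1; u2 = C z1 y2; v1 = C z1 x1; v2 = C z1 x2
     in {(C z2 x1, C z1 x2),
         (C z2 y1, C z1 y2),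
         (C z2 y2, C z1 y1 [^]\<^bsub>F\<^esub> k),
         (C z2 x2, C z1 x1 [^]\<^bsub>F\<^esub> k)}
      \<union> {(C z1 z2, \<one>\<^bsub>F\<^esub>)}
      \<union> {(C c a, \<one>\<^bsub>F\<^esub>) | c a. c \<in> {w1, w2, w3, w4, u1, u2, v1, v2} \<and>
             a \<in> {x1, x2, y1, y2, z1, z2, w1, w2, w3, w4, u1, u2, v1, v2}}
      \<union> {(a [^]\<^bsub>F\<^esub> p, \<one>\<^bsub>F\<^esub>) | a. a \<in> {x1, x2, y1, y2, w1, w2, w3, w4}})"

definition Gstar :: "nat \<Rightarrow> int \<Rightarrow> (bool \<times> generator) list set set monoid" where
  "Gstar p k = presented_group (Gstar_relations p k)"

end

theory Submission
  imports Defs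
begin

text \<open>Write \<open>G\<close> for the Heisenberg group over \<open>R = \<F>\<^sub>p[t]/(t\<^sup>2 - k)\<close>, and \<open>z\<^sub>i\<close>, \<open>w\<^sub>j\<close>, \<open>u\<^sub>i\<close>, \<open>v\<^sub>i\<close> for
  the elements named in the presentation of \<open>G\<^sup>\<star>\<close>.  With \<open>\<tau>\<close> the class of \<open>t\<close>, the matrices
  \<open>y\<^sub>1, y\<^sub>2\<close> with entry \<open>1, \<tau>\<close> in position \<open>(1, 2)\<close> and \<open>x\<^sub>1, x\<^sub>2\<close> with entry \<open>1, \<tau>\<close> in position
  \<open>(2, 3)\<close> generate \<open>G\<close>.  They have order \<open>p\<close>, the \<open>z\<^sub>i\<close> are central, and all \<open>w\<^sub>j\<close> are
  trivial; for \<open>w\<^sub>3\<close> this is the equation \<open>\<tau>\<^sup>2 = k\<close>.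

  The central observation is that the presentation describes exactly what survives of these facts in a
  central extension of \<open>G\<close>.  If \<open>E\<close> is such an extension and the four generators are lifted to elements of
  order dividing \<open>p\<close>, then \<open>w\<^sub>j\<close>, \<open>[z\<^sub>i, x\<^sub>j]\<close> and \<open>[z\<^sub>i, y\<^sub>j]\<close>, computed from the lifts, are central in
  \<open>E\<close>.  All remaining relations follow from this: those between the \<open>[z\<^sub>i, x\<^sub>j]\<close> and \<open>[z\<^sub>i, y\<^sub>j]\<close> are
  Jacobi identities, and the powers \<open>w\<^sub>j\<^sup>p\<close> vanish by commutator collection, because the
  exponent \<open>p(p-1)/2\<close> is divisible by the odd number \<open>p\<close>.  This is \<open>cover_relations_hold\<close>, and it turns
  lifts of the generators into homomorphisms out of \<open>G\<^sup>\<star>\<close>.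

  Let \<open>A\<close> be the subgroup of \<open>G\<^sup>\<star>\<close> generated by the \<open>w\<^sub>j\<close>, \<open>u\<^sub>i\<close>, \<open>v\<^sub>i\<close>.  It is central,
  contained in the derived subgroup and of exponent \<open>p\<close>.  Modulo \<open>A\<close> every element has the form
  \<open>x\<^sub>1\<^sup>a x\<^sub>2\<^sup>b y\<^sub>1\<^sup>c y\<^sub>2\<^sup>d z\<^sub>1\<^sup>e z\<^sub>2\<^sup>f\<close>, and the image of such a word in \<open>G\<close> is trivial only if \<open>p\<close> divides all
  exponents; so \<open>A\<close> is the kernel of \<open>G\<^sup>\<star> \<rightarrow> G\<close> (\<open>kernel_eq\<close>), and \<open>G\<^sup>\<star>\<close> is finite.

  The second cohomology of \<open>G\<close> is then the character group of \<open>A\<close>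
  (\<open>transgression_isomorphism\<close>).  A character of \<open>A\<close> is sent to the class of the cocycle that it makes out of
  the extension \<open>G\<^sup>\<star>\<close>.  This is injective because \<open>A\<close> lies in the derived subgroup.  It is surjective because
  \<open>\<complex>\<^sup>\<times>\<close> is divisible: in the extension given by any cocycle, the generators have lifts of order
  dividing \<open>p\<close>, so that \<open>G\<^sup>\<star>\<close> maps to the extension.  Finally an elementary abelian group is isomorphic to
  its character group (\<open>elementary_abelian_perfect_pairing\<close>).

  The class is at most three since commutators are sent to the centre of \<open>G\<close>, and hence double commutators to
  \<open>1\<close>, that is, into the central subgroup \<open>A\<close>.  It is three because \<open>v\<^sub>1\<close> has a nontrivial image in a central extension
  of \<open>G\<close> by the additive group of \<open>R\<close> (\<open>v1_nontrivial\<close>).\<close>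

section \<open>Free groups\<close>

lemma free_eq_append_left: "free_eq v v' \<Longrightarrow> free_eq (u @ v) (u @ v')"
proof (induction rule: free_eq.induct)
  case (cancel a b s c)
  show ?case using free_eq.cancel[of "u @ a" b s c] by simp
qed (auto intro: free_eq.intros)

lemma free_eq_append_right: "free_eq u u' \<Longrightarrow> free_eq (u @ v) (u' @ v)"
proof (induction rule: free_eq.induct)
  case (cancel a b s c)
  show ?case using free_eq.cancel[of a b s "c @ v"] by simp
qed (auto intro: free_eq.intros)

lemma free_eq_append: "free_eq u u' \<Longrightarrow> free_eq v v' \<Longrightarrow> free_eq (u @ v) (u' @ v')"
  by (meson free_eq.trans free_eq_append_left free_eq_append_right)

lemma free_class_eq_iff: "free_class u = free_class v \<longleftrightarrow> free_eq u v"
  unfolding free_class_def by (auto intro: free_eq.intros)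

lemma free_group_mult: "free_class u \<otimes>\<^bsub>free_group\<^esub> free_class v = free_class (u @ v)"
  unfolding free_group_def free_class_def
  by (auto intro: free_eq.intros free_eq_append)

lemma free_group_one: "\<one>\<^bsub>free_group\<^esub> = free_class []"
  by (simp add: free_group_def)

lemma free_group_carrier: "carrier free_group = range free_class"
  by (simp add: free_group_def)

definition inv_word :: "(bool \<times> 's) list \<Rightarrow> (bool \<times> 's) list" where
  "inv_word w = map (\<lambda>(b, s). (\<not> b, s)) (rev w)"

lemma inv_word_cancel: "free_eq (inv_word w @ w) []"
proof (induction w)
  case (Cons a w)
  obtain b s where a: "a = (b, s)" by fastforce
  have "inv_word (a # w) @ a # w = inv_word w @ [(\<not> b, s), (\<not> \<not> b, s)] @ w"
    by (simp add: inv_word_def a)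
  then have "free_eq (inv_word (a # w) @ a # w) (inv_word w @ w)"
    using free_eq.cancel[of "inv_word w" "\<not> b" s w] by (simp add: a)
  with Cons show ?case by (blast intro: free_eq.trans)
qed (simp add: inv_word_def free_eq.refl)

lemma group_free_group: "group free_group"
proof (rule groupI)
  fix x assume "x \<in> carrier (free_group :: (bool \<times> 's) list set monoid)"
  then obtain w :: "(bool \<times> 's) list" where "x = free_class w" by (auto simp: free_group_carrier)
  then show "\<exists>y\<in>carrier free_group. y \<otimes>\<^bsub>free_group\<^esub> x = \<one>\<^bsub>free_group\<^esub>"
    by (intro bexI[of _ "free_class (inv_word w)"])
      (auto simp: free_group_mult free_group_one free_group_carrier free_class_eq_iff inv_word_cancel)
qed (auto simp: free_group_carrier free_group_mult free_group_one)

lemma free_gen_closed: "free_gen s \<in> carrier free_group"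
  by (simp add: free_gen_def free_group_carrier)

lemma free_class_Cons:
  "free_class ((b, s) # w) =
    (if b then free_gen s else inv\<^bsub>free_group\<^esub> (free_gen s)) \<otimes>\<^bsub>free_group\<^esub> free_class w"
proof -
  interpret F: group "free_group :: (bool \<times> 's) list set monoid" by (rule group_free_group)
  have "free_class [(False, s)] \<otimes>\<^bsub>free_group\<^esub> free_gen s = \<one>\<^bsub>free_group\<^esub>"
    using free_eq.cancel[of "[]" False s "[]"]
    by (simp add: free_gen_def free_group_mult free_group_one free_class_eq_iff)
  then have "inv\<^bsub>free_group\<^esub> (free_gen s) = free_class [(False, s)]"
    by (rule F.inv_equality) (auto simp: free_group_carrier free_gen_def)
  then show ?thesis
    by (simp add: free_gen_def free_group_mult)
qed

lemma free_group_generated: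
  "generate free_group (range free_gen) = carrier (free_group :: (bool \<times> 's) list set monoid)"
proof -
  interpret F: group "free_group :: (bool \<times> 's) list set monoid" by (rule group_free_group)
  have "free_class w \<in> generate free_group (range free_gen)" for w :: "(bool \<times> 's) list"
  proof (induction w)
    case Nil show ?case by (metis free_group_one generate.one)
  next
    case (Cons a w)
    then show ?case
      by (cases a) (auto simp: free_class_Cons intro!: generate.eng intro: generate.incl generate.inv)
  qed
  moreover have "generate free_group (range free_gen) \<subseteq> carrier (free_group :: (bool \<times> 's) list set monoid)"
    by (rule F.generate_incl) (auto simp: free_gen_closed)
  ultimately show ?thesis by (auto simp: free_group_carrier)
qed

primrec word_value :: "('a, 'b) monoid_scheme \<Rightarrow> ('s \<Rightarrow> 'a) \<Rightarrow> (bool \<times> 's) list \<Rightarrow> 'a" where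
  "word_value H \<phi> [] = \<one>\<^bsub>H\<^esub>"
| "word_value H \<phi> (a # w) = (if fst a then \<phi> (snd a) else inv\<^bsub>H\<^esub> \<phi> (snd a)) \<otimes>\<^bsub>H\<^esub> word_value H \<phi> w"

context group begin

lemma word_value_closed: "range \<phi> \<subseteq> carrier G \<Longrightarrow> word_value G \<phi> w \<in> carrier G"
  by (induction w) auto

lemma word_value_append:
  "range \<phi> \<subseteq> carrier G \<Longrightarrow> word_value G \<phi> (u @ v) = word_value G \<phi> u \<otimes> word_value G \<phi> v"
proof (induction u)
  case (Cons a u)
  moreover have "\<phi> (snd a) \<in> carrier G" using Cons by auto
  ultimately show ?case by (simp add: word_value_closed m_assoc)
qed (simp add: word_value_closed)

lemma word_value_cong:
  assumes "range \<phi> \<subseteq> carrier G" "free_eq u v"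
  shows "word_value G \<phi> u = word_value G \<phi> v"
  using assms(2)
proof (induction rule: free_eq.induct)
  case (cancel u b s v)
  have s: "\<phi> s \<in> carrier G" using assms by auto
  have "word_value G \<phi> ([(b, s), (\<not> b, s)] @ v) = word_value G \<phi> v"
    using s by (simp add: word_value_closed[OF assms(1)] flip: m_assoc)
  then show ?case
    by (simp only: word_value_append[OF assms(1)])
qed auto

lemma free_group_lift:
  assumes "range \<phi> \<subseteq> carrier G"
  obtains h where "h \<in> hom free_group G" "\<And>s. h (free_gen s) = \<phi> s"
proof
  \<comment> \<open>All words of a class have the same value, so that any representative may be chosen.\<close>
  let ?h = "\<lambda>A. word_value G \<phi> (SOME w. w \<in> A)"
  have h: "?h (free_class w) = word_value G \<phi> w" for w
  proof -
    have "(SOME v. v \<in> free_class w) \<in> free_class w"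
      by (rule someI[of _ w]) (simp add: free_class_def free_eq.refl)
    then show ?thesis
      unfolding free_class_def using word_value_cong[OF assms] by (metis mem_Collect_eq)
  qed
  show "?h \<in> hom free_group G"
    by (rule homI)
      (auto simp: free_group_carrier free_group_mult h word_value_append[OF assms] word_value_closed[OF assms])
  show "?h (free_gen s) = \<phi> s" for s
    using assms by (auto simp: free_gen_def h intro!: r_one)
qed

end

section \<open>Presented groups\<close>

definition presented_class ::
  "((bool \<times> 's) list set \<times> (bool \<times> 's) list set) set \<Rightarrow> (bool \<times> 's) list set \<Rightarrow> (bool \<times> 's) list set set"
  where
  "presented_class E =
     r_coset free_group (normal_closure free_group
       {l \<otimes>\<^bsub>free_group\<^esub> inv\<^bsub>free_group\<^esub> r | l r. (l, r) \<in> E})"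

lemma (in group) normal_closure_normal:
  assumes "S \<subseteq> carrier G" shows "normal_closure G S \<lhd> G"
  unfolding normal_closure_def
proof (rule normal_generateI)
  show "{g \<otimes> s \<otimes> inv g | g s. g \<in> carrier G \<and> s \<in> S} \<subseteq> carrier G"
    using assms by auto
  fix h a assume "h \<in> {g \<otimes> s \<otimes> inv g | g s. g \<in> carrier G \<and> s \<in> S}" and a: "a \<in> carrier G"
  then obtain g s where gs: "g \<in> carrier G" "s \<in> S" "h = g \<otimes> s \<otimes> inv g" by auto
  then have "a \<otimes> h \<otimes> inv a = (a \<otimes> g) \<otimes> s \<otimes> inv (a \<otimes> g)"
    using a assms by (auto simp: m_assoc inv_mult_group subsetD)
  then show "a \<otimes> h \<otimes> inv a \<in> {g \<otimes> s \<otimes> inv g | g s. g \<in> carrier G \<and> s \<in> S}"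
    using a gs by (intro CollectI exI[of _ "a \<otimes> g"] exI[of _ s]) simp
qed

locale presentation =
  fixes E :: "((bool \<times> 's) list set \<times> (bool \<times> 's) list set) set"
  assumes relators_closed: "E \<subseteq> carrier free_group \<times> carrier free_group"
begin

abbreviation relators where
  "relators \<equiv> {l \<otimes>\<^bsub>free_group\<^esub> inv\<^bsub>free_group\<^esub> r | l r. (l, r) \<in> E}"

lemma normal: "normal_closure free_group relators \<lhd> free_group"
proof (rule group.normal_closure_normal[OF group_free_group])
  interpret F: group "free_group :: (bool \<times> 's) list set monoid" by (rule group_free_group)
  show "relators \<subseteq> carrier free_group" using relators_closed by auto
qed

lemma group_presented: "group (presented_group E)"
  unfolding presented_group_def by (rule normal.factorgroup_is_group[OF normal])

lemma presented_class_hom: "presented_class E \<in> hom free_group (presented_group E)"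
  unfolding presented_group_def presented_class_def by (rule normal.r_coset_hom_Mod[OF normal])

lemma presented_carrier: "carrier (presented_group E) = presented_class E ` carrier free_group"
  unfolding presented_group_def presented_class_def by (simp add: carrier_FactGroup)

lemma presented_relation:
  assumes "(l, r) \<in> E" shows "presented_class E l = presented_class E r"
proof -
  interpret N: normal "normal_closure free_group relators" free_group by (rule normal)
  have lr: "l \<in> carrier free_group" "r \<in> carrier free_group" using relators_closed assms by auto
  then have "\<one>\<^bsub>free_group\<^esub> \<otimes>\<^bsub>free_group\<^esub> (l \<otimes>\<^bsub>free_group\<^esub> inv\<^bsub>free_group\<^esub> r)
      \<otimes>\<^bsub>free_group\<^esub> inv\<^bsub>free_group\<^esub> \<one>\<^bsub>free_group\<^esub> = l \<otimes>\<^bsub>free_group\<^esub> inv\<^bsub>free_group\<^esub> r"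
    by simp
  moreover have "l \<otimes>\<^bsub>free_group\<^esub> inv\<^bsub>free_group\<^esub> r \<in> relators" using assms by blast
  ultimately have "l \<otimes>\<^bsub>free_group\<^esub> inv\<^bsub>free_group\<^esub> r \<in> normal_closure free_group relators"
    unfolding normal_closure_def
    by (intro generate.incl) (metis (mono_tags, lifting) N.one_closed mem_Collect_eq)
  from N.rcos_module_rev[OF N.is_group lr(2,1) this] show ?thesis
    unfolding presented_class_def by (rule N.repr_independence[OF _ lr(2) N.is_subgroup, symmetric])
qed

lemma presented_lift:
  assumes "group H" and h: "h \<in> hom free_group H" and "\<And>l r. (l, r) \<in> E \<Longrightarrow> h l = h r"
  obtains g where "g \<in> hom (presented_group E) H"
    "\<And>w. w \<in> carrier free_group \<Longrightarrow> g (presented_class E w) = h w"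
proof -
  interpret h: group_hom free_group H h
    using assms group_free_group by (simp add: group_hom_def group_hom_axioms_def)
  have "normal_closure free_group relators \<subseteq> kernel free_group H h"
    unfolding normal_closure_def
  proof (rule h.G.generate_subgroup_incl[OF _ h.subgroup_kernel], clarsimp)
    fix g l r assume g: "g \<in> carrier (free_group :: (bool \<times> 's) list set monoid)" "(l, r) \<in> E"
    then have "l \<in> carrier free_group" "r \<in> carrier free_group" "h l = h r"
      using relators_closed assms by auto
    then show "g \<otimes>\<^bsub>free_group\<^esub> (l \<otimes>\<^bsub>free_group\<^esub> inv\<^bsub>free_group\<^esub> r) \<otimes>\<^bsub>free_group\<^esub> inv\<^bsub>free_group\<^esub> g
        \<in> kernel free_group H h"
      using g by (simp add: kernel_def)
  qed
  from h.FactGroup_universal_kernel[OF normal this] obtain g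
    where "g \<in> hom (free_group Mod normal_closure free_group relators) H"
      "\<And>w. w \<in> carrier free_group \<Longrightarrow> g (normal_closure free_group relators #>\<^bsub>free_group\<^esub> w) = h w"
    by blast
  then show thesis
    by (intro that[of g]) (simp_all add: presented_group_def presented_class_def)
qed

lemma presented_generated:
  "generate (presented_group E) (range (\<lambda>s. presented_class E (free_gen s))) = carrier (presented_group E)"
proof -
  interpret h: group_hom free_group "presented_group E" "presented_class E"
    using group_free_group group_presented presented_class_hom
    by (simp add: group_hom_def group_hom_axioms_def)
  have "generate (presented_group E) (presented_class E ` range free_gen)
      = presented_class E ` generate free_group (range free_gen)"
    by (rule h.generate_img) (auto simp: free_gen_closed)
  then show ?thesis by (simp add: free_group_generated presented_carrier image_image)
qed

end

section \<open>Commutators with central values\<close>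

context group begin

lemma cancel_inv [simp]:
  assumes "x \<in> carrier G" "g \<in> carrier G"
  shows "x \<otimes> (inv x \<otimes> g) = g" "inv x \<otimes> (x \<otimes> g) = g"
  using assms m_assoc[of x "inv x" g] m_assoc[of "inv x" x g] by simp_all

lemma commutator_closed [simp, intro]:
  "x \<in> carrier G \<Longrightarrow> y \<in> carrier G \<Longrightarrow> commutator G x y \<in> carrier G"
  by (simp add: commutator_def)

lemma commutator_swap_mult:
  assumes "x \<in> carrier G" "y \<in> carrier G"
  shows "x \<otimes> y = y \<otimes> (x \<otimes> commutator G x y)"
proof -
  have "x \<otimes> commutator G x y = inv y \<otimes> (x \<otimes> y)"
    using assms by (simp add: commutator_def m_assoc)
  then show ?thesis using assms by simp
qed

lemma commutator_swap_assoc: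
  assumes "x \<in> carrier G" "y \<in> carrier G" "g \<in> carrier G"
  shows "x \<otimes> (y \<otimes> g) = y \<otimes> (x \<otimes> (commutator G x y \<otimes> g))"
  using commutator_swap_mult[OF assms(1,2)] assms m_assoc[of x y g] by (simp add: m_assoc)

lemma commutator_eqI:
  assumes "x \<in> carrier G" "y \<in> carrier G" "z \<in> carrier G" "x \<otimes> y = y \<otimes> (x \<otimes> z)"
  shows "commutator G x y = z"
proof -
  have "y \<otimes> (x \<otimes> commutator G x y) = y \<otimes> (x \<otimes> z)"
    using assms(4) commutator_swap_mult[OF assms(1,2)] by simp
  then show ?thesis using assms by simp
qed

lemma commutator_eq_one_iff:
  assumes "x \<in> carrier G" "y \<in> carrier G"
  shows "commutator G x y = \<one> \<longleftrightarrow> x \<otimes> y = y \<otimes> x"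
  using commutator_swap_mult[OF assms] commutator_eqI[OF assms one_closed] assms by auto

lemma commutator_one [simp]:
  "x \<in> carrier G \<Longrightarrow> commutator G x \<one> = \<one>" "x \<in> carrier G \<Longrightarrow> commutator G \<one> x = \<one>"
  by (simp_all add: commutator_eq_one_iff)

lemma commutator_flip:
  "x \<in> carrier G \<Longrightarrow> y \<in> carrier G \<Longrightarrow> commutator G y x = inv (commutator G x y)"
  by (simp add: commutator_def inv_mult_group m_assoc)

lemma centerD: "z \<in> center G \<Longrightarrow> g \<in> carrier G \<Longrightarrow> z \<otimes> g = g \<otimes> z"
  and center_closed: "z \<in> center G \<Longrightarrow> z \<in> carrier G"
  by (auto simp: center_def)

lemma center_subgroup: "subgroup (center G) G"
proof (rule subgroupI)
  show "center G \<subseteq> carrier G" "center G \<noteq> {}" by (auto simp: center_def intro!: exI[of _ \<one>])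
next
  fix a assume a: "a \<in> center G"
  have "inv a \<otimes> g = g \<otimes> inv a" if g: "g \<in> carrier G" for g
  proof -
    have "inv a \<otimes> g = inv a \<otimes> (g \<otimes> a) \<otimes> inv a"
      using center_closed[OF a] g by (simp add: m_assoc)
    also have "\<dots> = g \<otimes> inv a"
      using centerD[OF a g, symmetric] center_closed[OF a] g by (simp add: m_assoc)
    finally show ?thesis .
  qed
  then show "inv a \<in> center G" using center_closed[OF a] by (simp add: center_def)
next
  fix a b assume a: "a \<in> center G" and b: "b \<in> center G"
  note cl = center_closed[OF a] center_closed[OF b]
  have "a \<otimes> b \<otimes> g = g \<otimes> (a \<otimes> b)" if g: "g \<in> carrier G" for g
  proof -
    have "a \<otimes> b \<otimes> g = a \<otimes> g \<otimes> b" using centerD[OF b g] cl g by (simp add: m_assoc)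
    then show ?thesis using centerD[OF a g] cl g by (simp add: m_assoc)
  qed
  then show "a \<otimes> b \<in> center G" using cl by (simp add: center_def)
qed

lemmas center_mult = subgroup.m_closed[OF center_subgroup]
  and center_inv = subgroup.m_inv_closed[OF center_subgroup]
  and center_one = subgroup.one_closed[OF center_subgroup]

lemma center_nat_pow: "z \<in> center G \<Longrightarrow> z [^] (n::nat) \<in> center G"
  by (induction n) (auto intro: center_mult center_one)

lemma center_int_pow: "z \<in> center G \<Longrightarrow> z [^] (n::int) \<in> center G"
  by (cases n rule: int_cases2)
    (simp_all add: int_pow_int int_pow_neg_int center_closed center_inv center_nat_pow)

lemma commutator_center: "z \<in> center G \<Longrightarrow> g \<in> carrier G \<Longrightarrow> commutator G z g = \<one>"
  by (simp add: commutator_eq_one_iff centerD center_closed)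

text \<open>Moving \<open>a\<close> to the left through \<open>c d\<close> leaves \<open>[c, a]\<close> between \<open>c\<close> and \<open>d\<close>; being central, it can be
  moved to the end.\<close>

lemma commutator_mult_left:
  assumes "c \<in> carrier G" "d \<in> carrier G" "a \<in> carrier G" "commutator G c a \<in> center G"
  shows "commutator G (c \<otimes> d) a = commutator G c a \<otimes> commutator G d a"
proof (rule commutator_eqI)
  have "c \<otimes> d \<otimes> a = c \<otimes> (a \<otimes> (d \<otimes> commutator G d a))"
    using assms by (simp add: m_assoc commutator_swap_mult[of d a])
  also have "\<dots> = a \<otimes> (c \<otimes> (commutator G c a \<otimes> (d \<otimes> commutator G d a)))"
    using assms by (simp add: commutator_swap_assoc[of c a])
  also have "\<dots> = a \<otimes> (c \<otimes> ((commutator G c a \<otimes> d) \<otimes> commutator G d a))"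
    using assms by (simp add: m_assoc)
  also have "\<dots> = a \<otimes> (c \<otimes> d \<otimes> (commutator G c a \<otimes> commutator G d a))"
    unfolding centerD[OF assms(4,2)] using assms by (simp add: m_assoc)
  finally show "c \<otimes> d \<otimes> a = a \<otimes> (c \<otimes> d \<otimes> (commutator G c a \<otimes> commutator G d a))" .
qed (use assms in auto)

lemma commutator_nat_pow_left:
  assumes "c \<in> carrier G" "a \<in> carrier G" "commutator G c a \<in> center G"
  shows "commutator G (c [^] (n::nat)) a = commutator G c a [^] n"
proof (induction n)
  case (Suc n)
  then show ?case
    using assms commutator_mult_left[of "c [^] n" c a] center_nat_pow[OF assms(3)] by simp
qed (use assms in simp)

lemma commutator_inv_left:
  assumes "c \<in> carrier G" "a \<in> carrier G" "commutator G c a \<in> center G"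
  shows "commutator G (inv c) a = inv (commutator G c a)"
proof -
  have "commutator G c a \<otimes> commutator G (inv c) a = \<one>"
    using commutator_mult_left[of c "inv c" a] assms by simp
  then have "commutator G (inv c) a \<otimes> commutator G c a = \<one>"
    by (rule inv_comm) (use assms in auto)
  from inv_equality[OF this] show ?thesis using assms by simp
qed

lemma commutator_int_pow_left:
  assumes "c \<in> carrier G" "a \<in> carrier G" "commutator G c a \<in> center G"
  shows "commutator G (c [^] (n::int)) a = commutator G c a [^] n"
  using assms center_nat_pow[OF assms(3)]
  by (cases n rule: int_cases2)
    (simp_all add: int_pow_int int_pow_neg_int commutator_nat_pow_left commutator_inv_left)

lemma commutator_nat_pow_right:
  assumes "c \<in> carrier G" "a \<in> carrier G" "commutator G c a \<in> center G"
  shows "commutator G c (a [^] (n::nat)) = commutator G c a [^] n"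
proof -
  have "commutator G a c \<in> center G" 
    using center_inv[OF assms(3)] commutator_flip[OF assms(1,2)] by simp
  then have "commutator G (a [^] n) c = commutator G a c [^] n"
    using assms by (simp add: commutator_nat_pow_left)
  then show ?thesis
    using assms by (simp add: commutator_flip[of "a [^] n" c] commutator_flip[of a c] nat_pow_inv)
qed

text \<open>This is the Hall--Witt identity in the case where the double commutators are central.  It results from
  comparing two ways of moving \<open>y\<close> to the right in \<open>y b a\<close>, before and after exchanging \<open>a\<close> and \<open>b\<close>.\<close>

lemma commutator_jacobi:
  assumes carr: "y \<in> carrier G" "a \<in> carrier G" "b \<in> carrier G"
    and cd: "c = commutator G y a" "d = commutator G y b" "c \<otimes> d = d \<otimes> c"
    and central: "commutator G b a \<in> center G" "commutator G c b \<in> center G"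
  shows "commutator G c b = commutator G d a"
proof -
  let ?w = "commutator G b a" and ?u = "commutator G c b" and ?v = "commutator G d a"
  have cl: "c \<in> carrier G" "d \<in> carrier G" "?w \<in> carrier G" "?u \<in> carrier G" "?v \<in> carrier G"
    using carr cd by auto
  note swap = commutator_swap_assoc[OF carr(1,2), folded cd] commutator_swap_assoc[OF carr(1,3), folded cd]
    commutator_swap_assoc[OF cl(1) carr(3)] commutator_swap_assoc[OF carr(3,2)]
  have "y \<otimes> (b \<otimes> a) = b \<otimes> (y \<otimes> (d \<otimes> a))"
    using carr cl by (simp add: swap(2))
  also have "\<dots> = b \<otimes> (y \<otimes> (a \<otimes> (d \<otimes> ?v)))"
    using carr cl by (simp add: commutator_swap_mult[of d a])
  also have "\<dots> = b \<otimes> (a \<otimes> (y \<otimes> (c \<otimes> (d \<otimes> ?v))))"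
    using carr cl by (simp add: swap(1))
  also have "\<dots> = a \<otimes> (b \<otimes> (?w \<otimes> (y \<otimes> (c \<otimes> (d \<otimes> ?v)))))"
    using carr cl by (simp add: swap(4))
  finally have 1: "y \<otimes> (b \<otimes> a) = a \<otimes> (b \<otimes> (?w \<otimes> (y \<otimes> (c \<otimes> (d \<otimes> ?v)))))" .
  have "y \<otimes> (b \<otimes> a) = y \<otimes> (a \<otimes> (b \<otimes> ?w))"
    using carr cl by (simp add: commutator_swap_mult[of b a])
  also have "\<dots> = a \<otimes> (y \<otimes> (c \<otimes> (b \<otimes> ?w)))"
    using carr cl by (simp add: swap(1))
  also have "\<dots> = a \<otimes> (y \<otimes> (b \<otimes> (c \<otimes> (?u \<otimes> ?w))))"
    using carr cl by (simp add: swap(3))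
  also have "\<dots> = a \<otimes> (b \<otimes> (y \<otimes> (d \<otimes> (c \<otimes> (?u \<otimes> ?w)))))"
    using carr cl by (simp add: swap(2))
  finally have "?w \<otimes> (y \<otimes> (c \<otimes> (d \<otimes> ?v))) = y \<otimes> (d \<otimes> (c \<otimes> (?u \<otimes> ?w)))"
    using 1 carr cl by simp
  moreover have "?w \<otimes> (y \<otimes> (c \<otimes> (d \<otimes> ?v))) = y \<otimes> ((c \<otimes> d) \<otimes> (?v \<otimes> ?w))"
    using centerD[OF central(1), of "y \<otimes> (c \<otimes> (d \<otimes> ?v))"] carr cl by (simp add: m_assoc)
  ultimately have "(d \<otimes> c) \<otimes> (?v \<otimes> ?w) = (d \<otimes> c) \<otimes> (?u \<otimes> ?w)"
    unfolding cd(3) using carr cl by (simp add: m_assoc)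
  then show ?thesis using carr cl by simp
qed

text \<open>Conjugation by \<open>z\<close> multiplies \<open>x\<close> and \<open>y\<close> by central elements, which have no effect on their
  commutator.\<close>

lemma commutator_commutes:
  assumes carr: "z \<in> carrier G" "x \<in> carrier G" "y \<in> carrier G"
    and central: "commutator G z x \<in> center G" "commutator G z y \<in> center G"
  shows "z \<otimes> commutator G y x = commutator G y x \<otimes> z"
proof -
  let ?a = "commutator G z x" and ?b = "commutator G z y" and ?t = "commutator G y x"
  have cl: "?a \<in> carrier G" "?b \<in> carrier G" "?t \<in> carrier G" using carr by auto
  have zx: "z \<otimes> (x \<otimes> g) = x \<otimes> (z \<otimes> (g \<otimes> ?a))" if g: "g \<in> carrier G" for g
    using commutator_swap_assoc[OF carr(1,2) g] unfolding centerD[OF central(1) g] .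
  have zy: "z \<otimes> (y \<otimes> g) = y \<otimes> (z \<otimes> (g \<otimes> ?b))" if g: "g \<in> carrier G" for g
    using commutator_swap_assoc[OF carr(1,3) g] unfolding centerD[OF central(2) g] .
  have "z \<otimes> (y \<otimes> x) = y \<otimes> (z \<otimes> (x \<otimes> ?b))" by (rule zy[OF carr(2)])
  also have "\<dots> = y \<otimes> (x \<otimes> (z \<otimes> (?b \<otimes> ?a)))" using zx[of ?b] cl by simp
  also have "\<dots> = x \<otimes> (y \<otimes> (?t \<otimes> (z \<otimes> (?b \<otimes> ?a))))"
    by (rule commutator_swap_assoc) (use carr cl in auto)
  finally have 1: "z \<otimes> (y \<otimes> x) = x \<otimes> (y \<otimes> (?t \<otimes> (z \<otimes> (?b \<otimes> ?a))))" .
  have "z \<otimes> (y \<otimes> x) = z \<otimes> (x \<otimes> (y \<otimes> ?t))"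
    using carr by (simp add: commutator_swap_mult[of y x])
  also have "\<dots> = x \<otimes> (z \<otimes> (y \<otimes> (?t \<otimes> ?a)))"
    using carr cl by (simp add: zx m_assoc)
  also have "\<dots> = x \<otimes> (y \<otimes> (z \<otimes> (?t \<otimes> (?a \<otimes> ?b))))"
    using carr cl by (simp add: zy m_assoc)
  also have "?a \<otimes> ?b = ?b \<otimes> ?a" by (rule centerD[OF central(1) cl(2)])
  finally have "(?t \<otimes> z) \<otimes> (?b \<otimes> ?a) = (z \<otimes> ?t) \<otimes> (?b \<otimes> ?a)"
    using 1 carr cl by (simp add: m_assoc)
  then show ?thesis using carr cl by simp
qed

text \<open>The \<open>n\<close> factors \<open>x\<close> pass \<open>y\<close> one after the other.  The one that comes in position \<open>i + 1\<close> also
  passes the \<open>i\<close> factors \<open>z\<close> that are already there, and each of these exchanges contributes one \<open>[z, x]\<close>.\<close>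

lemma commutator_collect:
  assumes carr: "x \<in> carrier G" "y \<in> carrier G" and z: "z = commutator G y x"
    and central: "commutator G z x \<in> center G"
  shows "y \<otimes> x [^] (n::nat) = x [^] n \<otimes> y \<otimes> z [^] n \<otimes> commutator G z x [^] (n * (n - 1) div 2)"
proof (induction n)
  case (Suc n)
  let ?v = "commutator G z x" and ?k = "n * (n - 1) div 2"
  have cl: "z \<in> carrier G" "?v \<in> carrier G" using carr z by auto
  have k: "Suc n * (Suc n - 1) div 2 = n + ?k" by (cases n) (auto simp: algebra_simps)
  have "y \<otimes> x [^] Suc n = (y \<otimes> x [^] n) \<otimes> x"
    using carr by (simp add: m_assoc)
  also have "\<dots> = x [^] n \<otimes> (y \<otimes> (z [^] n \<otimes> (?v [^] ?k \<otimes> x)))"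
    unfolding Suc using carr cl by (simp add: m_assoc)
  also have "?v [^] ?k \<otimes> x = x \<otimes> ?v [^] ?k"
    by (rule centerD[OF center_nat_pow[OF central] carr(1)])
  also have "z [^] n \<otimes> (x \<otimes> ?v [^] ?k) = x \<otimes> (z [^] n \<otimes> (?v [^] n \<otimes> ?v [^] ?k))"
    using commutator_swap_assoc[of "z [^] n" x "?v [^] ?k"]
      commutator_nat_pow_left[OF cl(1) carr(1) central] carr cl by simp
  also have "y \<otimes> (x \<otimes> (z [^] n \<otimes> (?v [^] n \<otimes> ?v [^] ?k)))
      = x \<otimes> (y \<otimes> (z \<otimes> (z [^] n \<otimes> (?v [^] n \<otimes> ?v [^] ?k))))"
    unfolding z by (rule commutator_swap_assoc) (use carr cl in auto)
  also have "x [^] n \<otimes> (x \<otimes> (y \<otimes> (z \<otimes> (z [^] n \<otimes> (?v [^] n \<otimes> ?v [^] ?k)))))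
      = (x [^] n \<otimes> x) \<otimes> (y \<otimes> ((z \<otimes> z [^] n) \<otimes> (?v [^] n \<otimes> ?v [^] ?k)))"
    using carr cl by (simp add: m_assoc del: nat_pow_Suc)
  also have "\<dots> = x [^] Suc n \<otimes> y \<otimes> z [^] Suc n \<otimes> ?v [^] (n + ?k)"
    unfolding nat_pow_mult[OF cl(2)] nat_pow_Suc2[OF cl(1), symmetric] nat_pow_Suc[of x n, symmetric]
    using carr cl by (simp add: m_assoc del: nat_pow_Suc)
  finally show ?case unfolding k .
qed (use carr z in auto)

lemma commutator_pow_eq_one:
  assumes "x \<in> carrier G" "y \<in> carrier G" "x [^] p = \<one>" "commutator G y x \<in> center G"
  shows "commutator G y x [^] (p::nat) = \<one>"
  using commutator_nat_pow_right[OF assms(2,1,4), of p] assms by simp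

text \<open>Collecting \<open>y x\<^sup>p\<close> gives \<open>z\<^sup>p\<close> times the power of \<open>[z, x]\<close> with exponent \<open>p(p-1)/2\<close>, which is a
  multiple of \<open>p\<close> since \<open>p\<close> is odd.  Only this binomial coefficient enters, so that the prime \<open>3\<close> is
  covered although the nilpotency class reaches \<open>p\<close> there.\<close>

lemma commutator_odd_pow_eq_one:
  assumes carr: "x \<in> carrier G" "y \<in> carrier G" and z: "z = commutator G y x"
    and central: "commutator G z x \<in> center G" and p: "odd p" "x [^] p = \<one>"
  shows "z [^] (p::nat) = \<one>"
proof -
  let ?v = "commutator G z x"
  have cl: "z \<in> carrier G" "?v \<in> carrier G" using carr z by auto
  obtain m where m: "p - 1 = 2 * m" using p by (auto elim: oddE)
  have "?v [^] (p * (p - 1) div 2) = (?v [^] p) [^] m"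
    unfolding m using cl by (simp add: nat_pow_pow)
  then have v: "?v [^] (p * (p - 1) div 2) = \<one>"
    using commutator_pow_eq_one[OF carr(1) cl(1) p(2) central] by simp
  have "y \<otimes> z [^] p = y"
    using commutator_collect[OF carr z central, of p] unfolding v p(2) using carr cl by simp
  then show ?thesis using carr cl by simp
qed

end

section \<open>The relations of the presentation in an arbitrary group\<close>

text \<open>The relations are stated for four elements of an arbitrary group \<open>F\<close>.  They are assembled from sets of
  elements, so that the effect of a homomorphism on them is the formation of images.\<close>

definition cover_centrals :: "('a, 'b) monoid_scheme \<Rightarrow> int \<Rightarrow> 'a \<Rightarrow> 'a \<Rightarrow> 'a \<Rightarrow> 'a \<Rightarrow> 'a set" where
  "cover_centrals F k x1 x2 y1 y2 =
    (let C = commutator F; z1 = C y1 x1; z2 = C y1 x2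
     in {C x2 x1, C y2 x1 \<otimes>\<^bsub>F\<^esub> inv\<^bsub>F\<^esub> z2, C y2 x2 \<otimes>\<^bsub>F\<^esub> z1 [^]\<^bsub>F\<^esub> (- k), C y2 y1,
         C z1 y1, C z1 y2, C z1 x1, C z1 x2})"

definition cover_named :: "('a, 'b) monoid_scheme \<Rightarrow> int \<Rightarrow> 'a \<Rightarrow> 'a \<Rightarrow> 'a \<Rightarrow> 'a \<Rightarrow> 'a set" where
  "cover_named F k x1 x2 y1 y2 =
    {x1, x2, y1, y2, commutator F y1 x1, commutator F y1 x2} \<union> cover_centrals F k x1 x2 y1 y2"

definition cover_torsion :: "('a, 'b) monoid_scheme \<Rightarrow> int \<Rightarrow> 'a \<Rightarrow> 'a \<Rightarrow> 'a \<Rightarrow> 'a \<Rightarrow> 'a set" where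
  "cover_torsion F k x1 x2 y1 y2 =
    (let C = commutator F; z1 = C y1 x1; z2 = C y1 x2
     in {x1, x2, y1, y2, C x2 x1, C y2 x1 \<otimes>\<^bsub>F\<^esub> inv\<^bsub>F\<^esub> z2, C y2 x2 \<otimes>\<^bsub>F\<^esub> z1 [^]\<^bsub>F\<^esub> (- k), C y2 y1})"

definition cover_jacobi :: "('a, 'b) monoid_scheme \<Rightarrow> int \<Rightarrow> 'a \<Rightarrow> 'a \<Rightarrow> 'a \<Rightarrow> 'a \<Rightarrow> ('a \<times> 'a) set" where
  "cover_jacobi F k x1 x2 y1 y2 =
    (let C = commutator F; z1 = C y1 x1; z2 = C y1 x2
     in {(C z2 x1, C z1 x2),
         (C z2 y1, C z1 y2),
         (C z2 y2, C z1 y1 [^]\<^bsub>F\<^esub> k),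
         (C z2 x2, C z1 x1 [^]\<^bsub>F\<^esub> k)} \<union> {(C z1 z2, \<one>\<^bsub>F\<^esub>)})"

definition cover_relations ::
  "('a, 'b) monoid_scheme \<Rightarrow> nat \<Rightarrow> int \<Rightarrow> 'a \<Rightarrow> 'a \<Rightarrow> 'a \<Rightarrow> 'a \<Rightarrow> ('a \<times> 'a) set" where
  "cover_relations F p k x1 x2 y1 y2 = cover_jacobi F k x1 x2 y1 y2
      \<union> (\<lambda>(c, a). (commutator F c a, \<one>\<^bsub>F\<^esub>)) ` (cover_centrals F k x1 x2 y1 y2 \<times> cover_named F k x1 x2 y1 y2)
      \<union> (\<lambda>a. (a [^]\<^bsub>F\<^esub> p, \<one>\<^bsub>F\<^esub>)) ` cover_torsion F k x1 x2 y1 y2"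

lemma Gstar_relations_eq:
  "Gstar_relations p k =
    cover_relations free_group p k (free_gen X1) (free_gen X2) (free_gen Y1) (free_gen Y2)"
proof -
  have 1: "{(f c a, e) | c a. c \<in> S \<and> a \<in> T} = (\<lambda>(c, a). (f c a, e)) ` (S \<times> T)"
    for f :: "'b \<Rightarrow> 'c \<Rightarrow> 'd" and e :: 'e and S T by auto
  have 2: "{(f a, e) | a. a \<in> S} = (\<lambda>a. (f a, e)) ` S" for f :: "'b \<Rightarrow> 'd" and e :: 'e and S by auto
  have 3: "insert a (insert b (insert c (insert d (insert e (insert f B))))) = {a, b, c, d, e, f} \<union> B"
    for a b c d e f :: 'z and B by simp
  show ?thesis
    unfolding Gstar_relations_def cover_relations_def cover_jacobi_def cover_centrals_def cover_named_def
      cover_torsion_def Let_def 1 2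
    by (intro arg_cong2[where f = "(\<union>)"] HOL.refl arg_cong2[where f = "(`)"] arg_cong2[where f = "(\<times>)"] 3)
qed

context group_hom begin

lemma hom_commutator [simp]:
  "x \<in> carrier G \<Longrightarrow> y \<in> carrier G \<Longrightarrow> h (commutator G x y) = commutator H (h x) (h y)"
  by (simp add: commutator_def)

lemma cover_centrals_image:
  assumes "x1 \<in> carrier G" "x2 \<in> carrier G" "y1 \<in> carrier G" "y2 \<in> carrier G"
  shows "h ` cover_centrals G k x1 x2 y1 y2 = cover_centrals H k (h x1) (h x2) (h y1) (h y2)"
  using assms by (simp add: cover_centrals_def Let_def hom_int_pow)

lemma cover_relations_image:
  assumes "x1 \<in> carrier G" "x2 \<in> carrier G" "y1 \<in> carrier G" "y2 \<in> carrier G"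
  shows "map_prod h h ` cover_relations G p k x1 x2 y1 y2
    = cover_relations H p k (h x1) (h x2) (h y1) (h y2)"
proof -
  have comm: "map_prod h h ` (\<lambda>(c, a). (commutator G c a, \<one>)) ` (S \<times> T)
      = (\<lambda>(c, a). (commutator H c a, \<one>\<^bsub>H\<^esub>)) ` (h ` S \<times> h ` T)"
    if "S \<subseteq> carrier G" "T \<subseteq> carrier G" for S T
  proof -
    have "h ` S \<times> h ` T = map_prod h h ` (S \<times> T)" by force
    then show ?thesis using that by 
      (simp only: image_image, intro image_cong HOL.refl, clarsimp, intro hom_commutator, blast+)
  qed
  have pow: "map_prod h h ` (\<lambda>a. (a [^] p, \<one>)) ` S = (\<lambda>a. (a [^]\<^bsub>H\<^esub> p, \<one>\<^bsub>H\<^esub>)) ` h ` S"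
    if "S \<subseteq> carrier G" for S
    unfolding image_image using that by (intro image_cong) (auto simp: hom_nat_pow)
  have sub: "cover_centrals G k x1 x2 y1 y2 \<subseteq> carrier G" "cover_named G k x1 x2 y1 y2 \<subseteq> carrier G"
    "cover_torsion G k x1 x2 y1 y2 \<subseteq> carrier G"
    using assms by (simp_all add: cover_centrals_def cover_named_def cover_torsion_def Let_def)
  note cent = cover_centrals_image[OF assms]
  have named: "h ` cover_named G k x1 x2 y1 y2 = cover_named H k (h x1) (h x2) (h y1) (h y2)"
    unfolding cover_named_def image_Un cent using assms by simp
  have tors: "h ` cover_torsion G k x1 x2 y1 y2 = cover_torsion H k (h x1) (h x2) (h y1) (h y2)"
    using assms by (simp add: cover_torsion_def Let_def hom_int_pow)
  have jac: "map_prod h h ` cover_jacobi G k x1 x2 y1 y2 = cover_jacobi H k (h x1) (h x2) (h y1) (h y2)"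
    using assms by (simp add: cover_jacobi_def Let_def hom_int_pow)
  show ?thesis
    unfolding cover_relations_def image_Un jac comm[OF sub(1,2)] pow[OF sub(3)] cent named tors ..
qed

end

text \<open>The hypotheses say that modulo the centre the four elements satisfy the relations of the Heisenberg group.
  They hold both for suitable lifts of the generators to a central extension of the Heisenberg group and for
  the generators of the presented group itself.\<close>

locale heisenberg_cover = group +
  fixes p :: nat and k :: int and x1 x2 y1 y2
  assumes closed [simp]: "x1 \<in> carrier G" "x2 \<in> carrier G" "y1 \<in> carrier G" "y2 \<in> carrier G"
    and odd: "odd p"
    and pow: "x1 [^] p = \<one>" "x2 [^] p = \<one>" "y1 [^] p = \<one>" "y2 [^] p = \<one>"
    and w_central: "commutator G x2 x1 \<in> center G"
      "commutator G y2 x1 \<otimes> inv commutator G y1 x2 \<in> center G"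
      "commutator G y2 x2 \<otimes> commutator G y1 x1 [^] (- k) \<in> center G"
      "commutator G y2 y1 \<in> center G"
    and z_central: "\<And>z a. z \<in> {commutator G y1 x1, commutator G y1 x2} \<Longrightarrow> a \<in> {x1, x2, y1, y2}
      \<Longrightarrow> commutator G z a \<in> center G"
begin

definition "z1 = commutator G y1 x1"
definition "z2 = commutator G y1 x2"
definition "w2 = commutator G y2 x1 \<otimes> inv z2"
definition "w3 = commutator G y2 x2 \<otimes> z1 [^] (- k)"

lemma z_closed [simp]: "z1 \<in> carrier G" "z2 \<in> carrier G"
  by (auto simp: z1_def z2_def)

lemma w23_central: "w2 \<in> center G" "w3 \<in> center G"
  using w_central by (auto simp: w2_def w3_def z1_def z2_def)

lemma w23_closed [simp]: "w2 \<in> carrier G" "w3 \<in> carrier G"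
  using w23_central center_closed by auto

lemma z_gen_central:
  "z \<in> {z1, z2} \<Longrightarrow> a \<in> {x1, x2, y1, y2} \<Longrightarrow> commutator G z a \<in> center G"
  using z_central by (simp add: z1_def z2_def)

lemma y2x1: "commutator G y2 x1 = w2 \<otimes> z2"
  by (simp add: w2_def m_assoc)

lemma y2x2: "commutator G y2 x2 = w3 \<otimes> z1 [^] k"
  by (simp add: w3_def m_assoc int_pow_neg)

lemma z_commute: "z1 \<otimes> z2 = z2 \<otimes> z1"
  using commutator_commutes[of z1 x2 y1] z_gen_central by (simp add: z2_def[symmetric])

lemma commutator_y2x1:
  assumes "a \<in> {x1, x2, y1, y2}" shows "commutator G (commutator G y2 x1) a = commutator G z2 a"
proof -
  have "a \<in> carrier G" using assms by auto
  then show ?thesis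
    using assms w23_central by (simp add: y2x1 commutator_mult_left commutator_center center_one)
qed

lemma commutator_y2x2:
  assumes "a \<in> {x1, x2, y1, y2}" shows "commutator G (commutator G y2 x2) a = commutator G z1 a [^] k"
proof -
  have "a \<in> carrier G" using assms by auto
  then show ?thesis
    using assms w23_central z_gen_central[of z1 a]
    by (simp add: y2x2 commutator_mult_left commutator_center center_one commutator_int_pow_left)
qed

text \<open>As \<open>[y\<^sub>2, x\<^sub>1]\<close> agrees with \<open>z\<^sub>2\<close> up to the centre, its commutators with the generators are central too.\<close>

lemma y2x_commute: "commutator G y2 x1 \<otimes> commutator G y2 x2 = commutator G y2 x2 \<otimes> commutator G y2 x1"
  by (rule commutator_commutes) (auto simp: commutator_y2x1 intro: z_gen_central)

text \<open>These are the Jacobi identities for \<open>y\<^sub>1, x\<^sub>1, x\<^sub>2\<close> and for \<open>y\<^sub>2, x\<^sub>1, x\<^sub>2\<close>.  The remaining two triples of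
  generators give the corresponding relations for \<open>y\<^sub>1\<close> and \<open>y\<^sub>2\<close> below.\<close>

lemma z2_x: "commutator G z2 x1 = commutator G z1 x2" "commutator G z2 x2 = commutator G z1 x1 [^] k"
proof -
  show "commutator G z2 x1 = commutator G z1 x2"
    by (rule HOL.sym, rule commutator_jacobi[of y1 x1 x2])
      (use w_central z_gen_central in \<open>auto simp: z_commute simp flip: z1_def z2_def\<close>)
  have "commutator G (commutator G y2 x1) x2 = commutator G (commutator G y2 x2) x1"
    by (rule commutator_jacobi[of y2 x1 x2])
      (use w_central z_gen_central[of z2 x2] in \<open>auto simp: y2x_commute commutator_y2x1\<close>)
  then show "commutator G z2 x2 = commutator G z1 x1 [^] k"
    by (simp add: commutator_y2x1 commutator_y2x2)
qed

lemma commute_inv: "a \<in> carrier G \<Longrightarrow> b \<in> carrier G \<Longrightarrow> a \<otimes> b = b \<otimes> a \<Longrightarrow> inv a \<otimes> inv b = inv b \<otimes> inv a"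
  by (metis inv_mult_group)

lemma z2_y: "commutator G z2 y1 = commutator G z1 y2" "commutator G z2 y2 = commutator G z1 y1 [^] k"
proof -
  have w4: "commutator G y2 y1 \<in> center G" by (rule w_central)
  have c: "commutator G x1 y1 = inv z1" "commutator G x2 y1 = inv z2"
    "commutator G x1 y2 = inv commutator G y2 x1" "commutator G x2 y2 = inv commutator G y2 x2"
    by (simp_all add: z1_def z2_def flip: commutator_flip)
  have central: "commutator G (commutator G y2 x1) y1 \<in> center G" "commutator G (commutator G y2 x2) y1 \<in> center G"
    by (auto simp: commutator_y2x1 commutator_y2x2 intro!: z_gen_central center_int_pow)
  have z1c: "z1 \<otimes> commutator G y2 x1 = commutator G y2 x1 \<otimes> z1"
    by (rule commutator_commutes) (auto intro: z_gen_central)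
  have z2c: "z2 \<otimes> commutator G y2 x2 = commutator G y2 x2 \<otimes> z2"
    by (rule commutator_commutes) (auto intro: z_gen_central)
  have "commutator G (inv z1) y2 = commutator G (inv commutator G y2 x1) y1"
    by (rule commutator_jacobi[of x1 y1 y2])
      (use w4 z_gen_central[of z1 y2] in \<open>auto simp: c commute_inv z1c commutator_inv_left intro: center_inv\<close>)
  then have "inv (commutator G z1 y2) = inv (commutator G z2 y1)"
    using central z_gen_central[of z1 y2] by (simp add: commutator_inv_left commutator_y2x1)
  then show "commutator G z2 y1 = commutator G z1 y2"
    by (metis commutator_closed inv_inv z_closed closed(3,4))
  have "commutator G (inv z2) y2 = commutator G (inv commutator G y2 x2) y1"
    by (rule commutator_jacobi[of x2 y1 y2])
      (use w4 z_gen_central[of z2 y2] in \<open>auto simp: c commute_inv z2c commutator_inv_left intro: center_inv\<close>)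
  then have "inv (commutator G z2 y2) = inv (commutator G z1 y1 [^] k)"
    using central z_gen_central[of z2 y2] by (simp add: commutator_inv_left commutator_y2x2)
  then show "commutator G z2 y2 = commutator G z1 y1 [^] k"
    by (metis commutator_closed inv_inv z_closed closed(3,4) int_pow_closed)
qed

lemma z_pow: "z1 [^] p = \<one>" "z2 [^] p = \<one>"
proof -
  show "z1 [^] p = \<one>"
    by (rule commutator_odd_pow_eq_one[OF _ _ z1_def]) (auto simp: odd pow intro: z_gen_central)
  show "z2 [^] p = \<one>"
    by (rule commutator_odd_pow_eq_one[OF _ _ z2_def]) (auto simp: odd pow intro: z_gen_central)
qed

lemma z_gen_pow: "z \<in> {z1, z2} \<Longrightarrow> a \<in> {x1, x2, y1, y2} \<Longrightarrow> commutator G z a [^] p = \<one>"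
  using z_gen_central[of z a] by (intro commutator_pow_eq_one) (auto simp: pow)

text \<open>The elements \<open>w\<^sub>2\<close> and \<open>w\<^sub>3\<close> are quotients of two commuting elements of exponent \<open>p\<close>; the other two are
  central commutators of generators.\<close>

lemma w_pow: "commutator G x2 x1 [^] p = \<one>" "w2 [^] p = \<one>" "w3 [^] p = \<one>" "commutator G y2 y1 [^] p = \<one>"
proof -
  show "commutator G x2 x1 [^] p = \<one>" "commutator G y2 y1 [^] p = \<one>"
    using w_central by (auto intro!: commutator_pow_eq_one simp: pow)
  have "commutator G y2 x1 [^] p = \<one>"
    by (rule commutator_odd_pow_eq_one[OF _ _ HOL.refl])
      (auto simp: odd pow commutator_y2x1 intro: z_gen_central)
  then show "w2 [^] p = \<one>"
    using centerD[OF w23_central(1), of z2] by (simp add: y2x1 pow_mult_distrib z_pow)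
  have "commutator G y2 x2 [^] p = \<one>"
    by (rule commutator_odd_pow_eq_one[OF _ _ HOL.refl])
      (auto simp: odd pow commutator_y2x2 intro!: z_gen_central center_int_pow)
  moreover have "(z1 [^] k) [^] p = \<one>"
    using int_pow_pow[of z1 k "int p"] int_pow_pow[of z1 "int p" k] z_pow
    by (simp add: int_pow_int mult.commute)
  ultimately show "w3 [^] p = \<one>"
    using centerD[OF w23_central(2), of "z1 [^] k"] by (simp add: y2x2 pow_mult_distrib)
qed

lemma centrals_eq:
  "cover_centrals G k x1 x2 y1 y2 = {commutator G x2 x1, w2, w3, commutator G y2 y1,
     commutator G z1 y1, commutator G z1 y2, commutator G z1 x1, commutator G z1 x2}"
  unfolding cover_centrals_def Let_def z1_def[symmetric] z2_def[symmetric]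
    w2_def[symmetric] w3_def[symmetric] ..

lemma centrals_central: "cover_centrals G k x1 x2 y1 y2 \<subseteq> center G"
  using w_central w23_central z_gen_central unfolding centrals_eq by simp

lemma centrals_pow: "c \<in> cover_centrals G k x1 x2 y1 y2 \<Longrightarrow> c [^] p = \<one>"
  using w_pow z_gen_pow unfolding centrals_eq by auto

text \<open>Every relation of the presentation is thus a consequence of the centrality assumptions and the orders of the
  four elements; this makes homomorphisms from the presented group to central extensions available.\<close>

lemma cover_relations_hold: "(l, r) \<in> cover_relations G p k x1 x2 y1 y2 \<Longrightarrow> l = r"
proof -
  have "cover_centrals G k x1 x2 y1 y2 \<subseteq> center G" by (rule centrals_central)
  moreover from this have "cover_named G k x1 x2 y1 y2 \<subseteq> carrier G"
    unfolding cover_named_def using center_closed by auto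
  ultimately have S: "commutator G c a = \<one>"
    if "c \<in> cover_centrals G k x1 x2 y1 y2" "a \<in> cover_named G k x1 x2 y1 y2" for c a
    using that commutator_center by blast
  have P: "a [^] p = \<one>" if "a \<in> cover_torsion G k x1 x2 y1 y2" for a
    using that pow w_pow
    unfolding cover_torsion_def Let_def z1_def[symmetric] z2_def[symmetric]
      w2_def[symmetric] w3_def[symmetric] by blast
  have Z: "commutator G z1 z2 = \<one>" by (simp add: commutator_eq_one_iff z_commute)
  assume "(l, r) \<in> cover_relations G p k x1 x2 y1 y2"
  then consider "(l, r) \<in> cover_jacobi G k x1 x2 y1 y2"
    | c a where "c \<in> cover_centrals G k x1 x2 y1 y2" "a \<in> cover_named G k x1 x2 y1 y2"
        "l = commutator G c a" "r = \<one>"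
    | a where "a \<in> cover_torsion G k x1 x2 y1 y2" "l = a [^] p" "r = \<one>"
    unfolding cover_relations_def by auto
  then show "l = r"
  proof cases
    case 1
    then show ?thesis
      using Z z2_x z2_y
      unfolding cover_jacobi_def Let_def z1_def[symmetric] z2_def[symmetric] by auto
  qed (use S P in auto)
qed

end

lemma (in group) centerI_generated:
  assumes S: "S \<subseteq> carrier G" "generate G S = carrier G" and c: "c \<in> carrier G"
    and commute: "\<And>s. s \<in> S \<Longrightarrow> commutator G c s = \<one>"
  shows "c \<in> center G"
proof -
  let ?Z = "{g \<in> carrier G. c \<otimes> g = g \<otimes> c}"
  have "subgroup ?Z G"
  proof (rule subgroupI)
    fix a assume a: "a \<in> ?Z"
    then have ac: "a \<in> carrier G" "inv a \<otimes> (a \<otimes> c) \<otimes> inv a = inv a \<otimes> (c \<otimes> a) \<otimes> inv a" by simp_all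
    have "c \<otimes> inv a = inv a \<otimes> (a \<otimes> c) \<otimes> inv a"
      using ac(1) c by (simp add: m_assoc)
    also have "\<dots> = inv a \<otimes> (c \<otimes> a) \<otimes> inv a" by (rule ac(2))
    also have "\<dots> = inv a \<otimes> c" using ac(1) c by (simp add: m_assoc)
    finally show "inv a \<in> ?Z" using a by simp
  next
    fix a b assume ab: "a \<in> ?Z" "b \<in> ?Z"
    then have *: "a \<in> carrier G" "b \<in> carrier G" "c \<otimes> a = a \<otimes> c" "c \<otimes> b = b \<otimes> c" by simp_all
    have "c \<otimes> (a \<otimes> b) = (c \<otimes> a) \<otimes> b" using *(1,2) c by (simp add: m_assoc)
    also have "\<dots> = a \<otimes> (c \<otimes> b)" unfolding *(3) using *(1,2) c by (simp add: m_assoc)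
    also have "\<dots> = (a \<otimes> b) \<otimes> c" unfolding *(4) using *(1,2) c by (simp add: m_assoc)
    finally show "a \<otimes> b \<in> ?Z" using ab by simp
  qed (use c in auto)
  moreover have "S \<subseteq> ?Z"
    using S(1) c commute by (auto simp: commutator_eq_one_iff subsetD)
  ultimately have "carrier G \<subseteq> ?Z"
    using generate_subgroup_incl[of S ?Z] S(2) by simp
  then show ?thesis using c by (auto simp: center_def)
qed

section \<open>Lifting the Heisenberg relations to central extensions\<close>

locale heisenberg_base = group +
  fixes p :: nat and k :: int and x1 x2 y1 y2
  assumes closed [simp]: "x1 \<in> carrier G" "x2 \<in> carrier G" "y1 \<in> carrier G" "y2 \<in> carrier G"
    and odd: "odd p"
    and commuting: "commutator G x2 x1 = \<one>" "commutator G y2 y1 = \<one>"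
    and bilinear: "commutator G y2 x1 = commutator G y1 x2"
      "commutator G y2 x2 = commutator G y1 x1 [^] k"
    and z_center: "commutator G y1 x1 \<in> center G" "commutator G y1 x2 \<in> center G"

text \<open>Each element that has to be central in the extension has trivial image in the base, by the
  relations that hold there, and the kernel is central.\<close>

lemma (in heisenberg_base) cover_of_central_extension:
  assumes "group_hom E G h" and central: "\<And>c. c \<in> carrier E \<Longrightarrow> h c = \<one> \<Longrightarrow> c \<in> center E"
    and lifts: "a1 \<in> carrier E" "a2 \<in> carrier E" "b1 \<in> carrier E" "b2 \<in> carrier E"
    and h: "h a1 = x1" "h a2 = x2" "h b1 = y1" "h b2 = y2"
    and p: "a1 [^]\<^bsub>E\<^esub> p = \<one>\<^bsub>E\<^esub>" "a2 [^]\<^bsub>E\<^esub> p = \<one>\<^bsub>E\<^esub>" "b1 [^]\<^bsub>E\<^esub> p = \<one>\<^bsub>E\<^esub>" "b2 [^]\<^bsub>E\<^esub> p = \<one>\<^bsub>E\<^esub>"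
  shows "heisenberg_cover E p k a1 a2 b1 b2"
proof -
  interpret h: group_hom E G h by fact
  show ?thesis
  proof unfold_locales
    fix z a assume z: "z \<in> {commutator E b1 a1, commutator E b1 a2}" and a: "a \<in> {a1, a2, b1, b2}"
    then have "h (commutator E z a) = commutator G (h z) (h a)" "z \<in> carrier E" "a \<in> carrier E"
      using lifts by auto
    moreover have "h z \<in> center G" using z lifts h z_center by auto
    ultimately show "commutator E z a \<in> center E"
      using commutator_center by (intro central) auto
  qed (use lifts p in \<open>auto intro!: central simp: h h.hom_int_pow commuting bilinear int_pow_neg odd\<close>)
qed

section \<open>The group with the given presentation\<close>

lemma (in group) cover_relations_closed:
  assumes "x1 \<in> carrier G" "x2 \<in> carrier G" "y1 \<in> carrier G" "y2 \<in> carrier G"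
  shows "cover_relations G p k x1 x2 y1 y2 \<subseteq> carrier G \<times> carrier G"
proof -
  have "cover_centrals G k x1 x2 y1 y2 \<subseteq> carrier G" "cover_named G k x1 x2 y1 y2 \<subseteq> carrier G"
    "cover_torsion G k x1 x2 y1 y2 \<subseteq> carrier G" "cover_jacobi G k x1 x2 y1 y2 \<subseteq> carrier G \<times> carrier G"
    using assms
    by (simp_all add: cover_centrals_def cover_named_def cover_torsion_def cover_jacobi_def Let_def)
  then show ?thesis unfolding cover_relations_def by (auto simp: subset_iff)
qed

locale gstar =
  fixes p :: nat and k :: int
  assumes odd_p: "odd p"
begin

sublocale presentation "Gstar_relations p k"
  unfolding presentation_def Gstar_relations_eq
  by (rule group.cover_relations_closed[OF group_free_group]) (rule free_gen_closed)+

definition gen :: "generator \<Rightarrow> (bool \<times> generator) list set set" where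
  "gen s = presented_class (Gstar_relations p k) (free_gen s)"

lemma group_Gstar: "group (Gstar p k)"
  unfolding Gstar_def by (rule group_presented)

lemma gen_closed: "gen s \<in> carrier (Gstar p k)"
  unfolding gen_def Gstar_def presented_carrier by (simp add: free_gen_closed)

lemma generated_Gstar: "generate (Gstar p k) {gen X1, gen X2, gen Y1, gen Y2} = carrier (Gstar p k)"
proof -
  have "(UNIV :: generator set) = {X1, X2, Y1, Y2}"
    using generator.exhaust by (intro UNIV_eq_I) (metis insert_iff)
  then have "range gen = gen ` {X1, X2, Y1, Y2}" by (rule arg_cong)
  then have "range gen = {gen X1, gen X2, gen Y1, gen Y2}" by simp
  then show ?thesis
    unfolding gen_def Gstar_def using presented_generated by simp
qed

lemma Gstar_relation:
  assumes "(l, r) \<in> cover_relations (Gstar p k) p k (gen X1) (gen X2) (gen Y1) (gen Y2)"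
  shows "l = r"
proof -
  interpret h: group_hom free_group "Gstar p k" "presented_class (Gstar_relations p k)"
    using group_free_group group_Gstar presented_class_hom
    by (simp add: group_hom_def group_hom_axioms_def Gstar_def)
  note image = h.cover_relations_image[of "free_gen X1" "free_gen X2" "free_gen Y1" "free_gen Y2" p k,
      OF free_gen_closed free_gen_closed free_gen_closed free_gen_closed, folded Gstar_relations_eq gen_def]
  from assms[folded image]
  obtain l' r' where "(l', r') \<in> Gstar_relations p k"
    "l = presented_class (Gstar_relations p k) l'" "r = presented_class (Gstar_relations p k) r'" by auto
  then show ?thesis using presented_relation by metis
qed

text \<open>The presentation declares only \<open>[z\<^sub>1, x\<^sub>i]\<close> and \<open>[z\<^sub>1, y\<^sub>i]\<close> to be central.  The Jacobi relations express
  the commutators with \<open>z\<^sub>2\<close> through them.\<close>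

lemma heisenberg_cover_Gstar:
  "heisenberg_cover (Gstar p k) p k (gen X1) (gen X2) (gen Y1) (gen Y2)"
proof -
  interpret group "Gstar p k" by (rule group_Gstar)
  let ?R = "\<lambda>A. A (Gstar p k) k (gen X1) (gen X2) (gen Y1) (gen Y2)"
  note [simp] = gen_closed
  have closed: "?R cover_centrals \<subseteq> carrier (Gstar p k)"
    by (simp add: cover_centrals_def Let_def)
  have central: "?R cover_centrals \<subseteq> center (Gstar p k)"
  proof
    fix c assume c: "c \<in> ?R cover_centrals"
    show "c \<in> center (Gstar p k)"
    proof (rule centerI_generated[OF _ generated_Gstar])
      fix s assume "s \<in> {gen X1, gen X2, gen Y1, gen Y2}"
      then have "s \<in> ?R cover_named" by (auto simp: cover_named_def)
      with c have "(commutator (Gstar p k) c s, \<one>\<^bsub>Gstar p k\<^esub>)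
          \<in> cover_relations (Gstar p k) p k (gen X1) (gen X2) (gen Y1) (gen Y2)"
        unfolding cover_relations_def by force
      then show "commutator (Gstar p k) c s = \<one>\<^bsub>Gstar p k\<^esub>" by (rule Gstar_relation)
    qed (use c closed in auto)
  qed
  have torsion: "a [^]\<^bsub>Gstar p k\<^esub> p = \<one>\<^bsub>Gstar p k\<^esub>" if "a \<in> ?R cover_torsion" for a
    by (rule Gstar_relation) (use that in \<open>auto simp: cover_relations_def\<close>)
  have jacobi: "l = r" if "(l, r) \<in> ?R cover_jacobi" for l r
    by (rule Gstar_relation) (use that in \<open>auto simp: cover_relations_def\<close>)
  let ?C = "commutator (Gstar p k)"
  let ?z1 = "?C (gen Y1) (gen X1)" and ?z2 = "?C (gen Y1) (gen X2)"
  have jac: "?C ?z2 (gen X1) = ?C ?z1 (gen X2)" "?C ?z2 (gen Y1) = ?C ?z1 (gen Y2)"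
    "?C ?z2 (gen Y2) = ?C ?z1 (gen Y1) [^]\<^bsub>Gstar p k\<^esub> k" "?C ?z2 (gen X2) = ?C ?z1 (gen X1) [^]\<^bsub>Gstar p k\<^esub> k"
    by (rule jacobi, simp add: cover_jacobi_def Let_def)+
  have central': "c \<in> center (Gstar p k)" if "c \<in> ?R cover_centrals" for c
    using central that by blast
  have v: "?C ?z1 (gen s) \<in> center (Gstar p k)" for s
    by (cases s) (auto intro!: central' simp: cover_centrals_def Let_def)
  show ?thesis
  proof unfold_locales
    fix z a assume "z \<in> {?z1, ?z2}" "a \<in> {gen X1, gen X2, gen Y1, gen Y2}"
    then show "?C z a \<in> center (Gstar p k)"
      using v center_int_pow[OF v] by (auto simp: jac)
  qed (auto intro!: torsion central' odd_p simp: cover_centrals_def cover_torsion_def Let_def)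
qed

lemma Gstar_lift:
  assumes "heisenberg_cover H p k X1' X2' Y1' Y2'"
  obtains h where "h \<in> hom (Gstar p k) H"
    "h (gen X1) = X1'" "h (gen X2) = X2'" "h (gen Y1) = Y1'" "h (gen Y2) = Y2'"
proof -
  interpret H: heisenberg_cover H p k X1' X2' Y1' Y2' by fact
  define \<phi> where "\<phi> s = (case s of X1 \<Rightarrow> X1' | X2 \<Rightarrow> X2' | Y1 \<Rightarrow> Y1' | Y2 \<Rightarrow> Y2')" for s
  have "range \<phi> \<subseteq> carrier H" by (auto simp: \<phi>_def split: generator.split)
  then obtain f where f: "f \<in> hom free_group H" "\<And>s. f (free_gen s) = \<phi> s"
    using H.free_group_lift by metis
  interpret f: group_hom free_group H f
    using group_free_group f by (simp add: group_hom_def group_hom_axioms_def)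
  have "f l = f r" if "(l, r) \<in> Gstar_relations p k" for l r
  proof (rule H.cover_relations_hold)
    have "(f l, f r) \<in> map_prod f f ` Gstar_relations p k" using that by force
    then show "(f l, f r) \<in> cover_relations H p k X1' X2' Y1' Y2'"
      unfolding Gstar_relations_eq
      by (subst (asm) f.cover_relations_image) (simp_all add: free_gen_closed f(2) \<phi>_def)
  qed
  from presented_lift[OF H.is_group f(1) this] obtain h where h: "h \<in> hom (presented_group (Gstar_relations p k)) H"
    "\<And>w. w \<in> carrier free_group \<Longrightarrow> h (presented_class (Gstar_relations p k) w) = f w"
    by metis
  have "h (gen s) = \<phi> s" for s
    unfolding gen_def using h(2)[OF free_gen_closed] f(2) by metis
  then show thesis
    using h(1) by (intro that[of h]) (auto simp: Gstar_def \<phi>_def)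
qed

end

section \<open>Central extensions defined by cocycles\<close>

text \<open>Cocycles are not normalized, so that the identity has the inverse of the value at \<open>(1, 1)\<close> as its second
  component.\<close>

definition cocycle_extension ::
  "('a, 'c) monoid_scheme \<Rightarrow> ('b, 'd) monoid_scheme \<Rightarrow> ('a \<times> 'a \<Rightarrow> 'b) \<Rightarrow> ('a \<times> 'b) monoid" where
  "cocycle_extension G M f =
     \<lparr>carrier = carrier G \<times> carrier M,
      monoid.mult = (\<lambda>(g, a) (h, b). (g \<otimes>\<^bsub>G\<^esub> h, a \<otimes>\<^bsub>M\<^esub> b \<otimes>\<^bsub>M\<^esub> f (g, h))),
      one = (\<one>\<^bsub>G\<^esub>, inv\<^bsub>M\<^esub> f (\<one>\<^bsub>G\<^esub>, \<one>\<^bsub>G\<^esub>))\<rparr>"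

locale central_cocycle = G: group G + M: comm_group M
  for G :: "('a, 'c) monoid_scheme" and M :: "('b, 'd) monoid_scheme" +
  fixes f :: "'a \<times> 'a \<Rightarrow> 'b"
  assumes cocycle_closed [simp]: "\<And>g h. g \<in> carrier G \<Longrightarrow> h \<in> carrier G \<Longrightarrow> f (g, h) \<in> carrier M"
    and cocycle: "\<And>g h k. g \<in> carrier G \<Longrightarrow> h \<in> carrier G \<Longrightarrow> k \<in> carrier G \<Longrightarrow>
       f (g, h) \<otimes>\<^bsub>M\<^esub> f (g \<otimes>\<^bsub>G\<^esub> h, k) = f (h, k) \<otimes>\<^bsub>M\<^esub> f (g, h \<otimes>\<^bsub>G\<^esub> k)"
begin

abbreviation E where "E \<equiv> cocycle_extension G M f"
definition e where "e = f (\<one>\<^bsub>G\<^esub>, \<one>\<^bsub>G\<^esub>)"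

lemma e_closed [simp]: "e \<in> carrier M"
  by (simp add: e_def)

lemma E_simps [simp]:
  "carrier E = carrier G \<times> carrier M"
  "(g, a) \<otimes>\<^bsub>E\<^esub> (h, b) = (g \<otimes>\<^bsub>G\<^esub> h, a \<otimes>\<^bsub>M\<^esub> b \<otimes>\<^bsub>M\<^esub> f (g, h))"
  "\<one>\<^bsub>E\<^esub> = (\<one>\<^bsub>G\<^esub>, inv\<^bsub>M\<^esub> e)"
  by (simp_all add: cocycle_extension_def e_def)

lemma cocycle_one [simp]:
  assumes "g \<in> carrier G" shows "f (\<one>\<^bsub>G\<^esub>, g) = e" "f (g, \<one>\<^bsub>G\<^esub>) = e"
  using cocycle[of "\<one>\<^bsub>G\<^esub>" "\<one>\<^bsub>G\<^esub>" g] cocycle[of g "\<one>\<^bsub>G\<^esub>" "\<one>\<^bsub>G\<^esub>"] assms by (simp_all add: e_def)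

lemma group_E: "group E"
proof (rule groupI)
  fix x y z assume "x \<in> carrier E" "y \<in> carrier E" "z \<in> carrier E"
  then obtain g a h b k c where xyz: "x = (g, a)" "y = (h, b)" "z = (k, c)"
    and G: "g \<in> carrier G" "h \<in> carrier G" "k \<in> carrier G"
    and M: "a \<in> carrier M" "b \<in> carrier M" "c \<in> carrier M" by auto
  have "(a \<otimes>\<^bsub>M\<^esub> b \<otimes>\<^bsub>M\<^esub> c) \<otimes>\<^bsub>M\<^esub> (f (g, h) \<otimes>\<^bsub>M\<^esub> f (g \<otimes>\<^bsub>G\<^esub> h, k))
      = (a \<otimes>\<^bsub>M\<^esub> b \<otimes>\<^bsub>M\<^esub> c) \<otimes>\<^bsub>M\<^esub> (f (h, k) \<otimes>\<^bsub>M\<^esub> f (g, h \<otimes>\<^bsub>G\<^esub> k))"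
    by (simp only: cocycle[OF G])
  then show "x \<otimes>\<^bsub>E\<^esub> y \<otimes>\<^bsub>E\<^esub> z = x \<otimes>\<^bsub>E\<^esub> (y \<otimes>\<^bsub>E\<^esub> z)"
    using G M by (simp add: xyz G.m_assoc M.m_ac)
next
  fix x assume "x \<in> carrier E"
  then obtain g a where x: "x = (g, a)" "g \<in> carrier G" "a \<in> carrier M" by auto
  let ?y = "(inv\<^bsub>G\<^esub> g, inv\<^bsub>M\<^esub> (a \<otimes>\<^bsub>M\<^esub> f (inv\<^bsub>G\<^esub> g, g) \<otimes>\<^bsub>M\<^esub> e))"
  have "inv\<^bsub>M\<^esub> (w \<otimes>\<^bsub>M\<^esub> e) \<otimes>\<^bsub>M\<^esub> w = inv\<^bsub>M\<^esub> e" if "w \<in> carrier M" for w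
    using that M.m_comm[of "inv\<^bsub>M\<^esub> e" w] by (simp add: M.inv_mult M.m_assoc)
  from this[of "a \<otimes>\<^bsub>M\<^esub> f (inv\<^bsub>G\<^esub> g, g)"]
  have "inv\<^bsub>M\<^esub> (a \<otimes>\<^bsub>M\<^esub> f (inv\<^bsub>G\<^esub> g, g) \<otimes>\<^bsub>M\<^esub> e) \<otimes>\<^bsub>M\<^esub> a \<otimes>\<^bsub>M\<^esub> f (inv\<^bsub>G\<^esub> g, g) = inv\<^bsub>M\<^esub> e"
    using x by (simp add: M.m_assoc)
  then have "?y \<otimes>\<^bsub>E\<^esub> x = \<one>\<^bsub>E\<^esub>" using x by simp
  then show "\<exists>y\<in>carrier E. y \<otimes>\<^bsub>E\<^esub> x = \<one>\<^bsub>E\<^esub>"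
    using x by (intro bexI[of _ ?y]) auto
  show "\<one>\<^bsub>E\<^esub> \<otimes>\<^bsub>E\<^esub> x = x"
    using x M.m_comm[of "inv\<^bsub>M\<^esub> e" a] by (simp add: M.m_assoc)
qed auto

sublocale E: group E by (rule group_E)

lemma fst_hom: "group_hom E G fst"
  by unfold_locales (auto simp: hom_def)

text \<open>The factor \<open>e\<^sup>-\<^sup>1\<close> turns the inclusion of the kernel into a homomorphism although the cocycle is not
  normalized.\<close>

definition fibre :: "'b \<Rightarrow> 'a \<times> 'b" where
  "fibre c = (\<one>\<^bsub>G\<^esub>, c \<otimes>\<^bsub>M\<^esub> inv\<^bsub>M\<^esub> e)"

lemma fibre_hom: "group_hom M E fibre"
  by unfold_locales (auto simp: hom_def fibre_def M.m_ac)

lemma kernel_fst: "x \<in> carrier E \<Longrightarrow> fst x = \<one>\<^bsub>G\<^esub> \<Longrightarrow> x \<in> fibre ` carrier M"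
  by (auto simp: fibre_def image_iff M.m_assoc intro!: bexI[of _ "snd x \<otimes>\<^bsub>M\<^esub> e"])

lemma kernel_central: "x \<in> carrier E \<Longrightarrow> fst x = \<one>\<^bsub>G\<^esub> \<Longrightarrow> x \<in> center E"
  by (auto simp: center_def M.m_comm)

text \<open>Over a divisible kernel a lift of an element of order \<open>n\<close> can be corrected by an \<open>n\<close>-th root.\<close>

lemma lift_with_order:
  assumes g: "g \<in> carrier G" "g [^]\<^bsub>G\<^esub> n = \<one>\<^bsub>G\<^esub>"
    and divisible: "\<And>a. a \<in> carrier M \<Longrightarrow> \<exists>b\<in>carrier M. b [^]\<^bsub>M\<^esub> n = a"
  obtains x where "x \<in> carrier E" "fst x = g" "x [^]\<^bsub>E\<^esub> (n::nat) = \<one>\<^bsub>E\<^esub>"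
proof -
  interpret \<pi>: group_hom E G fst by (rule fst_hom)
  interpret \<iota>: group_hom M E fibre by (rule fibre_hom)
  define y where "y = (g, \<one>\<^bsub>M\<^esub>)"
  have y: "y \<in> carrier E" "fst y = g" using g by (auto simp: y_def)
  have "fst (y [^]\<^bsub>E\<^esub> n) = \<one>\<^bsub>G\<^esub>" using y g \<pi>.hom_nat_pow[of y n] by simp
  then obtain c where c: "c \<in> carrier M" "y [^]\<^bsub>E\<^esub> n = fibre c"
    using kernel_fst y E.nat_pow_closed by (metis imageE)
  then obtain b where b: "b \<in> carrier M" "b [^]\<^bsub>M\<^esub> n = inv\<^bsub>M\<^esub> c"
    using divisible by (metis M.inv_closed)
  have "fibre b \<in> carrier E" "fst (fibre b) = \<one>\<^bsub>G\<^esub>" using \<iota>.hom_closed[OF b(1)] by (simp_all add: fibre_def)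
  then have "(fibre b \<otimes>\<^bsub>E\<^esub> y) [^]\<^bsub>E\<^esub> n = fibre b [^]\<^bsub>E\<^esub> n \<otimes>\<^bsub>E\<^esub> y [^]\<^bsub>E\<^esub> n"
    by (intro E.pow_mult_distrib E.centerD[OF kernel_central]) (use y in auto)
  also have "\<dots> = fibre (inv\<^bsub>M\<^esub> c \<otimes>\<^bsub>M\<^esub> c)"
    using b c \<iota>.hom_nat_pow[OF b(1), of n] \<iota>.hom_mult[of "inv\<^bsub>M\<^esub> c" c] by (simp del: E_simps)
  also have "\<dots> = \<one>\<^bsub>E\<^esub>" using c \<iota>.hom_one by (simp del: E_simps)
  finally have "(fibre b \<otimes>\<^bsub>E\<^esub> y) [^]\<^bsub>E\<^esub> n = \<one>\<^bsub>E\<^esub>" .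
  moreover have "fibre b \<otimes>\<^bsub>E\<^esub> y \<in> carrier E" "fst (fibre b \<otimes>\<^bsub>E\<^esub> y) = g"
    using \<iota>.hom_closed[OF b(1)] y g by (auto simp: fibre_def y_def)
  ultimately show thesis using that by blast
qed

end

section \<open>Normal forms in groups satisfying the Heisenberg relations\<close>

context group begin

lemma commutator_int_pow_right:
  assumes "c \<in> carrier G" "a \<in> carrier G" "commutator G c a \<in> center G"
  shows "commutator G c (a [^] (n::int)) = commutator G c a [^] n"
proof -
  have "commutator G a c \<in> center G"
    using center_inv[OF assms(3)] commutator_flip[OF assms(1,2)] by simp
  then have "commutator G (a [^] n) c = commutator G a c [^] n"
    using assms by (simp add: commutator_int_pow_left)
  then show ?thesis
    using assms by (simp add: commutator_flip[of "a [^] n" c] commutator_flip[of a c] int_pow_inv)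
qed

lemma int_pow_swap:
  assumes "y \<in> carrier G" "x \<in> carrier G" "g \<in> carrier G" and z: "commutator G y x = z" "z \<in> center G"
  shows "y [^] (d::int) \<otimes> (x [^] (n::int) \<otimes> g) = x [^] n \<otimes> (y [^] d \<otimes> (z [^] (d * n) \<otimes> g))"
proof -
  have "commutator G (y [^] d) x = z [^] d"
    using assms by (simp add: commutator_int_pow_left)
  then have "commutator G (y [^] d) (x [^] n) = z [^] (d * n)"
    using assms center_int_pow[OF z(2), of d] center_closed[OF z(2)]
    by (simp add: commutator_int_pow_right int_pow_pow)
  then show ?thesis
    using commutator_swap_assoc[of "y [^] d" "x [^] n" g] assms by simp
qed

lemma int_pow_mult_assoc:
  "x \<in> carrier G \<Longrightarrow> g \<in> carrier G \<Longrightarrow> x [^] (a::int) \<otimes> (x [^] (b::int) \<otimes> g) = x [^] (a + b) \<otimes> g"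
  by (simp add: int_pow_mult m_assoc)

lemma center_assoc:
  "z \<in> center G \<Longrightarrow> g \<in> carrier G \<Longrightarrow> h \<in> carrier G \<Longrightarrow> z \<otimes> (g \<otimes> h) = g \<otimes> (z \<otimes> h)"
  using centerD[of z g] m_assoc[of z g h] m_assoc[of g z h] center_closed by auto

end

context heisenberg_base begin

abbreviation "z1 \<equiv> commutator G y1 x1"
abbreviation "z2 \<equiv> commutator G y1 x2"

definition normal_form :: "int \<Rightarrow> int \<Rightarrow> int \<Rightarrow> int \<Rightarrow> int \<Rightarrow> int \<Rightarrow> 'a" where
  "normal_form a b c d e f =
    x1 [^] a \<otimes> (x2 [^] b \<otimes> (y1 [^] c \<otimes> (y2 [^] d \<otimes> (z1 [^] e \<otimes> z2 [^] f))))"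

lemma z1_mult: "z1 [^] (m::int) \<otimes> (z1 [^] (e::int) \<otimes> z2 [^] (f::int)) = z1 [^] (m + e) \<otimes> z2 [^] f"
  by (simp add: int_pow_mult_assoc)

lemma z2_mult: "z2 [^] (m::int) \<otimes> (z1 [^] (e::int) \<otimes> z2 [^] (f::int)) = z1 [^] e \<otimes> z2 [^] (m + f)"
  using center_assoc[OF center_int_pow[OF z_center(2)], of "z1 [^] e" "z2 [^] f" m]
  by (simp add: int_pow_mult)

lemma zz_commute: "g \<in> carrier G \<Longrightarrow> (z1 [^] (e::int) \<otimes> z2 [^] (f::int)) \<otimes> g = g \<otimes> (z1 [^] e \<otimes> z2 [^] f)"
  by (intro centerD center_mult center_int_pow z_center)

text \<open>Passing \<open>y\<^sub>2\<^sup>d\<close> costs \<open>[y\<^sub>2, x\<^sub>1] = z\<^sub>2\<close> to the power \<open>d n\<close>, and passing \<open>y\<^sub>1\<^sup>c\<close> costs \<open>z\<^sub>1\<close> to the power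
  \<open>c n\<close>.  In the next lemma \<open>[y\<^sub>2, x\<^sub>2] = z\<^sub>1\<^sup>k\<close> brings in the factor \<open>k\<close>.\<close>

lemma normal_form_mult_x1:
  "normal_form a b c d e f \<otimes> x1 [^] n = normal_form (a + n) b c d (c * n + e) (d * n + f)"
proof -
  have "normal_form a b c d e f \<otimes> x1 [^] n
      = x1 [^] a \<otimes> (x2 [^] b \<otimes> (y1 [^] c \<otimes> (y2 [^] d \<otimes> (x1 [^] n \<otimes> (z1 [^] e \<otimes> z2 [^] f)))))"
    using zz_commute[of "x1 [^] n"] by (simp add: normal_form_def m_assoc)
  also have "\<dots> = x1 [^] a \<otimes> (x2 [^] b \<otimes> (y1 [^] c \<otimes> (x1 [^] n \<otimes> (y2 [^] d \<otimes> (z1 [^] e \<otimes> z2 [^] (d * n + f))))))"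
    using int_pow_swap[OF _ _ _ bilinear(1) z_center(2), of "z1 [^] e \<otimes> z2 [^] f" d n] by (simp add: z2_mult)
  also have "\<dots> = x1 [^] a \<otimes> (x2 [^] b \<otimes> (x1 [^] n \<otimes> (y1 [^] c \<otimes> (z1 [^] (c * n) \<otimes> (y2 [^] d \<otimes> (z1 [^] e \<otimes> z2 [^] (d * n + f)))))))"
    using int_pow_swap[OF _ _ _ HOL.refl z_center(1), of "y2 [^] d \<otimes> (z1 [^] e \<otimes> z2 [^] (d * n + f))" c n] by simp
  also have "\<dots> = x1 [^] a \<otimes> (x2 [^] b \<otimes> (x1 [^] n \<otimes> (y1 [^] c \<otimes> (y2 [^] d \<otimes> (z1 [^] (c * n + e) \<otimes> z2 [^] (d * n + f))))))"
    using center_assoc[OF center_int_pow[OF z_center(1)], of "y2 [^] d" "z1 [^] e \<otimes> z2 [^] (d * n + f)" "c * n"]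
    by (simp add: z1_mult)
  also have "\<dots> = x1 [^] a \<otimes> (x1 [^] n \<otimes> (x2 [^] b \<otimes> (y1 [^] c \<otimes> (y2 [^] d \<otimes> (z1 [^] (c * n + e) \<otimes> z2 [^] (d * n + f))))))"
    using int_pow_swap[OF _ _ _ commuting(1) center_one,
        of "y1 [^] c \<otimes> (y2 [^] d \<otimes> (z1 [^] (c * n + e) \<otimes> z2 [^] (d * n + f)))" b n] by simp
  finally show ?thesis by (simp add: normal_form_def int_pow_mult_assoc)
qed

lemma normal_form_mult_x2:
  "normal_form a b c d e f \<otimes> x2 [^] n = normal_form a (b + n) c d (k * (d * n) + e) (c * n + f)"
proof -
  have "normal_form a b c d e f \<otimes> x2 [^] n
      = x1 [^] a \<otimes> (x2 [^] b \<otimes> (y1 [^] c \<otimes> (y2 [^] d \<otimes> (x2 [^] n \<otimes> (z1 [^] e \<otimes> z2 [^] f)))))"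
    using zz_commute[of "x2 [^] n"] by (simp add: normal_form_def m_assoc)
  also have "\<dots> = x1 [^] a \<otimes> (x2 [^] b \<otimes> (y1 [^] c \<otimes> (x2 [^] n \<otimes> (y2 [^] d \<otimes> (z1 [^] (k * (d * n) + e) \<otimes> z2 [^] f)))))"
    using int_pow_swap[OF _ _ _ bilinear(2) center_int_pow[OF z_center(1)], of "z1 [^] e \<otimes> z2 [^] f" d n]
    by (simp add: z1_mult int_pow_pow)
  also have "\<dots> = x1 [^] a \<otimes> (x2 [^] b \<otimes> (x2 [^] n \<otimes> (y1 [^] c \<otimes> (z2 [^] (c * n) \<otimes> (y2 [^] d \<otimes> (z1 [^] (k * (d * n) + e) \<otimes> z2 [^] f))))))"
    using int_pow_swap[OF _ _ _ HOL.refl z_center(2), of "y2 [^] d \<otimes> (z1 [^] (k * (d * n) + e) \<otimes> z2 [^] f)" c n] by simp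
  also have "\<dots> = x1 [^] a \<otimes> (x2 [^] b \<otimes> (x2 [^] n \<otimes> (y1 [^] c \<otimes> (y2 [^] d \<otimes> (z1 [^] (k * (d * n) + e) \<otimes> z2 [^] (c * n + f))))))"
    using center_assoc[OF center_int_pow[OF z_center(2)], of "y2 [^] d" "z1 [^] (k * (d * n) + e) \<otimes> z2 [^] f" "c * n"]
    by (simp add: z2_mult)
  finally show ?thesis by (simp add: normal_form_def int_pow_mult_assoc)
qed

lemma normal_form_mult_y2: "normal_form a b c d e f \<otimes> y2 [^] n = normal_form a b c (d + n) e f"
  using zz_commute[of "y2 [^] n"] by (simp add: normal_form_def m_assoc int_pow_mult_assoc)

lemma normal_form_mult_y1: "normal_form a b c d e f \<otimes> y1 [^] n = normal_form a b (c + n) d e f"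
  using zz_commute[of "y1 [^] n"] int_pow_swap[OF _ _ _ commuting(2) center_one, of "z1 [^] e \<otimes> z2 [^] f" d n]
  by (simp add: normal_form_def m_assoc int_pow_mult_assoc)

lemma normal_form_closed [simp]: "normal_form a b c d e f \<in> carrier G"
  by (simp add: normal_form_def)

text \<open>The set of normal forms contains \<open>1\<close> and is stable under right multiplication by the generators and
  their inverses.\<close>

lemma normal_form_exhausts:
  assumes "generate G {x1, x2, y1, y2} = carrier G" "g \<in> carrier G"
  shows "\<exists>a b c d e f. g = normal_form a b c d e f"
proof -
  define N where "N = {normal_form a b c d e f | a b c d e f. True}"
  have nN: "normal_form a b c d e f \<in> N" for a b c d e f unfolding N_def by blast
  have N: "N \<subseteq> carrier G" by (auto simp: N_def)
  have step: "w \<otimes> s [^] (n::int) \<in> N" if "w \<in> N" "s \<in> {x1, x2, y1, y2}" for w s n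
  proof -
    from that(1) obtain a b c d e f where w: "w = normal_form a b c d e f" unfolding N_def by blast
    show ?thesis using that(2) nN unfolding w
      by (auto simp: normal_form_mult_x1 normal_form_mult_x2 normal_form_mult_y1 normal_form_mult_y2)
  qed
  have "\<forall>w\<in>N. w \<otimes> g \<in> N" if "g \<in> generate G {x1, x2, y1, y2}" for g
    using that
  proof (induction rule: generate.induct)
    case one show ?case using N by auto
  next
    case (incl s)
    moreover from this have "s \<in> carrier G" by auto
    ultimately show ?case using step[of _ s 1] by simp
  next
    case (inv s)
    moreover from this have "s \<in> carrier G" by auto
    ultimately show ?case using step[of _ s "-1"] by (simp add: int_pow_neg)
  next
    case (eng g h)
    then have "g \<in> carrier G" "h \<in> carrier G" using assms(1) by auto
    then show ?case using eng N by (simp add: subset_iff flip: m_assoc)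
  qed
  moreover have "\<one> \<in> N" using nN[of 0 0 0 0 0 0] by (simp add: normal_form_def)
  ultimately have "\<one> \<otimes> g \<in> N" using assms by blast
  then show ?thesis using assms(2) unfolding N_def by simp
qed

end

section \<open>Unitriangular matrices of size three\<close>

text \<open>The entries next to the diagonal are \<open>a\<close> and \<open>b\<close>, and \<open>c\<close> is the entry in the corner; rows and columns are
  counted from \<open>0\<close>.\<close>

definition heis :: "('a, 'b) ring_scheme \<Rightarrow> 'a \<Rightarrow> 'a \<Rightarrow> 'a \<Rightarrow> nat \<times> nat \<Rightarrow> 'a" where
  "heis R a b c = (\<lambda>(i, j)\<in>{..<3} \<times> {..<3}. if i = j then \<one>\<^bsub>R\<^esub> else if (i, j) = (0, 1) then a
     else if (i, j) = (1, 2) then b else if (i, j) = (0, 2) then c else \<zero>\<^bsub>R\<^esub>)"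

lemma heis_entries [simp]:
  "heis R a b c (0, Suc 0) = a" "heis R a b c (Suc 0, 2) = b" "heis R a b c (0, 2) = c"
  "heis R a b c (0, 0) = \<one>\<^bsub>R\<^esub>" "heis R a b c (Suc 0, Suc 0) = \<one>\<^bsub>R\<^esub>" "heis R a b c (2, 2) = \<one>\<^bsub>R\<^esub>"
  "heis R a b c (Suc 0, 0) = \<zero>\<^bsub>R\<^esub>" "heis R a b c (2, 0) = \<zero>\<^bsub>R\<^esub>" "heis R a b c (2, Suc 0) = \<zero>\<^bsub>R\<^esub>"
  by (simp_all add: heis_def)

lemma heis_eq_iff [simp]: "heis R a b c = heis R a' b' c' \<longleftrightarrow> a = a' \<and> b = b' \<and> c = c'"
  by (metis heis_entries(1-3))

lemma lessThan_3: "{..<3::nat} = {0, Suc 0, 2}"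
  by auto

lemma matrix3_eqI:
  assumes "A \<in> extensional ({..<3} \<times> {..<3})" "B \<in> extensional ({..<3} \<times> {..<3})"
    and "\<And>i j. i \<in> {0, Suc 0, 2} \<Longrightarrow> j \<in> {0, Suc 0, 2} \<Longrightarrow> A (i, j) = B (i, j)"
  shows "A = B"
proof (rule extensionalityI[OF assms(1,2)])
  fix x :: "nat \<times> nat" assume "x \<in> {..<3} \<times> {..<3}"
  then show "A x = B x" using assms(3)[of "fst x" "snd x"] unfolding lessThan_3 by auto
qed

lemma heis_extensional: "heis R a b c \<in> extensional ({..<3} \<times> {..<3})"
  by (simp add: heis_def)

context ring begin

lemma carrier_unitriangular_3:
  "carrier (unitriangular 3 R) = {heis R a b c | a b c. a \<in> carrier R \<and> b \<in> carrier R \<and> c \<in> carrier R}"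
proof (intro equalityI subsetI)
  fix A assume A: "A \<in> carrier (unitriangular 3 R)"
  then have e: "A \<in> {..<3} \<times> {..<3} \<rightarrow>\<^sub>E carrier R" "\<forall>i<3. A (i, i) = \<one>" "\<forall>i<3. \<forall>j<i. A (i, j) = \<zero>"
    by (auto simp: unitriangular_def)
  have "A = heis R (A (0, 1)) (A (1, 2)) (A (0, 2))"
    by (rule matrix3_eqI) (use e heis_extensional in \<open>auto simp: PiE_def\<close>)
  moreover have "A (0, 1) \<in> carrier R" "A (1, 2) \<in> carrier R" "A (0, 2) \<in> carrier R"
    by (rule PiE_mem[OF e(1)], simp)+
  ultimately show "A \<in> {heis R a b c | a b c. a \<in> carrier R \<and> b \<in> carrier R \<and> c \<in> carrier R}" by blast
next
  fix A assume "A \<in> {heis R a b c | a b c. a \<in> carrier R \<and> b \<in> carrier R \<and> c \<in> carrier R}"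
  then obtain a b c where A: "A = heis R a b c" "a \<in> carrier R" "b \<in> carrier R" "c \<in> carrier R" by auto
  then show "A \<in> carrier (unitriangular 3 R)"
    by (auto simp: unitriangular_def heis_def intro!: PiE_I)
qed

lemma heis_mult [simp]:
  assumes "a \<in> carrier R" "b \<in> carrier R" "c \<in> carrier R" "a' \<in> carrier R" "b' \<in> carrier R" "c' \<in> carrier R"
  shows "heis R a b c \<otimes>\<^bsub>unitriangular 3 R\<^esub> heis R a' b' c' = heis R (a \<oplus> a') (b \<oplus> b') (c \<oplus> a \<otimes> b' \<oplus> c')"
proof (rule matrix3_eqI[OF _ heis_extensional])
  show "heis R a b c \<otimes>\<^bsub>unitriangular 3 R\<^esub> heis R a' b' c' \<in> extensional ({..<3} \<times> {..<3})"
    by (simp add: unitriangular_def)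
  fix i j :: nat assume ij: "i \<in> {0, Suc 0, 2}" "j \<in> {0, Suc 0, 2}"
  then have "(heis R a b c \<otimes>\<^bsub>unitriangular 3 R\<^esub> heis R a' b' c') (i, j)
      = finsum R (\<lambda>l. heis R a b c (i, l) \<otimes> heis R a' b' c' (l, j)) {0, Suc 0, 2}"
    unfolding lessThan_3[symmetric] by (simp add: unitriangular_def)
  also have "\<dots> = heis R (a \<oplus> a') (b \<oplus> b') (c \<oplus> a \<otimes> b' \<oplus> c') (i, j)"
    using ij assms by (elim insertE emptyE; simp add: finsum_insert a_ac)
  finally show "(heis R a b c \<otimes>\<^bsub>unitriangular 3 R\<^esub> heis R a' b' c') (i, j)
      = heis R (a \<oplus> a') (b \<oplus> b') (c \<oplus> a \<otimes> b' \<oplus> c') (i, j)" .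
qed

lemma heis_one: "\<one>\<^bsub>unitriangular 3 R\<^esub> = heis R \<zero> \<zero> \<zero>"
  unfolding unitriangular_def heis_def by (auto intro!: restrict_ext)

lemma group_unitriangular_3: "group (unitriangular 3 R)"
proof (rule groupI)
  fix A assume "A \<in> carrier (unitriangular 3 R)"
  then obtain a b c where A: "A = heis R a b c" "a \<in> carrier R" "b \<in> carrier R" "c \<in> carrier R"
    by (auto simp: carrier_unitriangular_3)
  have "a \<otimes> b \<ominus> c \<oplus> (\<ominus> a) \<otimes> b \<oplus> c = \<zero>"
    using A by algebra
  then show "\<exists>B\<in>carrier (unitriangular 3 R). B \<otimes>\<^bsub>unitriangular 3 R\<^esub> A = \<one>\<^bsub>unitriangular 3 R\<^esub>"
    using A by (intro bexI[of _ "heis R (\<ominus> a) (\<ominus> b) (a \<otimes> b \<ominus> c)"])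
      (auto simp: heis_one carrier_unitriangular_3 l_neg)
qed (auto simp: carrier_unitriangular_3 heis_one a_assoc a_lcomm l_distr r_distr)

end

section \<open>The quadratic extension of the prime field\<close>

text \<open>The hypotheses determine the quadratic extension up to isomorphism.  The coordinates are integers, unique
  modulo \<open>p\<close>, so that they can serve as exponents of group elements.\<close>

locale quadratic_coordinates = cring R for R (structure) +
  fixes p :: nat and k :: int and \<tau>
  assumes prime_p: "Factorial_Ring.prime p" and odd_p: "odd p"
    and \<tau>_closed [simp]: "\<tau> \<in> carrier R"
    and \<tau>_square: "\<tau> \<otimes> \<tau> = add_pow R k \<one>"
    and spanning: "\<And>r. r \<in> carrier R \<Longrightarrow> \<exists>(c :: int) (d :: int). r = add_pow R c \<one> \<oplus> add_pow R d \<tau>"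
    and independent: "\<And>c d :: int. add_pow R c \<one> \<oplus> add_pow R d \<tau> = \<zero> \<longleftrightarrow> int p dvd c \<and> int p dvd d"
begin

definition lin :: "int \<Rightarrow> int \<Rightarrow> 'a" where "lin c d = add_pow R c \<one> \<oplus> add_pow R d \<tau>"

lemma lin_closed [simp]: "lin c d \<in> carrier R"
  by (simp add: lin_def)

lemma lin_zero_iff: "lin c d = \<zero> \<longleftrightarrow> int p dvd c \<and> int p dvd d"
  by (simp add: lin_def independent)

lemma lin_add: "lin c d \<oplus> lin c' d' = lin (c + c') (d + d')"
  unfolding lin_def by (simp add: add.int_pow_mult a_ac)

lemma lin_add_pow: "add_pow R n (lin c d) = lin (n * c) (n * d)"
  unfolding lin_def by (simp add: add.int_pow_distrib add.int_pow_pow mult.commute)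

lemma lin_eq_iff: "lin c d = lin c' d' \<longleftrightarrow> int p dvd c - c' \<and> int p dvd d - d'"
proof -
  have "lin c d = lin (c - c') (d - d') \<oplus> lin c' d'" by (simp add: lin_add)
  then have "lin c d = lin c' d' \<longleftrightarrow> lin (c - c') (d - d') = \<zero>" by (simp add: add.r_cancel_one)
  then show ?thesis by (simp add: lin_zero_iff)
qed

lemma lin_mult: "lin c d \<otimes> lin c' d' = lin (c * c' + k * (d * d')) (c * d' + d * c')"
proof -
  have m: "add_pow R a x \<otimes> add_pow R b y = add_pow R (a * b) (x \<otimes> y)"
    if "x \<in> carrier R" "y \<in> carrier R" for x y and a b :: int
    using that by (simp add: add_pow_ldistr_int add_pow_rdistr_int add.int_pow_pow mult.commute)
  have "lin c d \<otimes> lin c' d' = add_pow R (c * c') \<one> \<oplus> add_pow R (c * d') \<tau> \<oplus> (add_pow R (d * c') \<tau> \<oplus> add_pow R (d * d') (add_pow R k \<one>))"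
    unfolding lin_def by (simp add: l_distr r_distr m \<tau>_square a_ac)
  also have "add_pow R (d * d') (add_pow R k \<one>) = add_pow R (k * (d * d')) \<one>"
    by (simp add: add.int_pow_pow)
  finally show ?thesis by (simp add: lin_def add.int_pow_mult a_ac)
qed

lemma lin_exhausts: "r \<in> carrier R \<Longrightarrow> \<exists>c d. r = lin c d"
  using spanning unfolding lin_def by blast

lemma lin_1_0: "lin 1 0 = \<one>"
proof -
  have "add_pow R (0 :: int) \<tau> = \<zero>" by (simp add: add_pow_def)
  then show ?thesis by (simp add: lin_def)
qed

lemma carrier_eq: "carrier R = (\<lambda>(c, d). lin c d) ` ({0..<int p} \<times> {0..<int p})"
proof (intro equalityI subsetI)
  fix r assume "r \<in> carrier R"
  then obtain c d where "r = lin c d" using lin_exhausts by blast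
  then have "r = lin (c mod int p) (d mod int p)"
    by (simp add: lin_eq_iff minus_mod_eq_mult_div)
  then show "r \<in> (\<lambda>(c, d). lin c d) ` ({0..<int p} \<times> {0..<int p})"
    using prime_gt_0_nat[OF prime_p] by (intro image_eqI[of _ _ "(c mod int p, d mod int p)"]) auto
qed auto

lemma finite_carrier: "finite (carrier R)"
  unfolding carrier_eq by simp

lemma card_carrier: "card (carrier R) = p ^ 2"
proof -
  have "inj_on (\<lambda>(c, d). lin c d) ({0..<int p} \<times> {0..<int p})"
  proof (intro inj_onI, clarsimp simp: lin_eq_iff)
    fix a b c d assume *: "0 \<le> a" "a < int p" "0 \<le> b" "b < int p" "0 \<le> c" "c < int p" "0 \<le> d" "d < int p"
      and "int p dvd a - c" "int p dvd b - d"
    then have "a mod int p = c mod int p" "b mod int p = d mod int p"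
      by (metis mod_eq_dvd_iff)+
    with * show "a = c \<and> b = d" by (metis mod_pos_pos_trivial)
  qed
  then show ?thesis by (simp add: carrier_eq card_image power2_eq_square)
qed

text \<open>The inverse of \<open>c + d \<tau>\<close> is its conjugate divided by the norm \<open>c\<^sup>2 - k d\<^sup>2\<close>.  If \<open>p\<close> divided the norm but
  not \<open>d\<close>, then \<open>k\<close> would be the square of \<open>c/d\<close> modulo \<open>p\<close>.\<close>

lemma field_if_nonresidue:
  assumes "\<not> QuadRes (int p) k"
  shows "field R"
proof (rule cring_fieldI2)
  show "\<zero> \<noteq> \<one>"
    using lin_zero_iff[of 1 0] prime_gt_1_nat[OF prime_p] by (auto simp: lin_1_0)
next
  fix a assume a: "a \<in> carrier R" "a \<noteq> \<zero>"
  then obtain c d where cd: "a = lin c d" using lin_exhausts by blast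
  have p: "Factorial_Ring.prime (int p)" using prime_p by simp
  have "\<not> int p dvd c * c - k * (d * d)"
  proof
    assume dvd: "int p dvd c * c - k * (d * d)"
    show False
    proof (cases "int p dvd d")
      case True
      then have "int p dvd k * (d * d)" by simp
      then have "int p dvd c * c" using dvd by (metis dvd_diff_left_iff dvd_trans dvd_refl diff_add_cancel dvd_add)
      then have "int p dvd c" using p by (simp add: prime_dvd_mult_iff)
      with True a show False by (simp add: cd lin_zero_iff)
    next
      case False
      then have "coprime d (int p)" using p by (metis coprime_commute prime_imp_coprime)
      then obtain e where e: "[d * e = 1] (mod int p)" using cong_solve_coprime_int by blast
      have "[(e * c)^2 = e^2 * (c * c)] (mod int p)" by (simp add: power2_eq_square algebra_simps)
      also have "[e^2 * (c * c) = e^2 * (k * (d * d))] (mod int p)"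
        by (rule cong_mult[OF cong_refl]) (simp add: cong_iff_dvd_diff dvd)
      also have "e^2 * (k * (d * d)) = k * ((d * e) * (d * e))"
        by (simp add: power2_eq_square algebra_simps)
      also have "[k * ((d * e) * (d * e)) = k * (1 * 1)] (mod int p)"
        by (intro cong_mult cong_refl e)
      finally show False using assms by (auto simp: QuadRes_def)
    qed
  qed
  then have "coprime (c * c - k * (d * d)) (int p)"
    using p by (metis coprime_commute prime_imp_coprime)
  then obtain m where m: "[(c * c - k * (d * d)) * m = 1] (mod int p)"
    using cong_solve_coprime_int by blast
  have "lin c d \<otimes> lin (c * m) (- d * m) = lin ((c * c - k * (d * d)) * m) 0"
    by (simp add: lin_mult algebra_simps)
  also have "\<dots> = \<one>"
    using m by (simp add: lin_eq_iff cong_iff_dvd_diff flip: lin_1_0)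
  finally show "\<exists>b\<in>carrier R. a \<otimes> b = \<one>" using cd by auto
qed

end

lemma (in domain) linear_polynomial:
  assumes "a \<in> carrier R" "b \<in> carrier R"
  shows "poly_of_const a \<otimes>\<^bsub>poly_ring R\<^esub> X \<oplus>\<^bsub>poly_ring R\<^esub> poly_of_const b = normalize [a, b]"
proof -
  have "poly_mult (normalize [a]) X = normalize (normalize [a] @ [\<zero>])"
    using assms by (intro poly_mult_var') auto
  also have "\<dots> = normalize [a, \<zero>]"
    using normalize_idem[of "[a]" "[\<zero>]"] by simp
  finally have "poly_mult (normalize [a]) X = normalize [a, \<zero>]" .
  moreover have "poly_add (normalize [a, \<zero>]) (normalize [b]) = poly_add [a, \<zero>] [b]"
    using assms by (intro poly_add_normalize(3)[symmetric]) auto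
  moreover have "poly_add [a, \<zero>] [b] = normalize [a, b]"
    using assms by simp
  ultimately show ?thesis
    unfolding univ_poly_mult univ_poly_add poly_of_const_def by simp
qed

lemma (in group) int_pow_of_additive:
  assumes "\<And>m n. f (m + n) = f m \<otimes> f n" "\<And>n. f n \<in> carrier G"
  shows "f (n :: int) = f 1 [^] n"
proof -
  have "f \<in> hom integer_group G" using assms by (intro homI) auto
  from hom_int_pow[OF this _ group_integer_group is_group, of 1 n] show ?thesis by simp
qed

text \<open>The element \<open>\<tau>\<close> is the class of the indeterminate.  Division by \<open>t\<^sup>2 - k\<close> represents every class by a unique
  polynomial of degree at most one, whose coefficients are the coordinates.\<close>

theorem quadratic_ext_coordinates:
  assumes "Factorial_Ring.prime p" "odd p"
  obtains \<tau> where "quadratic_coordinates (quadratic_ext p k) p k \<tau>"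
proof -
  define K where "K = residue_ring (int p)"
  interpret K: residues_prime p K
    unfolding K_def by unfold_locales (rule assms)
  note K_eqs = K.res_carrier_eq K.res_add_eq K.res_mult_eq K.res_zero_eq K.res_one_eq
  have p: "1 < int p" using prime_gt_1_nat[OF assms(1)] by simp
  define f where "f = [1, 0, (- k) mod int p]"
  have f: "f \<in> carrier (poly_ring K)"
    using p by (simp add: f_def K_eqs polynomial_def flip: univ_poly_carrier)
  define L where "L = Rupt\<^bsub>K\<^esub> (carrier K) f"
  have L: "quadratic_ext p k = L"
    by (simp add: quadratic_ext_def L_def K_def f_def)
  define h where "h = K.rupture_surj (carrier K) f"
  interpret P: principal_domain "poly_ring K"
    by (rule K.univ_poly_is_principal[OF K.carrier_is_subfield])
  interpret L: cring L
    unfolding L_def rupture_def by (rule ideal.quotient_is_cring[OF P.cgenideal_ideal[OF f] P.is_cring])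
  interpret h: ring_hom_ring "poly_ring K" L h
    unfolding h_def L_def by (rule K.rupture_surj_hom(2)[OF K.carrier_is_subring f])
  define \<phi> where "\<phi> n = h (K.poly_of_const (n mod int p))" for n
  have const: "K.poly_of_const \<in> ring_hom K (poly_ring K)"
    using K.canonical_embedding_is_hom[OF K.carrier_is_subring] by simp
  have \<phi>_closed: "\<phi> n \<in> carrier L" for n
    unfolding \<phi>_def using ring_hom_memE(1)[OF const] by simp
  have \<phi>_add: "\<phi> (m + n) = \<phi> m \<oplus>\<^bsub>L\<^esub> \<phi> n" for m n
  proof -
    have "\<phi> (m + n) = h (K.poly_of_const ((m mod int p) \<oplus>\<^bsub>K\<^esub> (n mod int p)))"
      by (simp add: \<phi>_def K.add_cong)
    then show ?thesis unfolding \<phi>_def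
      using ring_hom_memE(1,3)[OF const] by simp
  qed
  have "\<phi> 1 = \<one>\<^bsub>L\<^esub>"
    using ring_hom_memE(4)[OF const] p by (simp add: \<phi>_def K.res_one_eq)
  then have \<phi>: "\<phi> n = add_pow L n \<one>\<^bsub>L\<^esub>" for n
    using L.add.int_pow_of_additive[of \<phi> n] \<phi>_add \<phi>_closed by simp
  define \<tau> where "\<tau> = h X\<^bsub>K\<^esub>"
  have X: "X\<^bsub>K\<^esub> \<in> carrier (poly_ring K)" by (rule K.var_closed(1)[OF K.carrier_is_subring])
  then have \<tau>: "\<tau> \<in> carrier L" by (simp add: \<tau>_def)
  have lin: "add_pow L c \<one>\<^bsub>L\<^esub> \<oplus>\<^bsub>L\<^esub> add_pow L d \<tau> = h (K.normalize [d mod int p, c mod int p])" for c d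
  proof -
    have "add_pow L d \<tau> = \<phi> d \<otimes>\<^bsub>L\<^esub> \<tau>"
      using \<tau> by (simp add: \<phi> L.add_pow_ldistr_int)
    then have "add_pow L c \<one>\<^bsub>L\<^esub> \<oplus>\<^bsub>L\<^esub> add_pow L d \<tau> = \<phi> d \<otimes>\<^bsub>L\<^esub> \<tau> \<oplus>\<^bsub>L\<^esub> \<phi> c"
      using \<tau> \<phi>_closed by (simp add: L.a_comm flip: \<phi>)
    also have "\<dots> = h (K.poly_of_const (d mod int p) \<otimes>\<^bsub>poly_ring K\<^esub> X\<^bsub>K\<^esub> \<oplus>\<^bsub>poly_ring K\<^esub> K.poly_of_const (c mod int p))"
      using X ring_hom_memE(1)[OF const] by (simp add: \<phi>_def \<tau>_def)
    finally show ?thesis by (simp only: K.linear_polynomial[OF K.mod_in_carrier K.mod_in_carrier])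
  qed
  have rem: "K.pmod q f = q" if "q \<in> carrier (poly_ring K)" "length q \<le> 2" for q
    using K.pmod_const(2)[OF K.carrier_is_subfield that(1) f] that(2) by (simp add: f_def)
  have norm_carrier: "K.normalize [d mod int p, c mod int p] \<in> carrier (poly_ring K)" for c d
    unfolding univ_poly_carrier[symmetric] by (intro K.normalize_gives_polynomial) auto
  have "quadratic_coordinates L p k \<tau>"
  proof unfold_locales
    have h_one: "h [1] = \<one>\<^bsub>L\<^esub>" using h.hom_one by (simp add: univ_poly_one K.res_one_eq)
    have h_zero: "h [] = \<zero>\<^bsub>L\<^esub>" using h.hom_zero by (simp add: univ_poly_zero)
    have "L.eval (map (h \<circ> K.poly_of_const) f) \<tau> = \<zero>\<^bsub>L\<^esub>"
      using K.polynomial_rupture[OF K.carrier_is_subring f] by (simp add: L_def h_def \<tau>_def)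
    moreover have "map (h \<circ> K.poly_of_const) f = [\<one>\<^bsub>L\<^esub>, \<zero>\<^bsub>L\<^esub>, \<phi> (- k)]"
      using h_one h_zero \<open>\<phi> 1 = \<one>\<^bsub>L\<^esub>\<close> by (simp add: f_def \<phi>_def K.poly_of_const_def K.res_zero_eq)
    ultimately have "\<tau> \<otimes>\<^bsub>L\<^esub> \<tau> \<oplus>\<^bsub>L\<^esub> \<phi> (- k) = \<zero>\<^bsub>L\<^esub>"
      using \<tau> \<phi>_closed by (simp add: numeral_2_eq_2)
    moreover have "\<phi> (- k) = \<ominus>\<^bsub>L\<^esub> \<phi> k"
      unfolding \<phi> by (rule L.add.int_pow_neg) simp
    ultimately have "\<tau> \<otimes>\<^bsub>L\<^esub> \<tau> \<ominus>\<^bsub>L\<^esub> \<phi> k = \<zero>\<^bsub>L\<^esub>" by (simp only: a_minus_def)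
    then show "\<tau> \<otimes>\<^bsub>L\<^esub> \<tau> = add_pow L k \<one>\<^bsub>L\<^esub>"
      unfolding \<phi>[symmetric] by (rule iffD1[OF L.r_right_minus_eq[OF L.m_closed[OF \<tau> \<tau>] \<phi>_closed]])
  next
    fix r assume "r \<in> carrier L"
    then obtain q where q: "q \<in> carrier (poly_ring K)" "r = h (K.pmod q f)"
      using K.rupture_carrier_as_pmod_image[OF K.carrier_is_subfield f] unfolding L_def h_def by blast
    define q' where "q' = K.pmod q f"
    have q': "q' \<in> carrier (poly_ring K)"
      unfolding q'_def by (rule K.long_division_closed(2)[OF K.carrier_is_subfield q(1) f])
    then have cf: "set q' \<subseteq> carrier K" "K.normalize q' = q'"
      using K.normalize_polynomial by (auto simp: polynomial_def simp flip: univ_poly_carrier)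
    have "length q' \<le> 2"
      using K.pmod_degree[OF K.carrier_is_subfield q(1) f] by (auto simp: q'_def f_def)
    then obtain c d where "c \<in> carrier K" "d \<in> carrier K" "q' = K.normalize [d, c]"
    proof -
      assume *: "\<And>c d. c \<in> carrier K \<Longrightarrow> d \<in> carrier K \<Longrightarrow> q' = K.normalize [d, c] \<Longrightarrow> thesis"
      consider "q' = []" | a where "q' = [a]" | a b where "q' = [a, b]"
        using \<open>length q' \<le> 2\<close> by (cases q' rule: remdups_adj.cases) auto
      then show thesis
      proof cases
        case 1 then show ?thesis using *[of "\<zero>\<^bsub>K\<^esub>" "\<zero>\<^bsub>K\<^esub>"] by simp
      next
        case (2 a) then show ?thesis using *[of a "\<zero>\<^bsub>K\<^esub>"] cf by simp
      next
        case (3 a b) then show ?thesis using *[of b a] cf by simp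
      qed
    qed
    moreover from this have "c mod int p = c" "d mod int p = d" by (auto simp: K.res_carrier_eq)
    ultimately show "\<exists>(c :: int) (d :: int). r = add_pow L c \<one>\<^bsub>L\<^esub> \<oplus>\<^bsub>L\<^esub> add_pow L d \<tau>"
      using q by (intro exI[of _ c] exI[of _ d]) (simp add: lin q'_def)
  next
    fix c d :: int
    have "h (K.normalize [d mod int p, c mod int p]) = h [] \<longleftrightarrow> K.normalize [d mod int p, c mod int p] = []"
    proof
      assume eq: "h (K.normalize [d mod int p, c mod int p]) = h []"
      let ?q = "K.normalize [d mod int p, c mod int p]"
      have "K.pmod ?q f = ?q" "K.pmod [] f = []"
        using K.normalize_length_le[of "[d mod int p, c mod int p]"]
        by (intro rem norm_carrier univ_poly_zero_closed; simp)+
      then have "?q \<in> (\<lambda>q. K.pmod q f) ` carrier (poly_ring K)" "[] \<in> (\<lambda>q. K.pmod q f) ` carrier (poly_ring K)"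
        using norm_carrier univ_poly_zero_closed by (metis image_eqI)+
      with eq show "?q = []"
        using K.rupture_surj_inj_on[OF K.carrier_is_subfield f] unfolding h_def inj_on_def by blast
    qed simp
    moreover have "h [] = \<zero>\<^bsub>L\<^esub>" using h.hom_zero by (simp add: univ_poly_zero)
    moreover have "K.normalize [d mod int p, c mod int p] = [] \<longleftrightarrow> c mod int p = 0 \<and> d mod int p = 0"
      by (simp add: K.res_zero_eq)
    ultimately show "add_pow L c \<one>\<^bsub>L\<^esub> \<oplus>\<^bsub>L\<^esub> add_pow L d \<tau> = \<zero>\<^bsub>L\<^esub> \<longleftrightarrow> int p dvd c \<and> int p dvd d"
      unfolding lin dvd_eq_mod_eq_0 by (simp only:)
  qed (use assms \<tau> in auto)
  then show thesis by (intro that[of \<tau>]) (simp only: L)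
qed

section \<open>Self-duality of elementary abelian groups\<close>

lemma complex_units_simps [simp]:
  "carrier complex_units = - {0}" "x \<otimes>\<^bsub>complex_units\<^esub> y = x * y" "\<one>\<^bsub>complex_units\<^esub> = 1"
  by (simp_all add: complex_units_def)

lemma comm_group_complex_units: "comm_group complex_units"
proof (rule comm_groupI)
  fix x assume "x \<in> carrier complex_units"
  then show "\<exists>y\<in>carrier complex_units. y \<otimes>\<^bsub>complex_units\<^esub> x = \<one>\<^bsub>complex_units\<^esub>"
    by (intro bexI[of _ "inverse x"]) auto
qed auto

interpretation CU: comm_group complex_units
  by (rule comm_group_complex_units)

lemma complex_units_inv [simp]: "x \<noteq> 0 \<Longrightarrow> inv\<^bsub>complex_units\<^esub> x = inverse x"
  by (rule CU.inv_equality) auto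

lemma complex_units_nat_pow [simp]: "x [^]\<^bsub>complex_units\<^esub> (n::nat) = x ^ n"
  by (induction n) auto

lemma complex_units_divisible:
  assumes "a \<in> carrier complex_units" "n > 0"
  shows "\<exists>b\<in>carrier complex_units. b [^]\<^bsub>complex_units\<^esub> (n::nat) = a"
proof -
  have "card {b. b ^ n = a} = n" using assms by (intro card_nth_roots) auto
  then have "{b. b ^ n = a} \<noteq> {}" using assms(2) by (metis card.empty less_irrefl)
  then obtain b where "b ^ n = a" by blast
  then show ?thesis using assms by (intro bexI[of _ b]) auto
qed

text \<open>A perfect pairing on \<open>H\<close> amounts to an isomorphism from \<open>H\<close> to its group of complex characters, sending
  \<open>a\<close> to \<open>\<beta> a\<close>.\<close>

definition perfect_pairing :: "('a, 'b) monoid_scheme \<Rightarrow> 'a set \<Rightarrow> ('a \<Rightarrow> 'a \<Rightarrow> complex) \<Rightarrow> bool" where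
  "perfect_pairing G H \<beta> \<longleftrightarrow>
     (\<forall>a\<in>H. \<beta> a \<in> hom (G\<lparr>carrier := H\<rparr>) complex_units) \<and>
     (\<forall>a\<in>H. \<forall>b\<in>H. \<forall>c\<in>H. \<beta> (a \<otimes>\<^bsub>G\<^esub> b) c = \<beta> a c * \<beta> b c) \<and>
     (\<forall>a\<in>H. (\<forall>b\<in>H. \<beta> a b = 1) \<longrightarrow> a = \<one>\<^bsub>G\<^esub>) \<and>
     (\<forall>\<chi>\<in>hom (G\<lparr>carrier := H\<rparr>) complex_units. \<exists>a\<in>H. \<forall>b\<in>H. \<chi> b = \<beta> a b)"

definition root_of_unity :: "nat \<Rightarrow> int \<Rightarrow> complex" where
  "root_of_unity p n = cis (2 * pi * of_int n / of_nat p)"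

lemma root_of_unity_add: "root_of_unity p (m + n) = root_of_unity p m * root_of_unity p n"
  by (simp add: root_of_unity_def cis_mult distrib_left add_divide_distrib)

lemma root_of_unity_nonzero [simp]: "root_of_unity p n \<noteq> 0"
  by (simp add: root_of_unity_def)

lemma root_of_unity_eq_one_iff:
  assumes "p > 0" shows "root_of_unity p n = 1 \<longleftrightarrow> int p dvd n"
proof
  assume "root_of_unity p n = 1"
  then have "cos (2 * pi * of_int n / of_nat p) = 1"
    by (simp add: root_of_unity_def complex_eq_iff)
  then obtain m :: int where "2 * pi * of_int n / of_nat p = of_int m * 2 * pi"
    using cos_one_2pi_int by auto
  then have "of_int n = (of_int m * of_nat p :: real)" using assms by (simp add: field_simps)
  then have "n = m * int p" by (metis of_int_eq_iff of_int_mult of_int_of_nat_eq)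
  then show "int p dvd n" by simp
next
  assume "int p dvd n"
  then obtain m where "n = int p * m" by (elim dvdE)
  then have "2 * pi * of_int n / of_nat p = 2 * pi * real_of_int m" using assms by simp
  then show "root_of_unity p n = 1"
    unfolding root_of_unity_def by (simp only: cis_multiple_2pi Ints_of_int)
qed

lemma root_of_unity_cong:
  assumes "p > 0" "int p dvd m - n" shows "root_of_unity p m = root_of_unity p n"
  using root_of_unity_add[of p "m - n" n] root_of_unity_eq_one_iff[of p "m - n"] assms by simp

lemma root_of_unity_exhausts:
  assumes "p > 0" "z ^ p = 1" obtains n where "z = root_of_unity p n"
proof -
  obtain j :: nat where "z = cis (2 * pi * real j / real p)"
    using bij_betw_imp_surj_on[OF bij_betw_roots_unity[OF assms(1)]] assms(2) by blast
  then show thesis using that[of "int j"] by (simp add: root_of_unity_def)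
qed

text \<open>By induction on the number of generators: a generator \<open>s\<close> outside of the subgroup \<open>H\<close> generated by the
  others splits off as a direct factor of order \<open>p\<close>, and the pairing is extended by
  \<open>(s\<^sup>m, s\<^sup>n) \<mapsto> \<zeta>\<^sup>m\<^sup>n\<close> with a primitive \<open>p\<close>-th root of unity \<open>\<zeta>\<close>.\<close>

lemma (in comm_group) elementary_abelian_perfect_pairing:
  assumes p: "Factorial_Ring.prime (p :: nat)" and S: "finite S" "S \<subseteq> carrier G" "\<And>s. s \<in> S \<Longrightarrow> s [^] p = \<one>"
  shows "finite (generate G S) \<and> (\<exists>\<beta>. perfect_pairing G (generate G S) \<beta>)"
  using S
proof (induction S rule: finite_induct)
  case empty
  have "perfect_pairing G {\<one>} (\<lambda>_ _. 1)"
    unfolding perfect_pairing_def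
  proof (intro conjI ballI)
    fix \<chi> assume "\<chi> \<in> hom (G\<lparr>carrier := {\<one>}\<rparr>) complex_units"
    then have "\<chi> (\<one> \<otimes> \<one>) = \<chi> \<one> * \<chi> \<one>" "\<chi> \<one> \<noteq> 0" by (auto simp: hom_def)
    then show "\<exists>a\<in>{\<one>}. \<forall>b\<in>{\<one>}. \<chi> b = 1" by simp
  qed (auto simp: hom_def)
  then show ?case by (auto simp: generate_empty)
next
  case (insert s S)
  define H where "H = generate G S"
  have s: "s \<in> carrier G" "s [^] p = \<one>" using insert by auto
  interpret H: subgroup H G unfolding H_def using insert by (intro generate_is_subgroup) auto
  obtain \<beta> where fin: "finite H" and \<beta>: "perfect_pairing G H \<beta>"
    using insert unfolding H_def by auto
  have p0: "p > 0" using p by (simp add: prime_gt_0_nat)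
  have s_int: "s [^] m = \<one>" if "int p dvd m" for m :: int
    using that s int_pow_pow[of s "int p"] by (auto simp: int_pow_int elim!: dvdE)
  have gen_insert: "generate G (insert s S) = {h \<otimes> s [^] (n::int) | h n. h \<in> H}" (is "_ = ?H'")
  proof (intro equalityI subsetI)
    have "subgroup ?H' G"
    proof (rule subgroupI)
      have "\<one> \<otimes> s [^] (0::int) \<in> ?H'" using H.one_closed by blast
      then show "?H' \<noteq> {}" by blast
    next
      fix a assume "a \<in> ?H'"
      then obtain h n where a: "a = h \<otimes> s [^] (n::int)" "h \<in> H" by auto
      then have "inv a = inv h \<otimes> s [^] (- n)" using s by (simp add: inv_mult int_pow_neg)
      then show "inv a \<in> ?H'" using a H.m_inv_closed by blast
    next
      fix a b assume "a \<in> ?H'" "b \<in> ?H'"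
      then obtain h n h' n' where ab: "a = h \<otimes> s [^] (n::int)" "h \<in> H" "b = h' \<otimes> s [^] (n'::int)" "h' \<in> H" by auto
      then have "a \<otimes> b = (h \<otimes> h') \<otimes> s [^] (n + n')" using s by (simp add: int_pow_mult m_ac)
      then show "a \<otimes> b \<in> ?H'" using ab H.m_closed by blast
    qed (use s in auto)
    moreover have "insert s S \<subseteq> ?H'"
    proof -
      have "\<one> \<otimes> s [^] (1::int) \<in> ?H'" using H.one_closed by blast
      moreover have "h \<otimes> s [^] (0::int) \<in> ?H'" if "h \<in> S" for h
        using that generate.incl[of h S G] unfolding H_def by blast
      ultimately show ?thesis using s insert.prems by (auto simp: subset_iff)
    qed
    ultimately show "x \<in> ?H'" if "x \<in> generate G (insert s S)" for x
      using that generate_subgroup_incl by blast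
  next
    fix x assume "x \<in> ?H'"
    then obtain h n where x: "x = h \<otimes> s [^] (n::int)" "h \<in> H" by auto
    have gs: "subgroup (generate G (insert s S)) G" using insert by (intro generate_is_subgroup) auto
    have "h \<in> generate G (insert s S)" using x mono_generate[of S "insert s S"] unfolding H_def by blast
    moreover have "s [^] n \<in> generate G (insert s S)"
      using subgroup_int_pow_closed[OF gs] generate.incl[of s "insert s S" G] by blast
    ultimately show "x \<in> generate G (insert s S)" using x subgroup.m_closed[OF gs] by blast
  qed
  show ?case
  proof (cases "s \<in> H")
    case True
    have "generate G (insert s S) = H"
    proof -
      have "h \<otimes> s [^] n \<in> H" if "h \<in> H" for h and n :: int
        using that True subgroup_int_pow_closed[OF H.is_subgroup] by blast
      moreover have "h = h \<otimes> s [^] (0::int)" if "h \<in> H" for h using that by simp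
      ultimately show ?thesis unfolding gen_insert by blast
    qed
    then show ?thesis using fin \<beta> by auto
  next
    case False
    define H' where "H' = generate G (insert s S)"
    have unique: "h = h' \<and> int p dvd m - n"
      if eq: "h \<otimes> s [^] m = h' \<otimes> s [^] n" and h: "h \<in> H" "h' \<in> H" for h h' and m n :: int
    proof -
      have "s [^] (m - n) = inv h \<otimes> (h \<otimes> s [^] m) \<otimes> inv (s [^] n)"
        using h s by (simp add: int_pow_diff m_assoc)
      also have "\<dots> = inv h \<otimes> h'" using h s by (simp add: eq m_assoc)
      finally have mem: "s [^] (m - n) \<in> H" and d: "s [^] (m - n) = inv h \<otimes> h'"
        using h by auto
      have dvd: "int p dvd m - n"
      proof (rule ccontr)
        assume "\<not> int p dvd m - n"
        then have "coprime (m - n) (int p)" using p by (metis coprime_commute prime_imp_coprime prime_nat_int_transfer)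
        then obtain u where "[(m - n) * u = 1] (mod int p)" using cong_solve_coprime_int by blast
        then have "int p dvd (m - n) * u - 1" by (simp add: cong_iff_dvd_diff)
        then have "s [^] ((m - n) * u - 1) = \<one>" by (rule s_int)
        then have "s [^] ((m - n) * u) = s" using s by (simp add: int_pow_diff) (metis int_pow_closed inv_solve_right' l_one one_closed)
        moreover have "s [^] ((m - n) * u) \<in> H"
          using subgroup_int_pow_closed[OF H.is_subgroup mem, of u] s by (simp add: int_pow_pow)
        ultimately show False using False by simp
      qed
      then have "inv h \<otimes> h' = \<one>" using d s_int by simp
      then have "h' = h" using h by (metis H.mem_carrier inv_closed inv_inv inv_equality)
      with dvd show ?thesis by simp
    qed
    \<comment> \<open>The coordinates of the direct product: \<open>hd\<close> is the projection to \<open>H\<close>, and \<open>ex\<close> chooses an exponent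
      of \<open>s\<close>, which is well defined only modulo \<open>p\<close>.\<close>
    have "\<exists>h n. x = h \<otimes> s [^] (n::int) \<and> h \<in> H" if "x \<in> H'" for x
      using that unfolding H'_def gen_insert by blast
    then obtain hd ex where split: "\<And>x. x \<in> H' \<Longrightarrow> x = hd x \<otimes> s [^] (ex x :: int)" "\<And>x. x \<in> H' \<Longrightarrow> hd x \<in> H"
      by metis
    have mem: "h \<otimes> s [^] (n::int) \<in> H'" if "h \<in> H" for h n
      using that unfolding H'_def gen_insert by blast
    have coords: "hd (h \<otimes> s [^] n) = h \<and> int p dvd ex (h \<otimes> s [^] n) - n" if "h \<in> H" for h and n :: int
      using unique[OF split(1)[OF mem[OF that], symmetric] split(2)[OF mem[OF that]] that] .
    have H': "subgroup H' G" unfolding H'_def using insert by (intro generate_is_subgroup) auto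
    have coords_mult: "hd (x \<otimes> y) = hd x \<otimes> hd y \<and> int p dvd ex (x \<otimes> y) - (ex x + ex y)"
      if "x \<in> H'" "y \<in> H'" for x y
    proof -
      have "x \<otimes> y = (hd x \<otimes> s [^] ex x) \<otimes> (hd y \<otimes> s [^] ex y)"
        using split(1) that by simp
      also have "\<dots> = (hd x \<otimes> hd y) \<otimes> s [^] (ex x + ex y)"
        using split(2) that s by (simp add: int_pow_mult m_ac)
      finally show ?thesis using coords[of "hd x \<otimes> hd y" "ex x + ex y"] split(2) that by simp
    qed
    have H_in: "h \<in> H'" "hd h = h" "int p dvd ex h" if "h \<in> H" for h
      using mem[OF that, of 0] coords[OF that, of 0] that by simp_all
    have s_in: "s \<in> H'" "hd s = \<one>" "int p dvd ex s - 1"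
      using mem[OF H.one_closed, of 1] coords[OF H.one_closed, of 1] s by simp_all
    let ?\<zeta> = "root_of_unity p"
    define \<gamma> where "\<gamma> x y = \<beta> (hd x) (hd y) * ?\<zeta> (ex x * ex y)" for x y
    have \<beta>_nz: "\<beta> a b \<noteq> 0" if "a \<in> H" "b \<in> H" for a b
      using \<beta> that unfolding perfect_pairing_def hom_def by (auto simp: Pi_iff)
    have \<beta>_hom: "\<beta> a (b \<otimes> c) = \<beta> a b * \<beta> a c" if "a \<in> H" "b \<in> H" "c \<in> H" for a b c
      using \<beta> that unfolding perfect_pairing_def hom_def by (auto simp: Pi_iff)
    have \<beta>_left: "\<beta> (a \<otimes> b) c = \<beta> a c * \<beta> b c" if "a \<in> H" "b \<in> H" "c \<in> H" for a b c
      using \<beta> that unfolding perfect_pairing_def by blast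
    have \<beta>_one: "\<beta> a \<one> = 1" if "a \<in> H" for a
      using \<beta>_hom[of a \<one> \<one>] \<beta>_nz[of a \<one>] that by simp
    have \<zeta>_mult: "?\<zeta> (n * c) = ?\<zeta> (a * c) * ?\<zeta> (b * c)" if "int p dvd n - (a + b)" for n a b c
    proof -
      have "int p dvd n * c - (a * c + b * c)"
        using dvd_mult2[OF that, of c] by (simp add: algebra_simps)
      from root_of_unity_cong[OF p0 this] show ?thesis by (simp add: root_of_unity_add)
    qed
    have "perfect_pairing G H' \<gamma>"
      unfolding perfect_pairing_def
    proof (intro conjI ballI impI)
      fix a assume a: "a \<in> H'"
      show "\<gamma> a \<in> hom (G\<lparr>carrier := H'\<rparr>) complex_units"
      proof (rule homI)
        fix b c assume bc: "b \<in> carrier (G\<lparr>carrier := H'\<rparr>)" "c \<in> carrier (G\<lparr>carrier := H'\<rparr>)"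
        then show "\<gamma> a (b \<otimes>\<^bsub>G\<lparr>carrier := H'\<rparr>\<^esub> c) = \<gamma> a b \<otimes>\<^bsub>complex_units\<^esub> \<gamma> a c"
          using a coords_mult[of b c] split(2) \<zeta>_mult[of "ex (b \<otimes> c)" "ex b" "ex c" "ex a"]
          by (simp add: \<gamma>_def \<beta>_hom mult_ac)
      qed (use a split(2) \<beta>_nz in \<open>auto simp: \<gamma>_def\<close>)
    next
      fix a b c assume abc: "a \<in> H'" "b \<in> H'" "c \<in> H'"
      then show "\<gamma> (a \<otimes> b) c = \<gamma> a c * \<gamma> b c"
        using coords_mult[of a b] split(2) \<zeta>_mult[of "ex (a \<otimes> b)" "ex a" "ex b" "ex c"]
        by (simp add: \<gamma>_def \<beta>_left mult_ac)
    next
      fix a assume a: "a \<in> H'" and one: "\<forall>b\<in>H'. \<gamma> a b = 1"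
      have "\<beta> (hd a) b = 1" if "b \<in> H" for b
      proof -
        have "?\<zeta> (ex a * ex b) = 1" using H_in(3)[OF that] p0 by (simp add: root_of_unity_eq_one_iff)
        then show ?thesis using one H_in[OF that] by (auto simp: \<gamma>_def)
      qed
      then have "hd a = \<one>" using \<beta> split(2)[OF a] unfolding perfect_pairing_def by blast
      have "?\<zeta> (ex a * ex s) = 1"
        using one s_in \<beta>_one[OF split(2)[OF a]] by (auto simp: \<gamma>_def)
      moreover have "int p dvd ex a * ex s - ex a"
        using dvd_mult[OF s_in(3), of "ex a"] by (simp add: algebra_simps)
      ultimately have "int p dvd ex a"
        using p0 root_of_unity_cong root_of_unity_eq_one_iff by metis
      then show "a = \<one>" using split(1)[OF a] \<open>hd a = \<one>\<close> s_int by simp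
    next
      fix \<chi> assume \<chi>: "\<chi> \<in> hom (G\<lparr>carrier := H'\<rparr>) complex_units"
      have \<chi>_mult: "\<chi> (x \<otimes> y) = \<chi> x * \<chi> y" if "x \<in> H'" "y \<in> H'" for x y
        using \<chi> that by (auto simp: hom_def)
      have \<chi>_nz: "\<chi> x \<noteq> 0" if "x \<in> H'" for x
        using \<chi> that by (auto simp: hom_def)
      have "\<chi> \<in> hom (G\<lparr>carrier := H\<rparr>) complex_units"
        using \<chi> H_in(1) by (auto simp: hom_def Pi_iff)
      then obtain a where a: "a \<in> H" "\<And>b. b \<in> H \<Longrightarrow> \<chi> b = \<beta> a b"
        using \<beta> unfolding perfect_pairing_def by blast
      have \<chi>_one: "\<chi> \<one> = 1" using a \<beta>_one by simp
      have sn: "s [^] (n::int) \<in> H'" for n using subgroup_int_pow_closed[OF H' s_in(1)] .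
      have "\<chi> (s [^] j) = \<chi> s ^ j" for j :: nat
      proof (induction j)
        case (Suc j)
        have "s [^] j \<in> H'" using sn[of "int j"] by (simp add: int_pow_int)
        then show ?case using Suc \<chi>_mult s_in by simp
      qed (simp add: \<chi>_one)
      then have "\<chi> s ^ p = 1" using s \<chi>_one by metis
      then obtain n where n: "\<chi> s = ?\<zeta> n" using root_of_unity_exhausts[OF p0] by blast
      have \<chi>_pow: "\<chi> (s [^] (m::int)) = ?\<zeta> (n * m)" for m
      proof -
        have "\<chi> (s [^] m) = \<chi> (s [^] (1::int)) [^]\<^bsub>complex_units\<^esub> m"
          by (rule CU.int_pow_of_additive[where f = "\<lambda>m. \<chi> (s [^] m)"])
            (use sn \<chi>_mult \<chi>_nz s in \<open>auto simp: int_pow_mult\<close>)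
        moreover have "?\<zeta> (n * m) = ?\<zeta> (n * 1) [^]\<^bsub>complex_units\<^esub> m"
          by (rule CU.int_pow_of_additive[where f = "\<lambda>m. ?\<zeta> (n * m)"])
            (auto simp: distrib_left root_of_unity_add)
        ultimately show ?thesis using s n by simp
      qed
      show "\<exists>x\<in>H'. \<forall>y\<in>H'. \<chi> y = \<gamma> x y"
      proof (intro bexI ballI)
        let ?x = "a \<otimes> s [^] n"
        show "?x \<in> H'" by (rule mem[OF a(1)])
        fix y assume y: "y \<in> H'"
        have "int p dvd ex ?x * ex y - n * ex y"
          using dvd_mult2[of "int p" "ex ?x - n" "ex y"] coords[OF a(1), of n] by (simp add: algebra_simps)
        then have "?\<zeta> (ex ?x * ex y) = ?\<zeta> (n * ex y)" by (rule root_of_unity_cong[OF p0])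
        then have "\<gamma> ?x y = \<chi> (hd y) * \<chi> (s [^] ex y)"
          using coords[OF a(1), of n] split(2)[OF y] a(2) by (simp add: \<gamma>_def \<chi>_pow)
        also have "\<dots> = \<chi> y"
          using \<chi>_mult[of "hd y" "s [^] ex y"] sn H_in(1) split y by metis
        finally show "\<chi> y = \<gamma> ?x y" ..
      qed
    qed
    moreover have "finite H'"
    proof -
      have "H' \<subseteq> (\<lambda>(h, n). h \<otimes> s [^] (n::int)) ` (H \<times> {0..<int p})"
      proof
        fix x assume x: "x \<in> H'"
        have "s [^] (ex x mod int p) = s [^] (ex x - int p * (ex x div int p))"
          by (simp add: minus_mult_div_eq_mod)
        also have "\<dots> = s [^] ex x" using s s_int[of "int p * (ex x div int p)"] by (simp add: int_pow_diff)
        finally have "x = hd x \<otimes> s [^] (ex x mod int p)" using split(1)[OF x] by simp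
        then show "x \<in> (\<lambda>(h, n). h \<otimes> s [^] (n::int)) ` (H \<times> {0..<int p})"
          using split(2)[OF x] p0 by (intro image_eqI[of _ _ "(hd x, ex x mod int p)"]) auto
      qed
      then show ?thesis using fin by (meson finite_SigmaI finite_atLeastLessThan_int finite_imageI finite_subset)
    qed
    ultimately show ?thesis unfolding H'_def by blast
  qed
qed

section \<open>The Schur multiplier of the quotient\<close>

lemma (in group) derived_eq_one_hom:
  assumes "comm_group H" "h \<in> hom G H" "x \<in> derived G (carrier G)"
  shows "h x = \<one>\<^bsub>H\<^esub>"
proof -
  interpret H: comm_group H by fact
  interpret h: group_hom G H h using assms is_group by (simp add: group_hom_def group_hom_axioms_def)
  have "h ` derived G (carrier G) = derived H (h ` carrier G)" by (rule h.derived_img[symmetric]) simp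
  also have "\<dots> = {\<one>\<^bsub>H\<^esub>}" by (rule H.derived_eq_singleton) auto
  finally show ?thesis using assms(3) by blast
qed

locale cohomology = G: group G + M: comm_group M
  for G :: "('a, 'c) monoid_scheme" and M :: "('b, 'd) monoid_scheme"
begin

abbreviation "C2 \<equiv> cochains2 G M"
abbreviation "Z2 \<equiv> cocycles2 G M"
abbreviation "B2 \<equiv> coboundaries2 G M"

definition coboundary :: "('a \<Rightarrow> 'b) \<Rightarrow> 'a \<times> 'a \<Rightarrow> 'b" where
  "coboundary c = (\<lambda>(g, h)\<in>carrier G \<times> carrier G. c h \<otimes>\<^bsub>M\<^esub> inv\<^bsub>M\<^esub> c (g \<otimes>\<^bsub>G\<^esub> h) \<otimes>\<^bsub>M\<^esub> c g)"

lemma B2_eq: "B2 = coboundary ` (carrier G \<rightarrow> carrier M)"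
  unfolding coboundaries2_def coboundary_def by blast

lemma coboundary_apply:
  "g \<in> carrier G \<Longrightarrow> h \<in> carrier G \<Longrightarrow> coboundary c (g, h) = c h \<otimes>\<^bsub>M\<^esub> inv\<^bsub>M\<^esub> c (g \<otimes>\<^bsub>G\<^esub> h) \<otimes>\<^bsub>M\<^esub> c g"
  by (simp add: coboundary_def)

lemma C2_carrier: "carrier C2 = carrier G \<times> carrier G \<rightarrow>\<^sub>E carrier M"
  by (simp add: cochains2_def)

lemma group_C2: "group C2"
  unfolding cochains2_def by (rule product_group) (rule M.is_group)

sublocale C2: group C2 by (rule group_C2)

lemma C2_closed: "f \<in> carrier C2 \<Longrightarrow> g \<in> carrier G \<Longrightarrow> h \<in> carrier G \<Longrightarrow> f (g, h) \<in> carrier M"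
  by (auto simp: C2_carrier)

lemma C2_mult: "g \<in> carrier G \<Longrightarrow> h \<in> carrier G \<Longrightarrow> (f \<otimes>\<^bsub>C2\<^esub> f') (g, h) = f (g, h) \<otimes>\<^bsub>M\<^esub> f' (g, h)"
  by (simp add: cochains2_def)

lemma C2_one: "g \<in> carrier G \<Longrightarrow> h \<in> carrier G \<Longrightarrow> \<one>\<^bsub>C2\<^esub> (g, h) = \<one>\<^bsub>M\<^esub>"
  by (simp add: cochains2_def)

lemma C2_inv: "f \<in> carrier C2 \<Longrightarrow> g \<in> carrier G \<Longrightarrow> h \<in> carrier G \<Longrightarrow> (inv\<^bsub>C2\<^esub> f) (g, h) = inv\<^bsub>M\<^esub> f (g, h)"
  unfolding cochains2_def by (subst inv_product_group) (auto intro: M.is_group)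

lemma C2_eqI:
  assumes "f \<in> carrier C2" "f' \<in> carrier C2"
    and "\<And>g h. g \<in> carrier G \<Longrightarrow> h \<in> carrier G \<Longrightarrow> f (g, h) = f' (g, h)"
  shows "f = f'"
  by (rule PiE_ext[OF assms(1,2)[unfolded C2_carrier]]) (use assms(3) in auto)

lemma C2_comm: "f \<in> carrier C2 \<Longrightarrow> f' \<in> carrier C2 \<Longrightarrow> f \<otimes>\<^bsub>C2\<^esub> f' = f' \<otimes>\<^bsub>C2\<^esub> f"
  by (rule C2_eqI) (auto simp: C2_mult C2_closed M.m_comm)

lemma coboundary_closed: "c \<in> carrier G \<rightarrow> carrier M \<Longrightarrow> coboundary c \<in> carrier C2"
  unfolding C2_carrier coboundary_def by (auto simp: Pi_iff)

lemma coboundary_mult: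
  assumes "c \<in> carrier G \<rightarrow> carrier M" "c' \<in> carrier G \<rightarrow> carrier M"
  shows "coboundary (\<lambda>g. c g \<otimes>\<^bsub>M\<^esub> c' g) = coboundary c \<otimes>\<^bsub>C2\<^esub> coboundary c'"
proof (rule C2_eqI)
  show "coboundary (\<lambda>g. c g \<otimes>\<^bsub>M\<^esub> c' g) \<in> carrier C2" using assms by (intro coboundary_closed) auto
  fix g h assume gh: "g \<in> carrier G" "h \<in> carrier G"
  then have "c g \<in> carrier M" "c h \<in> carrier M" "c (g \<otimes>\<^bsub>G\<^esub> h) \<in> carrier M"
    "c' g \<in> carrier M" "c' h \<in> carrier M" "c' (g \<otimes>\<^bsub>G\<^esub> h) \<in> carrier M" using assms by auto
  then show "coboundary (\<lambda>g. c g \<otimes>\<^bsub>M\<^esub> c' g) (g, h) = (coboundary c \<otimes>\<^bsub>C2\<^esub> coboundary c') (g, h)"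
    using gh by (simp add: C2_mult coboundary_apply M.inv_mult M.m_ac)
qed (use assms coboundary_closed in auto)

lemma subgroup_Z2: "subgroup Z2 C2"
proof (rule C2.subgroupI)
  show "Z2 \<subseteq> carrier C2" by (auto simp: cocycles2_def)
  have "\<one>\<^bsub>C2\<^esub> \<in> Z2" using C2.one_closed by (simp add: cocycles2_def C2_one)
  then show "Z2 \<noteq> {}" by blast
next
  fix f assume f: "f \<in> Z2"
  then have fC: "f \<in> carrier C2" by (simp add: cocycles2_def)
  show "inv\<^bsub>C2\<^esub> f \<in> Z2" unfolding cocycles2_def
  proof (intro CollectI conjI ballI)
    fix g h k assume ghk: "g \<in> carrier G" "h \<in> carrier G" "k \<in> carrier G"
    then have "f (g, h) \<otimes>\<^bsub>M\<^esub> f (g \<otimes>\<^bsub>G\<^esub> h, k) = f (h, k) \<otimes>\<^bsub>M\<^esub> f (g, h \<otimes>\<^bsub>G\<^esub> k)"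
      using f by (simp add: cocycles2_def)
    then have "inv\<^bsub>M\<^esub> (f (g, h) \<otimes>\<^bsub>M\<^esub> f (g \<otimes>\<^bsub>G\<^esub> h, k)) = inv\<^bsub>M\<^esub> (f (h, k) \<otimes>\<^bsub>M\<^esub> f (g, h \<otimes>\<^bsub>G\<^esub> k))" by simp
    then show "(inv\<^bsub>C2\<^esub> f) (g, h) \<otimes>\<^bsub>M\<^esub> (inv\<^bsub>C2\<^esub> f) (g \<otimes>\<^bsub>G\<^esub> h, k)
        = (inv\<^bsub>C2\<^esub> f) (h, k) \<otimes>\<^bsub>M\<^esub> (inv\<^bsub>C2\<^esub> f) (g, h \<otimes>\<^bsub>G\<^esub> k)"
      using ghk fC by (simp add: C2_inv C2_closed M.inv_mult)
  qed (use fC in simp)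
next
  fix f f' assume f: "f \<in> Z2" "f' \<in> Z2"
  then have fC: "f \<in> carrier C2" "f' \<in> carrier C2" by (simp_all add: cocycles2_def)
  show "f \<otimes>\<^bsub>C2\<^esub> f' \<in> Z2" unfolding cocycles2_def
  proof (intro CollectI conjI ballI)
    fix g h k assume ghk: "g \<in> carrier G" "h \<in> carrier G" "k \<in> carrier G"
    then have "f (g, h) \<otimes>\<^bsub>M\<^esub> f (g \<otimes>\<^bsub>G\<^esub> h, k) = f (h, k) \<otimes>\<^bsub>M\<^esub> f (g, h \<otimes>\<^bsub>G\<^esub> k)"
      "f' (g, h) \<otimes>\<^bsub>M\<^esub> f' (g \<otimes>\<^bsub>G\<^esub> h, k) = f' (h, k) \<otimes>\<^bsub>M\<^esub> f' (g, h \<otimes>\<^bsub>G\<^esub> k)"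
      using f by (simp_all add: cocycles2_def)
    then have "(f (g, h) \<otimes>\<^bsub>M\<^esub> f (g \<otimes>\<^bsub>G\<^esub> h, k)) \<otimes>\<^bsub>M\<^esub> (f' (g, h) \<otimes>\<^bsub>M\<^esub> f' (g \<otimes>\<^bsub>G\<^esub> h, k))
        = (f (h, k) \<otimes>\<^bsub>M\<^esub> f (g, h \<otimes>\<^bsub>G\<^esub> k)) \<otimes>\<^bsub>M\<^esub> (f' (h, k) \<otimes>\<^bsub>M\<^esub> f' (g, h \<otimes>\<^bsub>G\<^esub> k))" by simp
    then show "(f \<otimes>\<^bsub>C2\<^esub> f') (g, h) \<otimes>\<^bsub>M\<^esub> (f \<otimes>\<^bsub>C2\<^esub> f') (g \<otimes>\<^bsub>G\<^esub> h, k)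
        = (f \<otimes>\<^bsub>C2\<^esub> f') (h, k) \<otimes>\<^bsub>M\<^esub> (f \<otimes>\<^bsub>C2\<^esub> f') (g, h \<otimes>\<^bsub>G\<^esub> k)"
      using ghk fC by (simp add: C2_mult C2_closed M.m_ac)
  qed (use fC in simp)
qed

lemma coboundary_cocycle:
  assumes c: "c \<in> carrier G \<rightarrow> carrier M" shows "coboundary c \<in> Z2"
  unfolding cocycles2_def
proof (intro CollectI conjI ballI coboundary_closed c)
  have cancel: "(b \<otimes>\<^bsub>M\<^esub> inv\<^bsub>M\<^esub> u \<otimes>\<^bsub>M\<^esub> a) \<otimes>\<^bsub>M\<^esub> (d \<otimes>\<^bsub>M\<^esub> inv\<^bsub>M\<^esub> w \<otimes>\<^bsub>M\<^esub> u) = a \<otimes>\<^bsub>M\<^esub> b \<otimes>\<^bsub>M\<^esub> d \<otimes>\<^bsub>M\<^esub> inv\<^bsub>M\<^esub> w"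
    if "a \<in> carrier M" "b \<in> carrier M" "d \<in> carrier M" "u \<in> carrier M" "w \<in> carrier M" for a b d u w
  proof -
    have "(b \<otimes>\<^bsub>M\<^esub> inv\<^bsub>M\<^esub> u \<otimes>\<^bsub>M\<^esub> a) \<otimes>\<^bsub>M\<^esub> (d \<otimes>\<^bsub>M\<^esub> inv\<^bsub>M\<^esub> w \<otimes>\<^bsub>M\<^esub> u)
        = (a \<otimes>\<^bsub>M\<^esub> b \<otimes>\<^bsub>M\<^esub> d \<otimes>\<^bsub>M\<^esub> inv\<^bsub>M\<^esub> w) \<otimes>\<^bsub>M\<^esub> (inv\<^bsub>M\<^esub> u \<otimes>\<^bsub>M\<^esub> u)"
      using that by (simp only: M.m_ac M.m_closed M.inv_closed)
    then show ?thesis using that by simp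
  qed
  fix g h k assume ghk: "g \<in> carrier G" "h \<in> carrier G" "k \<in> carrier G"
  have [simp]: "c x \<in> carrier M" if "x \<in> carrier G" for x using c that by auto
  have "coboundary c (g, h) \<otimes>\<^bsub>M\<^esub> coboundary c (g \<otimes>\<^bsub>G\<^esub> h, k)
      = c g \<otimes>\<^bsub>M\<^esub> c h \<otimes>\<^bsub>M\<^esub> c k \<otimes>\<^bsub>M\<^esub> inv\<^bsub>M\<^esub> c (g \<otimes>\<^bsub>G\<^esub> h \<otimes>\<^bsub>G\<^esub> k)"
    unfolding coboundary_apply[OF ghk(1,2)] coboundary_apply[OF G.m_closed[OF ghk(1,2)] ghk(3)]
    by (rule cancel) (use ghk in auto)
  moreover have "coboundary c (h, k) \<otimes>\<^bsub>M\<^esub> coboundary c (g, h \<otimes>\<^bsub>G\<^esub> k)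
      = (c k \<otimes>\<^bsub>M\<^esub> inv\<^bsub>M\<^esub> c (h \<otimes>\<^bsub>G\<^esub> k) \<otimes>\<^bsub>M\<^esub> c h) \<otimes>\<^bsub>M\<^esub> (c g \<otimes>\<^bsub>M\<^esub> inv\<^bsub>M\<^esub> c (g \<otimes>\<^bsub>G\<^esub> h \<otimes>\<^bsub>G\<^esub> k) \<otimes>\<^bsub>M\<^esub> c (h \<otimes>\<^bsub>G\<^esub> k))"
    using ghk by (simp add: coboundary_apply G.m_assoc M.m_ac)
  moreover have "\<dots> = c h \<otimes>\<^bsub>M\<^esub> c k \<otimes>\<^bsub>M\<^esub> c g \<otimes>\<^bsub>M\<^esub> inv\<^bsub>M\<^esub> c (g \<otimes>\<^bsub>G\<^esub> h \<otimes>\<^bsub>G\<^esub> k)"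
    by (rule cancel) (use ghk in auto)
  moreover have "c h \<otimes>\<^bsub>M\<^esub> c k \<otimes>\<^bsub>M\<^esub> c g = c g \<otimes>\<^bsub>M\<^esub> c h \<otimes>\<^bsub>M\<^esub> c k"
    using ghk by (simp add: M.m_ac)
  ultimately show "coboundary c (g, h) \<otimes>\<^bsub>M\<^esub> coboundary c (g \<otimes>\<^bsub>G\<^esub> h, k)
      = coboundary c (h, k) \<otimes>\<^bsub>M\<^esub> coboundary c (g, h \<otimes>\<^bsub>G\<^esub> k)" by simp
qed

abbreviation "ZG \<equiv> C2\<lparr>carrier := Z2\<rparr>"

lemma comm_group_ZG: "comm_group ZG"
proof -
  have "group ZG" by (rule C2.subgroup_imp_group[OF subgroup_Z2])
  then show ?thesis
    by (rule group.group_comm_groupI) (auto intro: C2_comm simp: cocycles2_def)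
qed

sublocale ZG: comm_group ZG by (rule comm_group_ZG)

lemma subgroup_B2: "subgroup B2 ZG"
proof (rule ZG.subgroupI)
  show "B2 \<subseteq> carrier ZG" unfolding B2_eq using coboundary_cocycle by auto
  have "coboundary (\<lambda>_. \<one>\<^bsub>M\<^esub>) \<in> B2" unfolding B2_eq by (intro imageI) auto
  then show "B2 \<noteq> {}" by blast
next
  fix b assume "b \<in> B2"
  then obtain c where c: "c \<in> carrier G \<rightarrow> carrier M" "b = coboundary c" unfolding B2_eq by blast
  define c' where "c' g = inv\<^bsub>M\<^esub> c g" for g
  have c': "c' \<in> carrier G \<rightarrow> carrier M" using c(1) M.inv_closed by (auto simp: c'_def Pi_iff)
  have [simp]: "c g \<in> carrier M" if "g \<in> carrier G" for g using c(1) that by auto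
  have "coboundary c' \<otimes>\<^bsub>C2\<^esub> coboundary c = \<one>\<^bsub>C2\<^esub>"
    unfolding coboundary_mult[OF c' c(1), symmetric]
    by (rule C2_eqI) (use c c' in \<open>auto simp: coboundary_apply C2_one c'_def intro!: coboundary_closed\<close>)
  then have "inv\<^bsub>ZG\<^esub> b = coboundary c'"
    using c c' coboundary_cocycle by (intro ZG.inv_equality) auto
  then show "inv\<^bsub>ZG\<^esub> b \<in> B2" unfolding B2_eq using c' by blast
next
  fix b b' assume "b \<in> B2" "b' \<in> B2"
  then obtain c c' where c: "c \<in> carrier G \<rightarrow> carrier M" "b = coboundary c"
    "c' \<in> carrier G \<rightarrow> carrier M" "b' = coboundary c'" unfolding B2_eq by blast
  then have "b \<otimes>\<^bsub>ZG\<^esub> b' = coboundary (\<lambda>g. c g \<otimes>\<^bsub>M\<^esub> c' g)"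
    by (simp add: coboundary_mult)
  then show "b \<otimes>\<^bsub>ZG\<^esub> b' \<in> B2" unfolding B2_eq using c by auto
qed

lemma B2_normal: "B2 \<lhd> ZG"
  by (rule ZG.normal_iff_subgroup[THEN iffD2]) (rule subgroup_B2)

lemma H2_eq: "H2 G M = ZG Mod B2"
  by (simp add: H2_def)

lemma central_cocycle: "f \<in> Z2 \<Longrightarrow> central_cocycle G M f"
  by unfold_locales (auto simp: cocycles2_def intro: C2_closed)

end

text \<open>The isomorphism is the transgression: a character \<open>\<chi>\<close> of the kernel \<open>A\<close> is sent to the class of
  \<open>\<chi> \<circ> \<kappa>\<close>, where \<open>\<kappa>\<close> is the cocycle of the central extension.  If \<open>\<chi> \<circ> \<kappa>\<close> is a
  coboundary, then \<open>\<chi>\<close> extends to a character of the whole group, which is trivial on the derived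
  subgroup and hence on \<open>A\<close>.  Conversely, if \<open>\<pi>\<close> lifts to a homomorphism into the extension given by
  a cocycle, then this lift restricts on \<open>A\<close> to a character whose image is the class of the cocycle.\<close>

theorem transgression_isomorphism:
  assumes "group_hom E G \<pi>" and onto: "\<pi> ` carrier E = carrier G"
    and A_def: "A = kernel E G \<pi>" and central: "A \<subseteq> center E" and derived: "A \<subseteq> derived E (carrier E)"
    and pairing: "perfect_pairing E A \<beta>"
    and lift: "\<And>f. f \<in> cocycles2 G complex_units \<Longrightarrow>
      \<exists>\<Phi>\<in>hom E (cocycle_extension G complex_units f). \<forall>x\<in>carrier E. fst (\<Phi> x) = \<pi> x"
  shows "E\<lparr>carrier := A\<rparr> \<cong> H2 G complex_units"
proof -
  interpret \<pi>: group_hom E G \<pi> by fact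
  interpret coh: cohomology G complex_units
    using \<pi>.H.is_group comm_group_complex_units by (simp add: cohomology_def)
  have A: "subgroup A E" unfolding A_def by (rule \<pi>.subgroup_kernel)
  have A_iff: "a \<in> A \<longleftrightarrow> a \<in> carrier E \<and> \<pi> a = \<one>\<^bsub>G\<^esub>" for a by (simp add: A_def kernel_def)
  have A_carrier: "a \<in> carrier E" if "a \<in> A" for a using that A_iff by blast
  have A_mult: "a \<otimes>\<^bsub>E\<^esub> b \<in> A" if "a \<in> A" "b \<in> A" for a b using that by (rule subgroup.m_closed[OF A])
  have A_comm: "a \<otimes>\<^bsub>E\<^esub> x = x \<otimes>\<^bsub>E\<^esub> a" if "a \<in> A" "x \<in> carrier E" for a x
    using \<pi>.G.centerD central that by blast
  \<comment> \<open>A set-theoretic section \<open>s\<close> and the cocycle \<open>\<kappa>\<close> by which it fails to be a homomorphism.\<close>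
  have "\<exists>x\<in>carrier E. \<pi> x = g" if "g \<in> carrier G" for g using that unfolding onto[symmetric] by blast
  then obtain s where s: "\<And>g. g \<in> carrier G \<Longrightarrow> s g \<in> carrier E" "\<And>g. g \<in> carrier G \<Longrightarrow> \<pi> (s g) = g" by metis
  define \<kappa> where "\<kappa> g h = s g \<otimes>\<^bsub>E\<^esub> s h \<otimes>\<^bsub>E\<^esub> inv\<^bsub>E\<^esub> s (g \<otimes>\<^bsub>G\<^esub> h)" for g h
  have \<kappa>: "\<kappa> g h \<in> A" "s g \<otimes>\<^bsub>E\<^esub> s h = \<kappa> g h \<otimes>\<^bsub>E\<^esub> s (g \<otimes>\<^bsub>G\<^esub> h)" if "g \<in> carrier G" "h \<in> carrier G" for g h
  proof -
    show "\<kappa> g h \<in> A" using that s by (simp add: \<kappa>_def A_iff)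
    show "s g \<otimes>\<^bsub>E\<^esub> s h = \<kappa> g h \<otimes>\<^bsub>E\<^esub> s (g \<otimes>\<^bsub>G\<^esub> h)" using that s by (simp add: \<kappa>_def \<pi>.G.m_assoc)
  qed
  have \<beta>_nz: "\<beta> a b \<noteq> 0" if "a \<in> A" "b \<in> A" for a b
    using pairing that unfolding perfect_pairing_def hom_def by auto
  have \<beta>_right: "\<beta> a (b \<otimes>\<^bsub>E\<^esub> c) = \<beta> a b * \<beta> a c" if "a \<in> A" "b \<in> A" "c \<in> A" for a b c
    using pairing that unfolding perfect_pairing_def hom_def by auto
  have \<beta>_left: "\<beta> (a \<otimes>\<^bsub>E\<^esub> b) c = \<beta> a c * \<beta> b c" if "a \<in> A" "b \<in> A" "c \<in> A" for a b c
    using pairing that unfolding perfect_pairing_def by blast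
  have \<kappa>_cocycle: "\<kappa> g h \<otimes>\<^bsub>E\<^esub> \<kappa> (g \<otimes>\<^bsub>G\<^esub> h) k = \<kappa> h k \<otimes>\<^bsub>E\<^esub> \<kappa> g (h \<otimes>\<^bsub>G\<^esub> k)"
    if ghk: "g \<in> carrier G" "h \<in> carrier G" "k \<in> carrier G" for g h k
  proof -
    note cl = s(1)[OF ghk(1)] s(1)[OF ghk(2)] s(1)[OF ghk(3)] s(1)[of "g \<otimes>\<^bsub>G\<^esub> h \<otimes>\<^bsub>G\<^esub> k"]
      A_carrier[OF \<kappa>(1)]
    have "(\<kappa> g h \<otimes>\<^bsub>E\<^esub> \<kappa> (g \<otimes>\<^bsub>G\<^esub> h) k) \<otimes>\<^bsub>E\<^esub> s (g \<otimes>\<^bsub>G\<^esub> h \<otimes>\<^bsub>G\<^esub> k) = \<kappa> g h \<otimes>\<^bsub>E\<^esub> (s (g \<otimes>\<^bsub>G\<^esub> h) \<otimes>\<^bsub>E\<^esub> s k)"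
      using ghk cl by (simp add: \<kappa>(2)[of "g \<otimes>\<^bsub>G\<^esub> h" k] \<pi>.G.m_assoc)
    also have "\<dots> = (s g \<otimes>\<^bsub>E\<^esub> s h) \<otimes>\<^bsub>E\<^esub> s k"
      using ghk cl s(1) by (simp add: \<kappa>(2)[of g h] \<pi>.G.m_assoc)
    also have "\<dots> = s g \<otimes>\<^bsub>E\<^esub> (\<kappa> h k \<otimes>\<^bsub>E\<^esub> s (h \<otimes>\<^bsub>G\<^esub> k))"
      using ghk cl by (simp add: \<kappa>(2)[of h k, symmetric] \<pi>.G.m_assoc)
    also have "\<dots> = \<kappa> h k \<otimes>\<^bsub>E\<^esub> (s g \<otimes>\<^bsub>E\<^esub> s (h \<otimes>\<^bsub>G\<^esub> k))"
      using ghk cl s(1) A_comm[OF \<kappa>(1)[OF ghk(2,3)] cl(1)] by (simp flip: \<pi>.G.m_assoc)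
    also have "\<dots> = (\<kappa> h k \<otimes>\<^bsub>E\<^esub> \<kappa> g (h \<otimes>\<^bsub>G\<^esub> k)) \<otimes>\<^bsub>E\<^esub> s (g \<otimes>\<^bsub>G\<^esub> h \<otimes>\<^bsub>G\<^esub> k)"
      using ghk cl by (simp add: \<kappa>(2)[of g "h \<otimes>\<^bsub>G\<^esub> k"] \<pi>.G.m_assoc \<pi>.H.m_assoc)
    finally show ?thesis using ghk cl by (metis \<pi>.G.m_closed \<pi>.G.right_cancel \<pi>.H.m_closed)
  qed
  define F where "F a = (\<lambda>(g, h)\<in>carrier G \<times> carrier G. \<beta> a (\<kappa> g h))" for a
  have F: "F a (g, h) = \<beta> a (\<kappa> g h)" if "g \<in> carrier G" "h \<in> carrier G" for a g h
    using that by (simp add: F_def)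
  have F_C2: "F a \<in> carrier coh.C2" if "a \<in> A" for a
    unfolding coh.C2_carrier F_def using that \<beta>_nz \<kappa>(1) by auto
  have F_Z2: "F a \<in> coh.Z2" if "a \<in> A" for a
    unfolding cocycles2_def
  proof (intro CollectI conjI ballI F_C2 that)
    fix g h k assume ghk: "g \<in> carrier G" "h \<in> carrier G" "k \<in> carrier G"
    then show "F a (g, h) \<otimes>\<^bsub>complex_units\<^esub> F a (g \<otimes>\<^bsub>G\<^esub> h, k) = F a (h, k) \<otimes>\<^bsub>complex_units\<^esub> F a (g, h \<otimes>\<^bsub>G\<^esub> k)"
      using that \<kappa>(1) \<kappa>_cocycle[OF ghk] by (simp add: F flip: \<beta>_right)
  qed
  have F_mult: "F (a \<otimes>\<^bsub>E\<^esub> b) = F a \<otimes>\<^bsub>coh.C2\<^esub> F b" if "a \<in> A" "b \<in> A" for a b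
    by (rule coh.C2_eqI) (use that F_C2 A_mult \<beta>_left \<kappa>(1) in \<open>auto simp: coh.C2_mult F\<close>)
  have F_trivial: "a = \<one>\<^bsub>E\<^esub>" if a: "a \<in> A" and "F a \<in> coh.B2" for a
  proof -
    from that obtain c where c: "c \<in> carrier G \<rightarrow> - {0}" "F a = coh.coboundary c"
      unfolding coh.B2_eq by auto
    have c_nz: "c g \<noteq> 0" if "g \<in> carrier G" for g using c(1) that by auto
    have \<beta>\<kappa>: "\<beta> a (\<kappa> g h) * c (g \<otimes>\<^bsub>G\<^esub> h) = c g * c h" if "g \<in> carrier G" "h \<in> carrier G" for g h
    proof -
      have "\<beta> a (\<kappa> g h) = c h * inverse (c (g \<otimes>\<^bsub>G\<^esub> h)) * c g"
        using F[OF that, of a] coh.coboundary_apply[OF that, of c] c_nz[of "g \<otimes>\<^bsub>G\<^esub> h"] that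
        unfolding c(2) by simp
      then show ?thesis using c_nz[of "g \<otimes>\<^bsub>G\<^esub> h"] that by (simp add: field_simps)
    qed
    \<comment> \<open>Each \<open>x\<close> is the product of \<open>r x\<close> in \<open>A\<close> and the representative of its class.  Since \<open>c\<close> trivializes
      the cocycle, \<open>\<beta> a\<close> on the first factor and \<open>c\<close> on the second combine to a character of \<open>E\<close>.\<close>
    define r where "r x = x \<otimes>\<^bsub>E\<^esub> inv\<^bsub>E\<^esub> s (\<pi> x)" for x
    have r: "r x \<in> A" "x = r x \<otimes>\<^bsub>E\<^esub> s (\<pi> x)" if "x \<in> carrier E" for x
    proof -
      show "r x \<in> A" using that s by (simp add: r_def A_iff)
      show "x = r x \<otimes>\<^bsub>E\<^esub> s (\<pi> x)" using that s by (simp add: r_def \<pi>.G.m_assoc)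
    qed
    have r_mult: "r (x \<otimes>\<^bsub>E\<^esub> y) = r x \<otimes>\<^bsub>E\<^esub> r y \<otimes>\<^bsub>E\<^esub> \<kappa> (\<pi> x) (\<pi> y)" if xy: "x \<in> carrier E" "y \<in> carrier E" for x y
    proof -
      note cl = A_carrier[OF r(1)] A_carrier[OF \<kappa>(1)] s(1)
      have "r (x \<otimes>\<^bsub>E\<^esub> y) \<otimes>\<^bsub>E\<^esub> s (\<pi> x \<otimes>\<^bsub>G\<^esub> \<pi> y) = x \<otimes>\<^bsub>E\<^esub> y"
        using r(2)[of "x \<otimes>\<^bsub>E\<^esub> y"] xy by simp
      also have "\<dots> = (r x \<otimes>\<^bsub>E\<^esub> s (\<pi> x)) \<otimes>\<^bsub>E\<^esub> (r y \<otimes>\<^bsub>E\<^esub> s (\<pi> y))"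
        using r(2) xy by simp
      also have "\<dots> = r x \<otimes>\<^bsub>E\<^esub> ((r y \<otimes>\<^bsub>E\<^esub> s (\<pi> x)) \<otimes>\<^bsub>E\<^esub> s (\<pi> y))"
        using xy cl A_comm[OF r(1)[OF xy(2)], of "s (\<pi> x)"] by (simp add: \<pi>.G.m_assoc)
      also have "\<dots> = (r x \<otimes>\<^bsub>E\<^esub> r y \<otimes>\<^bsub>E\<^esub> \<kappa> (\<pi> x) (\<pi> y)) \<otimes>\<^bsub>E\<^esub> s (\<pi> x \<otimes>\<^bsub>G\<^esub> \<pi> y)"
        using xy cl \<kappa>(2)[of "\<pi> x" "\<pi> y"] by (simp add: \<pi>.G.m_assoc)
      finally show ?thesis using xy cl by (simp del: \<pi>.hom_mult)
    qed
    define \<chi> where "\<chi> x = \<beta> a (r x) * c (\<pi> x)" for x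
    have "\<chi> \<in> hom E complex_units"
    proof (rule homI)
      fix x y assume xy: "x \<in> carrier E" "y \<in> carrier E"
      have "\<chi> (x \<otimes>\<^bsub>E\<^esub> y) = \<beta> a (r x) * \<beta> a (r y) * (\<beta> a (\<kappa> (\<pi> x) (\<pi> y)) * c (\<pi> x \<otimes>\<^bsub>G\<^esub> \<pi> y))"
        using xy r(1) \<kappa>(1) a by (simp add: \<chi>_def r_mult \<beta>_right A_mult)
      then show "\<chi> (x \<otimes>\<^bsub>E\<^esub> y) = \<chi> x \<otimes>\<^bsub>complex_units\<^esub> \<chi> y"
        using xy by (simp add: \<chi>_def \<beta>\<kappa> mult_ac)
    qed (use a r(1) \<beta>_nz c_nz in \<open>auto simp: \<chi>_def\<close>)
    then have \<chi>_one: "\<chi> b = 1" if "b \<in> A" for b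
      using \<pi>.G.derived_eq_one_hom[OF comm_group_complex_units, of \<chi> b] derived that by auto
    have "\<beta> a b = 1" if b: "b \<in> A" for b
    proof -
      have "inv\<^bsub>E\<^esub> s \<one>\<^bsub>G\<^esub> \<in> A" using s by (simp add: A_iff)
      then have "\<chi> b = \<beta> a b * \<chi> \<one>\<^bsub>E\<^esub>"
        using a b A_iff[of b] by (simp add: \<chi>_def r_def \<beta>_right A_carrier)
      then show ?thesis using \<chi>_one[OF b] \<chi>_one[of "\<one>\<^bsub>E\<^esub>"] by (simp add: A_iff)
    qed
    then show ?thesis using pairing a unfolding perfect_pairing_def by blast
  qed
  have F_onto: "\<exists>a\<in>A. \<exists>b\<in>coh.B2. f = b \<otimes>\<^bsub>coh.C2\<^esub> F a" if f: "f \<in> coh.Z2" for f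
  proof -
    interpret f: central_cocycle G complex_units f by (rule coh.central_cocycle[OF f])
    from lift[OF f] obtain \<Phi> where \<Phi>: "\<Phi> \<in> hom E f.E" "\<And>x. x \<in> carrier E \<Longrightarrow> fst (\<Phi> x) = \<pi> x" by blast
    define \<mu> where "\<mu> x = snd (\<Phi> x)" for x
    have \<Phi>_eq: "\<Phi> x = (\<pi> x, \<mu> x)" if "x \<in> carrier E" for x
      using \<Phi>(2)[OF that] by (simp add: \<mu>_def prod_eq_iff)
    have \<mu>_nz: "\<mu> x \<noteq> 0" if "x \<in> carrier E" for x
      using hom_in_carrier[OF \<Phi>(1) that] by (simp add: \<Phi>_eq that)
    have \<mu>_mult: "\<mu> (x \<otimes>\<^bsub>E\<^esub> y) = \<mu> x * \<mu> y * f (\<pi> x, \<pi> y)" if "x \<in> carrier E" "y \<in> carrier E" for x y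
      using hom_mult[OF \<Phi>(1) that] that by (simp add: \<Phi>_eq)
    define \<chi> where "\<chi> b = \<mu> b * f.e" for b
    have e_nz: "f.e \<noteq> 0" using f.e_closed by simp
    have "\<chi> \<in> hom (E\<lparr>carrier := A\<rparr>) complex_units"
      by (rule homI) (use \<mu>_nz e_nz in \<open>auto simp: \<chi>_def A_iff \<mu>_mult\<close>)
    then obtain a where a: "a \<in> A" "\<And>b. b \<in> A \<Longrightarrow> \<chi> b = \<beta> a b"
      using pairing unfolding perfect_pairing_def by blast
    \<comment> \<open>The second component of the lift, taken on representatives, is the cochain relating the two cocycles.\<close>
    define c where "c g = inverse (\<mu> (s g))" for g
    have c: "c \<in> carrier G \<rightarrow> carrier complex_units" using s(1) \<mu>_nz by (auto simp: c_def)
    have "f = coh.coboundary c \<otimes>\<^bsub>coh.C2\<^esub> F a"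
    proof (rule coh.C2_eqI)
      show "f \<in> carrier coh.C2" using f by (simp add: cocycles2_def)
      show "coh.coboundary c \<otimes>\<^bsub>coh.C2\<^esub> F a \<in> carrier coh.C2"
        using coh.coboundary_closed[OF c] F_C2[OF a(1)] by simp
      fix g h assume gh: "g \<in> carrier G" "h \<in> carrier G"
      have "\<mu> (s g) * \<mu> (s h) * f (g, h) = \<mu> (\<kappa> g h \<otimes>\<^bsub>E\<^esub> s (g \<otimes>\<^bsub>G\<^esub> h))"
        using gh s \<mu>_mult[of "s g" "s h"] \<kappa>(2)[OF gh] by simp
      also have "\<dots> = \<beta> a (\<kappa> g h) * \<mu> (s (g \<otimes>\<^bsub>G\<^esub> h))"
        using gh s \<kappa>(1)[OF gh] a(2)[OF \<kappa>(1)[OF gh]]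
        by (simp add: A_iff \<mu>_mult) (simp add: \<chi>_def mult_ac)
      finally have "\<mu> (s g) * \<mu> (s h) * f (g, h) = \<beta> a (\<kappa> g h) * \<mu> (s (g \<otimes>\<^bsub>G\<^esub> h))" .
      moreover have "(coh.coboundary c \<otimes>\<^bsub>coh.C2\<^esub> F a) (g, h)
          = inverse (\<mu> (s h)) * \<mu> (s (g \<otimes>\<^bsub>G\<^esub> h)) * inverse (\<mu> (s g)) * \<beta> a (\<kappa> g h)"
        using gh s \<mu>_nz by (simp add: coh.C2_mult coh.coboundary_apply F c_def)
      moreover have nz: "\<mu> (s g) \<noteq> 0" "\<mu> (s h) \<noteq> 0" using gh s(1) \<mu>_nz by auto
      ultimately have "\<mu> (s g) * (\<mu> (s h) * f (g, h))
          = \<mu> (s g) * (\<mu> (s h) * (coh.coboundary c \<otimes>\<^bsub>coh.C2\<^esub> F a) (g, h))"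
        by (simp add: field_simps)
      then show "f (g, h) = (coh.coboundary c \<otimes>\<^bsub>coh.C2\<^esub> F a) (g, h)"
        by (simp only: mult_left_cancel[OF nz(1)] mult_left_cancel[OF nz(2)])
    qed
    then show ?thesis using a(1) c unfolding coh.B2_eq by blast
  qed
  define \<Psi> where "\<Psi> a = r_coset coh.ZG coh.B2 (F a)" for a
  interpret B2: normal coh.B2 coh.ZG by (rule coh.B2_normal)
  have "\<Psi> \<in> hom (E\<lparr>carrier := A\<rparr>) (H2 G complex_units)"
  proof -
    have "F \<in> hom (E\<lparr>carrier := A\<rparr>) coh.ZG"
      by (rule homI) (auto simp: F_Z2 F_mult)
    from hom_compose[OF this B2.r_coset_hom_Mod] show ?thesis
      by (simp add: \<Psi>_def[abs_def] coh.H2_eq comp_def)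
  qed
  moreover have "inj_on \<Psi> A"
  proof -
    interpret \<Psi>: group_hom "E\<lparr>carrier := A\<rparr>" "H2 G complex_units" \<Psi>
      using \<open>\<Psi> \<in> _\<close> subgroup.subgroup_is_group[OF A \<pi>.G.is_group] B2.factorgroup_is_group
      by (simp add: group_hom_def group_hom_axioms_def coh.H2_eq)
    have "a = \<one>\<^bsub>E\<^esub>" if a: "a \<in> A" "\<Psi> a = \<one>\<^bsub>H2 G complex_units\<^esub>" for a
    proof (rule F_trivial[OF a(1)])
      have "r_coset coh.ZG coh.B2 (F a) = coh.B2" using a(2) by (simp add: \<Psi>_def coh.H2_eq)
      then show "F a \<in> coh.B2"
        using coh.ZG.rcos_self[of "F a" coh.B2] F_Z2[OF a(1)] B2.is_subgroup by simp
    qed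
    then show ?thesis using \<Psi>.inj_on_one_iff by simp
  qed
  moreover have "\<Psi> ` A = carrier (H2 G complex_units)"
  proof
    show "\<Psi> ` A \<subseteq> carrier (H2 G complex_units)" using hom_carrier[OF \<open>\<Psi> \<in> _\<close>] by simp
    show "carrier (H2 G complex_units) \<subseteq> \<Psi> ` A"
    proof
      fix K assume "K \<in> carrier (H2 G complex_units)"
      then obtain f where f: "f \<in> coh.Z2" "K = r_coset coh.ZG coh.B2 f"
        by (auto simp: coh.H2_eq carrier_FactGroup)
      from F_onto[OF f(1)] obtain a b where ab: "a \<in> A" "b \<in> coh.B2" "f = b \<otimes>\<^bsub>coh.C2\<^esub> F a" by blast
      have "f \<in> r_coset coh.ZG coh.B2 (F a)" using ab by (auto simp: r_coset_def)
      then have "r_coset coh.ZG coh.B2 (F a) = r_coset coh.ZG coh.B2 f"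
        by (rule coh.ZG.repr_independence) (simp_all add: F_Z2[OF ab(1)] B2.is_subgroup)
      then show "K \<in> \<Psi> ` A" using ab f by (auto simp: \<Psi>_def)
    qed
  qed
  ultimately have "\<Psi> \<in> iso (E\<lparr>carrier := A\<rparr>) (H2 G complex_units)"
    by (simp add: iso_def bij_betw_def)
  then show ?thesis by (rule is_isoI)
qed

section \<open>The Heisenberg group over the quadratic extension\<close>

lemma (in group) commutator_in_derived:
  assumes "x \<in> carrier G" "y \<in> carrier G" shows "commutator G x y \<in> derived G (carrier G)"
proof -
  have "commutator G x y = inv x \<otimes> inv y \<otimes> inv (inv x) \<otimes> inv (inv y)"
    using assms by (simp add: commutator_def)
  then show ?thesis
    unfolding derived_def using assms by (intro generate.incl UN_I[of "inv x"] UN_I[of "inv y"]) auto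
qed

lemma (in group_hom) hom_eq_on_generate:
  assumes "group_hom G H h'" "S \<subseteq> carrier G" "\<And>s. s \<in> S \<Longrightarrow> h s = h' s" "x \<in> generate G S"
  shows "h x = h' x"
proof -
  interpret h': group_hom G H h' by fact
  show ?thesis using assms(4)
  proof (induction rule: generate.induct)
    case (inv s)
    then show ?case using assms(2,3) by (simp add: subset_iff)
  next
    case (eng a b)
    then show ?case using G.generate_in_carrier[OF assms(2)] by simp
  qed (use assms(3) in auto)
qed

lemma (in heisenberg_base) centrals_trivial: "cover_centrals G k x1 x2 y1 y2 \<subseteq> {\<one>}"
  using z_center
  by (simp add: cover_centrals_def Let_def commuting bilinear commutator_center int_pow_neg)

context quadratic_coordinates
begin

abbreviation "UT \<equiv> unitriangular 3 R"

sublocale UT: group UT by (rule group_unitriangular_3)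

lemma heis_closed [simp]: "a \<in> carrier R \<Longrightarrow> b \<in> carrier R \<Longrightarrow> c \<in> carrier R \<Longrightarrow> heis R a b c \<in> carrier UT"
  by (auto simp: carrier_unitriangular_3)

lemma commutator_heis:
  assumes "a \<in> carrier R" "b \<in> carrier R" "c \<in> carrier R" "a' \<in> carrier R" "b' \<in> carrier R" "c' \<in> carrier R"
  shows "commutator UT (heis R a b c) (heis R a' b' c') = heis R \<zero> \<zero> (a \<otimes> b' \<ominus> a' \<otimes> b)"
proof (rule UT.commutator_eqI)
  have "c \<oplus> a \<otimes> b' \<oplus> c' = c' \<oplus> a' \<otimes> b \<oplus> (c \<oplus> (a \<otimes> b' \<ominus> a' \<otimes> b))"
    using assms by algebra
  then show "heis R a b c \<otimes>\<^bsub>UT\<^esub> heis R a' b' c'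
      = heis R a' b' c' \<otimes>\<^bsub>UT\<^esub> (heis R a b c \<otimes>\<^bsub>UT\<^esub> heis R \<zero> \<zero> (a \<otimes> b' \<ominus> a' \<otimes> b))"
    using assms by (simp add: a_comm)
qed (use assms in auto)

lemma heis_central: "c \<in> carrier R \<Longrightarrow> heis R \<zero> \<zero> c \<in> center UT"
  by (auto simp: center_def carrier_unitriangular_3 a_comm)

lemma group_add_monoid: "group (add_monoid R)" by (rule add.is_group)

lemma heis_int_pow:
  assumes "r \<in> carrier R"
  shows "heis R r \<zero> \<zero> [^]\<^bsub>UT\<^esub> (n::int) = heis R (add_pow R n r) \<zero> \<zero>"
    and "heis R \<zero> r \<zero> [^]\<^bsub>UT\<^esub> (n::int) = heis R \<zero> (add_pow R n r) \<zero>"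
    and "heis R \<zero> \<zero> r [^]\<^bsub>UT\<^esub> (n::int) = heis R \<zero> \<zero> (add_pow R n r)"
proof -
  have "(\<lambda>r. heis R r \<zero> \<zero>) \<in> hom (add_monoid R) UT" "(\<lambda>r. heis R \<zero> r \<zero>) \<in> hom (add_monoid R) UT"
    "(\<lambda>r. heis R \<zero> \<zero> r) \<in> hom (add_monoid R) UT" by (auto intro!: homI)
  from this[THEN hom_int_pow, OF _ group_add_monoid UT.is_group, of r n] assms
  show "heis R r \<zero> \<zero> [^]\<^bsub>UT\<^esub> n = heis R (add_pow R n r) \<zero> \<zero>"
    "heis R \<zero> r \<zero> [^]\<^bsub>UT\<^esub> n = heis R \<zero> (add_pow R n r) \<zero>"
    "heis R \<zero> \<zero> r [^]\<^bsub>UT\<^esub> n = heis R \<zero> \<zero> (add_pow R n r)"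
    by (simp_all add: add_pow_def)
qed

definition "mx1 = heis R \<zero> \<one> \<zero>"
definition "mx2 = heis R \<zero> \<tau> \<zero>"
definition "my1 = heis R \<one> \<zero> \<zero>"
definition "my2 = heis R \<tau> \<zero> \<zero>"

lemma matrices_closed [simp]: "mx1 \<in> carrier UT" "mx2 \<in> carrier UT" "my1 \<in> carrier UT" "my2 \<in> carrier UT"
  by (simp_all add: mx1_def mx2_def my1_def my2_def)

lemma matrices_commutators:
  "commutator UT my1 mx1 = heis R \<zero> \<zero> \<one>" "commutator UT my1 mx2 = heis R \<zero> \<zero> \<tau>"
  by (simp_all add: mx1_def mx2_def my1_def commutator_heis a_minus_def)

sublocale base: heisenberg_base UT p k mx1 mx2 my1 my2
proof unfold_locales
  show "commutator UT mx2 mx1 = \<one>\<^bsub>UT\<^esub>" "commutator UT my2 my1 = \<one>\<^bsub>UT\<^esub>"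
    by (simp_all add: mx1_def mx2_def my1_def my2_def commutator_heis heis_one a_minus_def)
  show "commutator UT my2 mx1 = commutator UT my1 mx2"
    unfolding matrices_commutators by (simp add: mx1_def my2_def commutator_heis a_minus_def)
  show "commutator UT my2 mx2 = commutator UT my1 mx1 [^]\<^bsub>UT\<^esub> k"
    unfolding matrices_commutators by (simp add: mx2_def my2_def commutator_heis a_minus_def heis_int_pow \<tau>_square)
  show "commutator UT my1 mx1 \<in> center UT" "commutator UT my1 mx2 \<in> center UT"
    unfolding matrices_commutators by (simp_all add: heis_central)
qed (use odd_p in auto)

lemma normal_form_eq: "base.normal_form a b c d e f = heis R (lin c d) (lin a b) (lin e f)"
  unfolding base.normal_form_def matrices_commutators
  by (simp add: mx1_def mx2_def my1_def my2_def heis_int_pow lin_def a_assoc)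

text \<open>This uses that \<open>1\<close> and \<open>\<tau>\<close> are linearly independent over the prime field.\<close>

lemma normal_form_eq_one_iff:
  "base.normal_form a b c d e f = \<one>\<^bsub>UT\<^esub> \<longleftrightarrow> (\<forall>n\<in>{a, b, c, d, e, f}. int p dvd n)"
  by (auto simp: normal_form_eq heis_one lin_zero_iff)

lemma p_annihilates: "r \<in> carrier R \<Longrightarrow> add_pow R (int p) r = \<zero>"
  using lin_exhausts[of r] by (auto simp: lin_add_pow lin_zero_iff)

lemma matrices_pow: "mx1 [^]\<^bsub>UT\<^esub> p = \<one>\<^bsub>UT\<^esub>" "mx2 [^]\<^bsub>UT\<^esub> p = \<one>\<^bsub>UT\<^esub>" "my1 [^]\<^bsub>UT\<^esub> p = \<one>\<^bsub>UT\<^esub>" "my2 [^]\<^bsub>UT\<^esub> p = \<one>\<^bsub>UT\<^esub>"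
  by (simp_all add: mx1_def mx2_def my1_def my2_def heis_one heis_int_pow p_annihilates flip: int_pow_int)

lemma finite_UT: "finite (carrier UT)"
proof -
  have "carrier UT = (\<lambda>(a, b, c). heis R a b c) ` (carrier R \<times> carrier R \<times> carrier R)"
    by (force simp: carrier_unitriangular_3)
  then show ?thesis using finite_carrier by simp
qed

lemma heisenberg_cover_UT: "heisenberg_cover UT p k mx1 mx2 my1 my2"
proof (rule base.cover_of_central_extension[where h = "\<lambda>x. x"])
  show "group_hom UT UT (\<lambda>x. x)" by unfold_locales (auto simp: hom_def)
qed (use matrices_pow UT.center_one in auto)

text \<open>With \<open>(y, b, z)\<close> for the entries of a matrix, the extension by this cocycle is the semidirect product of \<open>R\<^sup>3\<close> by
  \<open>R\<close> in which \<open>b\<close> acts by \<open>(y, z, v) \<mapsto> (y, z + y b, v + 2 z b + y b\<^sup>2)\<close>.  This is the action of \<open>exp (b N)\<close> for a nilpotent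
  matrix \<open>N\<close> with \<open>N\<^sup>3 = 0\<close>, where the last coordinate is doubled to avoid division by two.\<close>

definition class3_cocycle :: "(nat \<times> nat \<Rightarrow> 'a) \<times> (nat \<times> nat \<Rightarrow> 'a) \<Rightarrow> 'a" where
  "class3_cocycle = (\<lambda>(A, B). A (0, 2) \<otimes> B (Suc 0, 2) \<oplus> A (0, 2) \<otimes> B (Suc 0, 2)
     \<oplus> A (0, Suc 0) \<otimes> (B (Suc 0, 2) \<otimes> B (Suc 0, 2)))"

lemma class3_cocycle_heis [simp]:
  "class3_cocycle (heis R a b c, heis R a' b' c') = c \<otimes> b' \<oplus> c \<otimes> b' \<oplus> a \<otimes> (b' \<otimes> b')"
  by (simp add: class3_cocycle_def)

lemma central_cocycle_class3: "central_cocycle UT (add_monoid R) class3_cocycle"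
proof -
  interpret M: comm_group "add_monoid R" by (rule add.comm_group_axioms)
  show ?thesis
  proof unfold_locales
    fix g h assume "g \<in> carrier UT" "h \<in> carrier UT"
    then show "class3_cocycle (g, h) \<in> carrier (add_monoid R)"
      by (auto simp: carrier_unitriangular_3)
  next
    fix A B C assume "A \<in> carrier UT" "B \<in> carrier UT" "C \<in> carrier UT"
    then obtain a b c a' b' c' a'' b'' c'' where
      ABC: "A = heis R a b c" "B = heis R a' b' c'" "C = heis R a'' b'' c''" and
      [simp]: "a \<in> carrier R" "b \<in> carrier R" "c \<in> carrier R" "a' \<in> carrier R" "b' \<in> carrier R"
        "c' \<in> carrier R" "a'' \<in> carrier R" "b'' \<in> carrier R" "c'' \<in> carrier R"
      by (auto simp: carrier_unitriangular_3)
    have "(c \<otimes> b' \<oplus> c \<otimes> b' \<oplus> a \<otimes> (b' \<otimes> b')) \<oplus> ((c \<oplus> a \<otimes> b' \<oplus> c') \<otimes> b'' \<oplus> (c \<oplus> a \<otimes> b' \<oplus> c') \<otimes> b'' \<oplus> (a \<oplus> a') \<otimes> (b'' \<otimes> b''))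
      = (c' \<otimes> b'' \<oplus> c' \<otimes> b'' \<oplus> a' \<otimes> (b'' \<otimes> b'')) \<oplus> (c \<otimes> (b' \<oplus> b'') \<oplus> c \<otimes> (b' \<oplus> b'') \<oplus> a \<otimes> ((b' \<oplus> b'') \<otimes> (b' \<oplus> b'')))"
      by (simp add: l_distr r_distr a_ac m_ac)
    then show "class3_cocycle (A, B) \<otimes>\<^bsub>add_monoid R\<^esub> class3_cocycle (A \<otimes>\<^bsub>UT\<^esub> B, C)
        = class3_cocycle (B, C) \<otimes>\<^bsub>add_monoid R\<^esub> class3_cocycle (A, B \<otimes>\<^bsub>UT\<^esub> C)"
      by (simp add: ABC)
  qed
qed

end

section \<open>The kernel of the projection onto the Heisenberg group\<close>

locale gstar_projection = quadratic_coordinates +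
  fixes \<pi>
  assumes \<pi>_hom: "\<pi> \<in> hom (Gstar p k) UT"
    and \<pi>_gen: "\<pi> (gstar.gen p k X1) = mx1" "\<pi> (gstar.gen p k X2) = mx2"
      "\<pi> (gstar.gen p k Y1) = my1" "\<pi> (gstar.gen p k Y2) = my2"
begin

sublocale gs: gstar p k by unfold_locales (rule odd_p)

abbreviation "GS \<equiv> Gstar p k"
abbreviation "X1' \<equiv> gs.gen X1"
abbreviation "X2' \<equiv> gs.gen X2"
abbreviation "Y1' \<equiv> gs.gen Y1"
abbreviation "Y2' \<equiv> gs.gen Y2"

sublocale GS: heisenberg_cover GS p k X1' X2' Y1' Y2'
  by (rule gs.heisenberg_cover_Gstar)

sublocale \<pi>: group_hom GS UT \<pi>
  by unfold_locales (rule \<pi>_hom)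

definition "centrals = cover_centrals GS k X1' X2' Y1' Y2'"
definition "A = generate GS centrals"

lemma centrals_closed: "centrals \<subseteq> carrier GS"
  unfolding centrals_def using GS.centrals_central GS.center_closed by blast

lemma A_subgroup: "subgroup A GS"
  unfolding A_def by (rule GS.generate_is_subgroup[OF centrals_closed])

lemma A_central: "A \<subseteq> center GS"
  unfolding A_def centrals_def
  by (rule GS.generate_subgroup_incl[OF GS.centrals_central GS.center_subgroup])

text \<open>Each of \<open>w\<^sub>j\<close>, \<open>u\<^sub>i\<close>, \<open>v\<^sub>i\<close> is a commutator or a product of commutators and their powers.\<close>

lemma A_derived: "A \<subseteq> derived GS (carrier GS)"
  unfolding A_def
proof (rule GS.generate_subgroup_incl)
  interpret D: subgroup "derived GS (carrier GS)" GS by (rule GS.derived_is_subgroup) simp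
  have "GS.z1 [^]\<^bsub>GS\<^esub> (- k) \<in> derived GS (carrier GS)"
    unfolding GS.z1_def using GS.subgroup_int_pow_closed[OF D.is_subgroup] GS.commutator_in_derived by simp
  then have "GS.w3 \<in> derived GS (carrier GS)" "GS.w2 \<in> derived GS (carrier GS)"
    unfolding GS.w3_def GS.w2_def GS.z2_def using GS.commutator_in_derived
    by (auto intro!: D.m_closed D.m_inv_closed)
  then show "centrals \<subseteq> derived GS (carrier GS)"
    unfolding centrals_def GS.centrals_eq using GS.commutator_in_derived by auto
  show "subgroup (derived GS (carrier GS)) GS" by (rule D.is_subgroup)
qed

lemma A_in_kernel: "a \<in> A \<Longrightarrow> \<pi> a = \<one>\<^bsub>UT\<^esub>"
proof -
  have "\<pi> ` centrals \<subseteq> {\<one>\<^bsub>UT\<^esub>}"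
    unfolding centrals_def
    by (subst \<pi>.cover_centrals_image) (use base.centrals_trivial in \<open>simp_all add: \<pi>_gen\<close>)
  then have "A \<subseteq> kernel GS UT \<pi>"
    unfolding A_def using centrals_closed
    by (intro GS.generate_subgroup_incl \<pi>.subgroup_kernel) (auto simp: kernel_def)
  then show "a \<in> A \<Longrightarrow> \<pi> a = \<one>\<^bsub>UT\<^esub>" by (auto simp: kernel_def)
qed

definition word :: "int \<Rightarrow> int \<Rightarrow> int \<Rightarrow> int \<Rightarrow> int \<Rightarrow> int \<Rightarrow> (bool \<times> generator) list set set" where
  "word a b c d e f = X1' [^]\<^bsub>GS\<^esub> a \<otimes>\<^bsub>GS\<^esub> (X2' [^]\<^bsub>GS\<^esub> b \<otimes>\<^bsub>GS\<^esub> (Y1' [^]\<^bsub>GS\<^esub> c \<otimes>\<^bsub>GS\<^esub> (Y2' [^]\<^bsub>GS\<^esub> d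
     \<otimes>\<^bsub>GS\<^esub> (GS.z1 [^]\<^bsub>GS\<^esub> e \<otimes>\<^bsub>GS\<^esub> GS.z2 [^]\<^bsub>GS\<^esub> f))))"

lemma word_closed [simp]: "word a b c d e f \<in> carrier GS"
  by (simp add: word_def)

lemma \<pi>_word: "\<pi> (word a b c d e f) = base.normal_form a b c d e f"
  by (simp add: word_def base.normal_form_def GS.z1_def GS.z2_def \<pi>.hom_int_pow \<pi>_gen)

lemma word_trivial:
  assumes "\<forall>n\<in>{a, b, c, d, e, f}. int p dvd n" shows "word a b c d e f = \<one>\<^bsub>GS\<^esub>"
proof -
  have "g [^]\<^bsub>GS\<^esub> n = \<one>\<^bsub>GS\<^esub>" if "g \<in> carrier GS" "g [^]\<^bsub>GS\<^esub> p = \<one>\<^bsub>GS\<^esub>" "int p dvd n" for g and n :: int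
    using that GS.int_pow_pow[of g "int p"] by (auto simp: int_pow_int elim!: dvdE)
  then show ?thesis using assms GS.pow GS.z_pow by (simp add: word_def)
qed

lemma A_normal: "A \<lhd> GS"
proof (rule GS.normal_invI[OF A_subgroup])
  fix x a assume x: "x \<in> carrier GS" and a: "a \<in> A"
  then have "a \<in> center GS" using A_central by blast
  from GS.centerD[OF this x, symmetric] GS.center_closed[OF this]
  show "x \<otimes>\<^bsub>GS\<^esub> a \<otimes>\<^bsub>GS\<^esub> inv\<^bsub>GS\<^esub> x \<in> A" using x a by (simp add: GS.m_assoc)
qed

text \<open>In the quotient by \<open>A\<close> the generators satisfy the Heisenberg relations, so that every element of the quotient
  has a normal form.\<close>

lemma word_exhausts:
  assumes x: "x \<in> carrier GS" shows "\<exists>\<alpha>\<in>A. \<exists>a b c d e f. x = \<alpha> \<otimes>\<^bsub>GS\<^esub> word a b c d e f"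
proof -
  interpret A: normal A GS by (rule A_normal)
  define q where "q = r_coset GS A"
  interpret q: group_hom GS "GS Mod A" q
    unfolding q_def using A.r_coset_hom_Mod A.factorgroup_is_group
    by (simp add: group_hom_def group_hom_axioms_def)
  have q_A: "q a = \<one>\<^bsub>GS Mod A\<^esub>" if "a \<in> A" for a
    unfolding q_def one_FactGroup using that A.subset by (intro GS.coset_join2 A.is_subgroup) auto
  have q_centrals: "q c = \<one>\<^bsub>GS Mod A\<^esub>" if "c \<in> centrals" for c
    using that by (intro q_A) (auto simp: A_def intro: generate.incl)
  have absorb: "q (c \<otimes>\<^bsub>GS\<^esub> g) = q g" if "c \<in> centrals" "g \<in> carrier GS" for c g
  proof -
    have "c \<in> carrier GS" using that(1) centrals_closed by blast
    then have "q (c \<otimes>\<^bsub>GS\<^esub> g) = q c \<otimes>\<^bsub>GS Mod A\<^esub> q g" using that(2) by (rule q.hom_mult)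
    also have "\<dots> = q g" unfolding q_centrals[OF that(1)] by (rule q.H.l_one[OF q.hom_closed[OF that(2)]])
    finally show ?thesis .
  qed
  have w23: "GS.w2 \<in> centrals" "GS.w3 \<in> centrals" unfolding centrals_def GS.centrals_eq by simp_all
  note cent = q_centrals[unfolded centrals_def GS.centrals_eq]
  note [simp] = gs.gen_closed
  let ?C = "commutator GS" and ?D = "commutator (GS Mod A)"
  have hom_C: "?D (q x) (q y) = q (?C x y)" if "x \<in> carrier GS" "y \<in> carrier GS" for x y
    using that by simp
  have gen_Q: "generate (GS Mod A) {q X1', q X2', q Y1', q Y2'} = carrier (GS Mod A)"
  proof -
    have "generate (GS Mod A) (q ` {X1', X2', Y1', Y2'}) = q ` carrier GS"
      by (subst q.generate_img) (simp_all add: gs.generated_Gstar)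
    also have "\<dots> = carrier (GS Mod A)" by (simp add: q_def carrier_FactGroup)
    finally show ?thesis by simp
  qed
  have uv: "q (?C z s) = \<one>\<^bsub>GS Mod A\<^esub>" if "z \<in> {GS.z1, GS.z2}" "s \<in> {X1', X2', Y1', Y2'}" for z s
  proof -
    have z1: "q (?C GS.z1 t) = \<one>\<^bsub>GS Mod A\<^esub>" if "t \<in> {X1', X2', Y1', Y2'}" for t
      by (rule cent) (use that in blast)
    have z2: "q (?C GS.z2 s) = \<one>\<^bsub>GS Mod A\<^esub>"
      using that(2)
      by (elim insertE emptyE)
        (simp_all only: GS.z2_x GS.z2_y q.hom_int_pow GS.commutator_closed GS.z_closed gs.gen_closed z1 insert_iff
          q.H.int_pow_one simp_thms)
    show ?thesis
      using that(1) z1[OF that(2)] z2 by (elim insertE emptyE) (simp_all only:)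
  qed
  have "q z \<in> center (GS Mod A)" if z: "z \<in> {GS.z1, GS.z2}" for z
  proof (rule q.H.centerI_generated[OF _ gen_Q])
    have zc: "z \<in> carrier GS" using z by auto
    then show "q z \<in> carrier (GS Mod A)" by simp
    fix s assume "s \<in> {q X1', q X2', q Y1', q Y2'}"
    then obtain t where t: "s = q t" "t \<in> {X1', X2', Y1', Y2'}" by auto
    then have "t \<in> carrier GS" by auto
    then show "?D (q z) s = \<one>\<^bsub>GS Mod A\<^esub>" using uv[OF z t(2)] zc t(1) by (simp add: hom_C del: q.hom_commutator)
  qed auto
  then have zQ: "q GS.z1 \<in> center (GS Mod A)" "q GS.z2 \<in> center (GS Mod A)" by auto
  interpret Q: heisenberg_base "GS Mod A" p k "q X1'" "q X2'" "q Y1'" "q Y2'"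
  proof unfold_locales
    show "?D (q X2') (q X1') = \<one>\<^bsub>GS Mod A\<^esub>" "?D (q Y2') (q Y1') = \<one>\<^bsub>GS Mod A\<^esub>"
      using cent by (simp_all add: hom_C del: q.hom_commutator)
    show "?D (q Y2') (q X1') = ?D (q Y1') (q X2')"
      by (simp only: hom_C gs.gen_closed GS.y2x1 absorb w23 GS.z_closed GS.z2_def[symmetric])
    show "?D (q Y2') (q X2') = ?D (q Y1') (q X1') [^]\<^bsub>GS Mod A\<^esub> k"
      by (simp only: hom_C gs.gen_closed GS.y2x2 absorb w23 GS.z_closed GS.int_pow_closed q.hom_int_pow
          GS.z1_def[symmetric])
    show "?D (q Y1') (q X1') \<in> center (GS Mod A)" "?D (q Y1') (q X2') \<in> center (GS Mod A)"
      using zQ by (simp_all add: hom_C GS.z1_def GS.z2_def del: q.hom_commutator)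
  qed (auto simp: odd_p)
  obtain a b c d e f where "q x = Q.normal_form a b c d e f"
    using Q.normal_form_exhausts[OF gen_Q q.hom_closed[OF x]] by blast
  also have "\<dots> = q (word a b c d e f)"
    by (simp add: Q.normal_form_def word_def q.hom_int_pow GS.z1_def GS.z2_def)
  finally have "x \<in> r_coset GS A (word a b c d e f)"
    using GS.rcos_self[OF x A_subgroup] by (simp add: q_def)
  then obtain \<alpha> where "\<alpha> \<in> A" "x = \<alpha> \<otimes>\<^bsub>GS\<^esub> word a b c d e f" by (auto simp: r_coset_def)
  then show ?thesis by blast
qed

text \<open>A word in normal form that is trivial in the matrix group has all exponents divisible by \<open>p\<close>, and then it is
  already trivial in the presented group, where the \<open>x\<^sub>i\<close>, \<open>y\<^sub>i\<close>, \<open>z\<^sub>i\<close> have exponent \<open>p\<close>.\<close>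

lemma kernel_eq: "kernel GS UT \<pi> = A"
proof (intro equalityI subsetI)
  fix x assume "x \<in> kernel GS UT \<pi>"
  then have x: "x \<in> carrier GS" "\<pi> x = \<one>\<^bsub>UT\<^esub>" by (auto simp: kernel_def)
  obtain \<alpha> a b c d e f where w: "\<alpha> \<in> A" "x = \<alpha> \<otimes>\<^bsub>GS\<^esub> word a b c d e f" using word_exhausts[OF x(1)] by blast
  have \<alpha>: "\<alpha> \<in> carrier GS" using w A_subgroup subgroup.mem_carrier by metis
  then have "base.normal_form a b c d e f = \<one>\<^bsub>UT\<^esub>"
    using x(2) A_in_kernel[OF w(1)] by (simp add: w(2) \<pi>_word)
  then have "word a b c d e f = \<one>\<^bsub>GS\<^esub>" unfolding normal_form_eq_one_iff by (rule word_trivial)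
  then show "x \<in> A" using w \<alpha> by simp
next
  fix x assume "x \<in> A"
  then show "x \<in> kernel GS UT \<pi>"
    using A_in_kernel subgroup.mem_carrier[OF A_subgroup] by (simp add: kernel_def)
qed

lemma \<pi>_onto: "\<pi> ` carrier GS = carrier UT"
proof
  show "carrier UT \<subseteq> \<pi> ` carrier GS"
  proof
    fix g assume "g \<in> carrier UT"
    then obtain r s t where g: "g = heis R r s t" "r \<in> carrier R" "s \<in> carrier R" "t \<in> carrier R"
      by (auto simp: carrier_unitriangular_3)
    obtain a b c d e f where "r = lin c d" "s = lin a b" "t = lin e f"
      using lin_exhausts g(2-4) by metis
    then have "g = \<pi> (word a b c d e f)" by (simp add: g \<pi>_word normal_form_eq)
    then show "g \<in> \<pi> ` carrier GS" by simp
  qed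
qed auto

lemma A_finite_pairing: "finite A \<and> (\<exists>\<beta>. perfect_pairing GS A \<beta>)"
proof -
  define B where "B = GS\<lparr>carrier := A\<rparr>"
  interpret A: subgroup A GS by (rule A_subgroup)
  have "group B" unfolding B_def by (rule A.subgroup_is_group) (rule GS.is_group)
  moreover have "x \<otimes>\<^bsub>B\<^esub> y = y \<otimes>\<^bsub>B\<^esub> x" if "x \<in> carrier B" "y \<in> carrier B" for x y
  proof -
    have "x \<in> center GS" "y \<in> carrier GS" using that A_central A.subset by (auto simp: B_def)
    then show ?thesis using GS.centerD[of x y] by (simp add: B_def)
  qed
  ultimately interpret B: comm_group B by (rule group.group_comm_groupI)
  have "centrals \<subseteq> A" unfolding A_def by (auto intro: generate.incl)
  then have gen: "generate B centrals = A"
    unfolding B_def using GS.generate_consistent[OF _ A_subgroup, of centrals] by (simp add: A_def)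
  have "finite (generate B centrals) \<and> (\<exists>\<beta>. perfect_pairing B (generate B centrals) \<beta>)"
  proof (rule B.elementary_abelian_perfect_pairing[OF prime_p])
    show "finite centrals" unfolding centrals_def by (simp add: cover_centrals_def Let_def)
    show "centrals \<subseteq> carrier B" using \<open>centrals \<subseteq> A\<close> by (simp add: B_def)
    fix s assume "s \<in> centrals"
    then have "s [^]\<^bsub>GS\<^esub> p = \<one>\<^bsub>GS\<^esub>" unfolding centrals_def by (rule GS.centrals_pow)
    then show "s [^]\<^bsub>B\<^esub> p = \<one>\<^bsub>B\<^esub>" by (simp add: B_def nat_pow_def)
  qed
  then show ?thesis unfolding gen by (simp add: perfect_pairing_def B_def)
qed

lemma finite_GS: "finite (carrier GS)"
proof -
  have "GS Mod A \<cong> UT"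
    using \<pi>.FactGroup_iso[OF \<pi>_onto] by (simp add: kernel_eq)
  then have "finite (rcosets\<^bsub>GS\<^esub> A)"
    using iso_finite[of "GS Mod A" UT] finite_UT by (simp add: FactGroup_def)
  moreover have "finite K" if "K \<in> rcosets\<^bsub>GS\<^esub> A" for K
    using that A_finite_pairing by (auto simp: RCOSETS_def r_coset_def)
  ultimately have "finite (\<Union>(rcosets\<^bsub>GS\<^esub> A))" by blast
  then show ?thesis by (simp add: GS.rcosets_part_G[OF A_subgroup])
qed

text \<open>A cocycle with values in \<open>\<complex>\<^sup>\<times>\<close> defines a central extension of the Heisenberg group; the
  multiplicative group being divisible, the generators have lifts of order \<open>p\<close> there, and all relations
  of the presentation hold for these lifts.\<close>

lemma lift_to_extension:
  assumes "f \<in> cocycles2 UT complex_units"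
  shows "\<exists>\<Phi>\<in>hom GS (cocycle_extension UT complex_units f). \<forall>x\<in>carrier GS. fst (\<Phi> x) = \<pi> x"
proof -
  interpret coh: cohomology UT complex_units
    using UT.is_group comm_group_complex_units by (simp add: cohomology_def)
  interpret f: central_cocycle UT complex_units f by (rule coh.central_cocycle[OF assms])
  have p0: "p > 0" using prime_p by (simp add: prime_gt_0_nat)
  note lift = f.lift_with_order[OF _ _ complex_units_divisible[OF _ p0]]
  obtain a1 where a1: "a1 \<in> carrier f.E" "fst a1 = mx1" "a1 [^]\<^bsub>f.E\<^esub> p = \<one>\<^bsub>f.E\<^esub>"
    by (rule lift[OF matrices_closed(1) matrices_pow(1)])
  obtain a2 where a2: "a2 \<in> carrier f.E" "fst a2 = mx2" "a2 [^]\<^bsub>f.E\<^esub> p = \<one>\<^bsub>f.E\<^esub>"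
    by (rule lift[OF matrices_closed(2) matrices_pow(2)])
  obtain b1 where b1: "b1 \<in> carrier f.E" "fst b1 = my1" "b1 [^]\<^bsub>f.E\<^esub> p = \<one>\<^bsub>f.E\<^esub>"
    by (rule lift[OF matrices_closed(3) matrices_pow(3)])
  obtain b2 where b2: "b2 \<in> carrier f.E" "fst b2 = my2" "b2 [^]\<^bsub>f.E\<^esub> p = \<one>\<^bsub>f.E\<^esub>"
    by (rule lift[OF matrices_closed(4) matrices_pow(4)])
  have "heisenberg_cover f.E p k a1 a2 b1 b2"
    by (rule base.cover_of_central_extension[OF f.fst_hom f.kernel_central a1(1) a2(1) b1(1) b2(1)
          a1(2) a2(2) b1(2) b2(2) a1(3) a2(3) b1(3) b2(3)])
  then obtain \<Phi> where \<Phi>: "\<Phi> \<in> hom GS f.E" "\<Phi> X1' = a1" "\<Phi> X2' = a2" "\<Phi> Y1' = b1" "\<Phi> Y2' = b2"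
    by (rule gs.Gstar_lift)
  have "fst \<circ> \<Phi> \<in> hom GS UT"
    using hom_compose[OF \<Phi>(1)] f.fst_hom by (simp add: group_hom_def group_hom_axioms_def)
  then have hom': "group_hom GS UT (fst \<circ> \<Phi>)"
    by (simp add: group_hom_def group_hom_axioms_def)
  have "\<pi> x = (fst \<circ> \<Phi>) x" if "x \<in> carrier GS" for x
    by (rule \<pi>.hom_eq_on_generate[OF hom', of "{X1', X2', Y1', Y2'}"])
      (use that in \<open>auto simp: gs.generated_Gstar \<pi>_gen \<Phi> a1 a2 b1 b2 gs.gen_closed\<close>)
  then show ?thesis using \<Phi>(1) by auto
qed

lemma representation_group_GS: "representation_group GS UT"
  unfolding representation_group_def
proof (intro conjI exI[of _ A])
  obtain \<beta> where "perfect_pairing GS A \<beta>" using A_finite_pairing by blast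
  then show "GS\<lparr>carrier := A\<rparr> \<cong> H2 UT complex_units"
    by (intro transgression_isomorphism[OF \<pi>.group_hom_axioms \<pi>_onto kernel_eq[symmetric] A_central A_derived _ lift_to_extension])
  show "GS Mod A \<cong> UT"
    using \<pi>.FactGroup_iso[OF \<pi>_onto] by (simp add: kernel_eq)
qed (use finite_UT finite_GS A_subgroup A_central A_derived in auto)

section \<open>Nilpotency class\<close>

text \<open>In the extension by \<open>class3_cocycle\<close> the products of the images of \<open>z\<^sub>1\<close> and \<open>x\<^sub>1\<close> in the two orders differ by
  \<open>2\<close> in the kernel, and \<open>2\<close> is not zero in \<open>R\<close> because \<open>p\<close> is odd.  The standard lifts of the generators have order
  dividing \<open>p\<close>, because the cocycle vanishes on pairs of powers of the same generator.\<close>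

lemma v1_nontrivial: "commutator GS GS.z1 X1' \<noteq> \<one>\<^bsub>GS\<^esub>"
proof
  assume v1: "commutator GS GS.z1 X1' = \<one>\<^bsub>GS\<^esub>"
  interpret f: central_cocycle UT "add_monoid R" class3_cocycle by (rule central_cocycle_class3)
  have e: "f.e = \<zero>" by (simp add: f.e_def heis_one)
  have one: "\<one>\<^bsub>f.E\<^esub> = (heis R \<zero> \<zero> \<zero>, \<zero>)"
    unfolding f.E_simps(3) e heis_one a_inv_def[symmetric] by simp
  have pow_x: "(heis R \<zero> b \<zero>, \<zero>) [^]\<^bsub>f.E\<^esub> n = (heis R \<zero> b \<zero> [^]\<^bsub>UT\<^esub> n, \<zero>)" if b: "b \<in> carrier R" for b and n :: nat
  proof (induction n)
    case (Suc n)
    have "heis R \<zero> b \<zero> [^]\<^bsub>UT\<^esub> n = heis R \<zero> (add_pow R (int n) b) \<zero>"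
      using heis_int_pow(2)[OF b, of "int n"] by (simp add: int_pow_int)
    then show ?case using Suc b by simp
  qed (simp add: one heis_one del: f.E_simps)
  have pow_y: "(heis R a \<zero> \<zero>, \<zero>) [^]\<^bsub>f.E\<^esub> n = (heis R a \<zero> \<zero> [^]\<^bsub>UT\<^esub> n, \<zero>)" if a: "a \<in> carrier R" for a and n :: nat
  proof (induction n)
    case (Suc n)
    have "heis R a \<zero> \<zero> [^]\<^bsub>UT\<^esub> n = heis R (add_pow R (int n) a) \<zero> \<zero>"
      using heis_int_pow(1)[OF a, of "int n"] by (simp add: int_pow_int)
    then show ?case using Suc a by simp
  qed (simp add: one heis_one del: f.E_simps)
  have "heisenberg_cover f.E p k (mx1, \<zero>) (mx2, \<zero>) (my1, \<zero>) (my2, \<zero>)"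
  proof (rule base.cover_of_central_extension[OF f.fst_hom f.kernel_central])
    show "(mx1, \<zero>) [^]\<^bsub>f.E\<^esub> p = \<one>\<^bsub>f.E\<^esub>" "(mx2, \<zero>) [^]\<^bsub>f.E\<^esub> p = \<one>\<^bsub>f.E\<^esub>"
      using matrices_pow pow_x unfolding mx1_def mx2_def one heis_one by simp_all
    show "(my1, \<zero>) [^]\<^bsub>f.E\<^esub> p = \<one>\<^bsub>f.E\<^esub>" "(my2, \<zero>) [^]\<^bsub>f.E\<^esub> p = \<one>\<^bsub>f.E\<^esub>"
      using matrices_pow pow_y unfolding my1_def my2_def one heis_one by simp_all
  qed auto
  then obtain \<Phi> where \<Phi>: "\<Phi> \<in> hom GS f.E" "\<Phi> X1' = (mx1, \<zero>)" "\<Phi> Y1' = (my1, \<zero>)"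
    by (rule gs.Gstar_lift)
  interpret \<Phi>: group_hom GS f.E \<Phi>
    using \<Phi>(1) by (simp add: group_hom_def group_hom_axioms_def f.group_E)
  interpret fst: group_hom f.E UT fst by (rule f.fst_hom)
  have "fst (\<Phi> GS.z1) = commutator UT my1 mx1"
    using fst.hom_commutator[OF \<Phi>.hom_closed[of Y1'] \<Phi>.hom_closed[of X1']]
    by (simp add: GS.z1_def \<Phi>(2,3) del: f.E_simps)
  moreover have "snd (\<Phi> GS.z1) \<in> carrier R" using \<Phi>.hom_closed[OF GS.z_closed(1)] by auto
  ultimately obtain r where r: "\<Phi> GS.z1 = (heis R \<zero> \<zero> \<one>, r)" "r \<in> carrier R"
    using matrices_commutators(1) by (metis prod.collapse)
  have "GS.z1 \<otimes>\<^bsub>GS\<^esub> X1' = X1' \<otimes>\<^bsub>GS\<^esub> GS.z1"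
    using v1 by (simp add: GS.commutator_eq_one_iff)
  then have "\<Phi> GS.z1 \<otimes>\<^bsub>f.E\<^esub> \<Phi> X1' = \<Phi> X1' \<otimes>\<^bsub>f.E\<^esub> \<Phi> GS.z1"
    using \<Phi>.hom_mult[of GS.z1 X1'] \<Phi>.hom_mult[of X1' GS.z1] by (simp del: f.E_simps \<Phi>.hom_mult)
  then have "r \<oplus> (\<one> \<oplus> \<one>) = r"
    using r(2) by (simp add: r(1) \<Phi>(2) mx1_def)
  then have "\<one> \<oplus> \<one> = \<zero>" using r(2) by simp
  then have "lin 2 0 = \<zero>" using lin_add[of 1 0 1 0] by (simp add: lin_1_0)
  then have "int p dvd 2" by (simp add: lin_zero_iff)
  then have "p dvd 2" by (metis int_dvd_int_iff of_nat_numeral)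
  then show False using odd_p prime_gt_1_nat[OF prime_p] by (auto dest: dvd_imp_le simp: le_less numeral_2_eq_2 less_Suc_eq)
qed

text \<open>The projection sends commutators to the centre of the matrix group and double commutators to \<open>1\<close>; the latter
  therefore lie in \<open>A\<close>, which is central.\<close>

lemma has_nilpotency_class_GS: "has_nilpotency_class GS 3"
proof -
  let ?N = "{x \<in> carrier GS. \<exists>c\<in>carrier R. \<pi> x = heis R \<zero> \<zero> c}"
  have N: "subgroup ?N GS"
  proof (rule GS.subgroupI)
    show "?N \<noteq> {}" using heis_one by (auto intro!: exI[of _ "\<one>\<^bsub>GS\<^esub>"] bexI[of _ \<zero>])
  next
    fix x assume "x \<in> ?N"
    then obtain c where c: "x \<in> carrier GS" "c \<in> carrier R" "\<pi> x = heis R \<zero> \<zero> c" by auto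
    have "inv\<^bsub>UT\<^esub> heis R \<zero> \<zero> c = heis R \<zero> \<zero> (\<ominus> c)"
      using c(2) by (intro UT.inv_equality) (auto simp: heis_one l_neg)
    then show "inv\<^bsub>GS\<^esub> x \<in> ?N" using c by auto
  qed auto
  have comm_N: "commutator GS x y \<in> ?N" if "x \<in> carrier GS" "y \<in> carrier GS" for x y
  proof -
    have "\<pi> x \<in> carrier UT" "\<pi> y \<in> carrier UT" using that by auto
    then obtain a b c a' b' c' where "\<pi> x = heis R a b c" "\<pi> y = heis R a' b' c'"
      "a \<in> carrier R" "b \<in> carrier R" "c \<in> carrier R" "a' \<in> carrier R" "b' \<in> carrier R" "c' \<in> carrier R"
      unfolding carrier_unitriangular_3 by blast
    then show ?thesis using that by (auto simp: commutator_heis)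
  qed
  have 1: "lower_central GS 1 \<subseteq> ?N"
    unfolding One_nat_def lower_central.simps
    by (rule GS.generate_subgroup_incl[OF _ N]) (use comm_N in blast)
  have comm_A: "commutator GS x y \<in> A" if "x \<in> ?N" "y \<in> carrier GS" for x y
  proof -
    from that obtain c where "x \<in> carrier GS" "c \<in> carrier R" "\<pi> x = heis R \<zero> \<zero> c" by auto
    then have "commutator GS x y \<in> kernel GS UT \<pi>"
      using that UT.commutator_center[OF heis_central] by (simp add: kernel_def)
    then show ?thesis by (simp add: kernel_eq)
  qed
  have 2: "lower_central GS 2 \<subseteq> A"
    unfolding numeral_2_eq_2 lower_central.simps(2)[of _ "Suc 0"]
    by (rule GS.generate_subgroup_incl[OF _ A_subgroup]) (use comm_A 1[unfolded One_nat_def] in blast)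
  have "commutator GS x y = \<one>\<^bsub>GS\<^esub>" if "x \<in> lower_central GS (Suc (Suc 0))" "y \<in> carrier GS" for x y
    using that 2[unfolded numeral_2_eq_2] A_central by (intro GS.commutator_center) blast+
  then have "lower_central GS 3 \<subseteq> {\<one>\<^bsub>GS\<^esub>}"
    unfolding numeral_3_eq_3 lower_central.simps(2)[of _ "Suc (Suc 0)"]
    by (intro GS.generate_subgroup_incl[OF _ GS.triv_subgroup]) blast
  moreover have "\<one>\<^bsub>GS\<^esub> \<in> lower_central GS 3"
    unfolding numeral_3_eq_3 lower_central.simps(2) by (rule generate.one)
  ultimately have 3: "lower_central GS 3 = {\<one>\<^bsub>GS\<^esub>}" by blast
  have z1: "GS.z1 \<in> lower_central GS 1"
    unfolding One_nat_def lower_central.simps GS.z1_def by (rule generate.incl) (use GS.closed in blast)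
  have v1: "commutator GS GS.z1 X1' \<in> lower_central GS 2"
    unfolding numeral_2_eq_2 lower_central.simps(2)[of _ "Suc 0"]
    by (rule generate.incl) (use z1[unfolded One_nat_def] GS.closed(1) in blast)
  have "GS.z1 \<noteq> \<one>\<^bsub>GS\<^esub>"
    using v1_nontrivial GS.commutator_one(2)[OF GS.closed(1)] by metis
  moreover have "n = 0 \<or> n = 1 \<or> n = 2" if "n < 3" for n :: nat using that by auto
  ultimately have "lower_central GS n \<noteq> {\<one>\<^bsub>GS\<^esub>}" if "n < 3" for n
    using that z1 v1 v1_nontrivial GS.z_closed(1) by (metis lower_central.simps(1) singletonD)
  then show ?thesis using 3 by (simp add: has_nilpotency_class_def)
qed

end

theorem theorem4p2:
  fixes p :: nat and k :: int
  assumes "Factorial_Ring.prime p" and "odd p" and "\<not> QuadRes (int p) k"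
  shows "field (quadratic_ext p k) \<and> card (carrier (quadratic_ext p k)) = p ^ 2 \<and>
    representation_group (Gstar p k) (unitriangular 3 (quadratic_ext p k)) \<and>
    has_nilpotency_class (Gstar p k) 3"
proof -
  obtain \<tau> where "quadratic_coordinates (quadratic_ext p k) p k \<tau>"
    using quadratic_ext_coordinates[OF assms(1,2)] by blast
  then interpret L: quadratic_coordinates "quadratic_ext p k" p k \<tau> .
  interpret gs: gstar p k by unfold_locales (rule assms)
  obtain \<pi> where "\<pi> \<in> hom (Gstar p k) L.UT"
    "\<pi> (gs.gen X1) = L.mx1" "\<pi> (gs.gen X2) = L.mx2" "\<pi> (gs.gen Y1) = L.my1" "\<pi> (gs.gen Y2) = L.my2"
    by (rule gs.Gstar_lift[OF L.heisenberg_cover_UT])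
  then interpret gstar_projection "quadratic_ext p k" p k \<tau> \<pi> by unfold_locales
  show ?thesis
    using L.field_if_nonresidue[OF assms(3)] L.card_carrier representation_group_GS has_nilpotency_class_GS
    by simp
qed

end
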